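(* Let $a\in L^1(0,1)$ satisfy $\int_0^1 a(x)\,dx<0$ and $a(x)>0$ on a set of positive measure. Let $f\in\mathcal C(\mathbb R)$ satisfy $f(0)=0$, $f(u)>0$ for $u>0$, and, for some constants $h>0$ and $q\in(0,1)$, $$\lim_{u\to0^+}\frac{f(u)}{u}=1,\qquad \lim_{u\to\infty}\frac{f(u)}{u^{-q}}=h.$$ Let $\lambda_0>0$ be the positive principal eigenvalue of $-\varphi''=\lambda a(x)\varphi$ in $(0,1)$, $\varphi'(0)=\varphi'(1)=0$. Then, for every $\lambda>\lambda_0$, the problem $$-\left(\frac{u'}{\sqrt{1+(u')^2}}\right)'=\lambda a(x)f(u),\quad 0<x<1,\qquad u'(0)=u'(1)=0,$$ has at least one positive (bounded variation) solution.
   Context: $\lambda_0$: under the stated assumptions on $a$, the linear weighted problem $-\varphi''=\lambda a(x)\varphi$ in $(0,1)$, $\varphi'(0)=\varphi'(1)=0$, admits, besides $\lambda=0$, a unique positive eigenvalue $\lambda_0>0$ with a strictly positive eigenfunction (unique up to a positive multiplicative constant); this is the positive principal eigenvalue. A function $u\in BV(0,1)$ is a bounded variation solution of the quasilinear problem (for a given $\lambda$) if $$\int_0^1 \frac{Du^a\,D\phi^a}{\sqrt{1+(Du^a)^2}}\,dx+\int_0^1\frac{Du^s}{|Du^s|}\,D\phi^s=\int_0^1\lambda a f(u)\phi\,dx$$ for every $\phi\in BV(0,1)$ such that $|D\phi^s|$ is absolutely continuous with respect to $|Du^s|$. Here, for $v\in BV(0,1)$, $Dv=Dv^a\,dx+Dv^s$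 is the Lebesgue decomposition of the measure $Dv$, and $\frac{Dv^s}{|Dv^s|}$ is the density of $Dv^s$ with respect to its total variation $|Dv^s|$. A solution $u$ is positive if $\operatorname{ess\,inf}u\ge0$ and $\operatorname{ess\,sup}u>0$. *)

theory Defs
  imports "HOL-Analysis.Analysis" "HOL-Probability.Essential_Supremum"
begin

section \<open>Finite signed measures\<close>

text \<open>
  A finite signed measure on the measurable space underlying \<open>M\<close> is a real-valued, countably
  additive set function on \<open>sets M\<close>. Its values outside \<open>sets M\<close> are irrelevant, and only
  \<open>space M\<close> and \<open>sets M\<close> are used.
\<close>

definition signed_measure :: "'a measure \<Rightarrow> ('a set \<Rightarrow> real) \<Rightarrow> bool" where
  "signed_measure M \<nu> \<longleftrightarrow>
     \<nu> {} = 0 \<and>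
     (\<forall>A :: nat \<Rightarrow> 'a set. range A \<subseteq> sets M \<longrightarrow> disjoint_family A \<longrightarrow>
        (\<lambda>n. \<nu> (A n)) sums \<nu> (\<Union>n. A n))"

definition total_variation :: "'a measure \<Rightarrow> ('a set \<Rightarrow> real) \<Rightarrow> 'a measure" where
  "total_variation M \<nu> =
     measure_of (space M) (sets M)
       (\<lambda>A. SUP P \<in> {P. finite P \<and> P \<subseteq> sets M \<and> disjoint P \<and> \<Union>P = A}.
              \<Sum>B\<in>P. ennreal \<bar>\<nu> B\<bar>)"

text \<open>The density \<open>\<nu>/|\<nu>|\<close>, which is determined up to a \<open>|\<nu>|\<close>-null set.\<close>

definition polar_density :: "'a measure \<Rightarrow> ('a set \<Rightarrow> real) \<Rightarrow> 'a \<Rightarrow> real" where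
  "polar_density M \<nu> =
     (SOME \<sigma>. integrable (total_variation M \<nu>) \<sigma> \<and>
            (\<forall>A\<in>sets M. \<nu> A = (LINT x:A|total_variation M \<nu>. \<sigma> x)))"

definition signed_integral :: "'a measure \<Rightarrow> ('a set \<Rightarrow> real) \<Rightarrow> ('a \<Rightarrow> real) \<Rightarrow> real" where
  "signed_integral M \<nu> g = (LINT x|total_variation M \<nu>. g x * polar_density M \<nu> x)"


section \<open>Functions of bounded variation on the unit interval\<close>

text \<open>
  Elements of \<open>L\<^sup>1(0,1)\<close> and \<open>BV(0,1)\<close> are represented by functions on the real line; only
  their values almost everywhere on the open interval matter.
\<close>

abbreviation unit_ivl :: "real set" where
  "unit_ivl \<equiv> {0<..<1}"

abbreviation borel_ivl :: "real measure" where
  "borel_ivl \<equiv> restrict_space borel unit_ivl"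

definition test_fun :: "(real \<Rightarrow> real) \<Rightarrow> bool" where
  "test_fun \<psi> \<longleftrightarrow>
     \<psi> C1_differentiable_on UNIV \<and>
     compact (closure {x. \<psi> x \<noteq> 0}) \<and> closure {x. \<psi> x \<noteq> 0} \<subseteq> unit_ivl"

definition has_distr_deriv :: "(real \<Rightarrow> real) \<Rightarrow> (real set \<Rightarrow> real) \<Rightarrow> bool" where
  "has_distr_deriv v \<nu> \<longleftrightarrow>
     signed_measure borel_ivl \<nu> \<and>
     (\<forall>\<psi>. test_fun \<psi> \<longrightarrow>
        (LINT x:unit_ivl|lebesgue. v x * deriv \<psi> x) = - signed_integral borel_ivl \<nu> \<psi>)"

definition BV :: "(real \<Rightarrow> real) set" where
  "BV = {v. set_integrable lebesgue unit_ivl v \<and> (\<exists>\<nu>. has_distr_deriv v \<nu>)}"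

definition distr_deriv :: "(real \<Rightarrow> real) \<Rightarrow> real set \<Rightarrow> real" where
  "distr_deriv v = (SOME \<nu>. has_distr_deriv v \<nu>)"

text \<open>The decomposition \<open>\<nu> = g dx + \<mu>\<close> with \<open>\<mu>\<close> singular to Lebesgue measure.\<close>

definition lebesgue_decomp ::
  "(real set \<Rightarrow> real) \<Rightarrow> (real \<Rightarrow> real) \<Rightarrow> (real set \<Rightarrow> real) \<Rightarrow> bool" where
  "lebesgue_decomp \<nu> g \<mu> \<longleftrightarrow>
     set_integrable lebesgue unit_ivl g \<and>
     signed_measure borel_ivl \<mu> \<and>
     (\<exists>N\<in>sets borel_ivl. emeasure lebesgue N = 0 \<and>
        emeasure (total_variation borel_ivl \<mu>) (unit_ivl - N) = 0) \<and>
     (\<forall>A\<in>sets borel_ivl. \<nu> A = (LINT x:A|lebesgue. g x) + \<mu> A)"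

text \<open>
  \<open>deriv_ac v\<close> is the function \<open>Dv\<^sup>a\<close> (unique almost everywhere) and \<open>deriv_sing v\<close> is the
  signed measure \<open>Dv\<^sup>s\<close> (unique on the Borel subsets of the interval).
\<close>

definition deriv_ac :: "(real \<Rightarrow> real) \<Rightarrow> real \<Rightarrow> real" where
  "deriv_ac v = fst (SOME (g, \<mu>). lebesgue_decomp (distr_deriv v) g \<mu>)"

definition deriv_sing :: "(real \<Rightarrow> real) \<Rightarrow> real set \<Rightarrow> real" where
  "deriv_sing v = snd (SOME (g, \<mu>). lebesgue_decomp (distr_deriv v) g \<mu>)"


section \<open>Bounded variation solutions\<close>

text \<open>
  The term \<open>\<integral> (Du\<^sup>s/|Du\<^sup>s|) D\<phi>\<^sup>s\<close> is the integral of the density \<open>Du\<^sup>s/|Du\<^sup>s|\<close> against the signed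
  measure \<open>D\<phi>\<^sup>s\<close>; it does not depend on the version of the density because \<open>|D\<phi>\<^sup>s|\<close> is absolutely
  continuous with respect to \<open>|Du\<^sup>s|\<close>. The library relation \<open>absolutely_continuous M N\<close> means that
  \<open>N\<close> is absolutely continuous with respect to \<open>M\<close>.
\<close>

definition bv_solution ::
  "(real \<Rightarrow> real) \<Rightarrow> (real \<Rightarrow> real) \<Rightarrow> real \<Rightarrow> (real \<Rightarrow> real) \<Rightarrow> bool" where
  "bv_solution a f lam u \<longleftrightarrow>
     u \<in> BV \<and>
     (\<forall>\<phi>\<in>BV.
        absolutely_continuous (total_variation borel_ivl (deriv_sing u))
                              (total_variation borel_ivl (deriv_sing \<phi>)) \<longrightarrow>
        (LINT x:unit_ivl|lebesgue.
            deriv_ac u x * deriv_ac \<phi> x / sqrt (1 + (deriv_ac u x)\<^sup>2))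
        + signed_integral borel_ivl (deriv_sing \<phi>) (polar_density borel_ivl (deriv_sing u))
        = (LINT x:unit_ivl|lebesgue. lam * a x * f (u x) * \<phi> x))"

definition positive_fun :: "(real \<Rightarrow> real) \<Rightarrow> bool" where
  "positive_fun u \<longleftrightarrow>
     - esssup (lebesgue_on unit_ivl) (\<lambda>x. - ereal (u x)) \<ge> 0 \<and>
     esssup (lebesgue_on unit_ivl) (\<lambda>x. ereal (u x)) > 0"


section \<open>The positive principal eigenvalue\<close>

text \<open>
  Since the weight is only integrable, \<open>-\<phi>'' = lam a \<phi>\<close> is understood in the Caratheodory sense:
  \<open>\<phi>\<close> is in \<open>W\<^sup>2\<^sup>,\<^sup>1(0,1)\<close> and the equation holds almost everywhere. Here \<open>p\<close> is \<open>\<phi>'\<close>, and \<open>r\<close>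
  is the integrable almost everywhere derivative of the absolutely continuous function \<open>p\<close>.
\<close>

definition neumann_eigenfunction ::
  "(real \<Rightarrow> real) \<Rightarrow> real \<Rightarrow> (real \<Rightarrow> real) \<Rightarrow> bool" where
  "neumann_eigenfunction a lam \<phi> \<longleftrightarrow>
     (\<exists>x\<in>{0..1}. \<phi> x \<noteq> 0) \<and>
     (\<exists>p r.
        (\<forall>x\<in>{0..1}. (\<phi> has_real_derivative p x) (at x within {0..1})) \<and>
        set_integrable lebesgue unit_ivl r \<and>
        (\<forall>x\<in>{0..1}. p x = p 0 + (LINT t:{0<..<x}|lebesgue. r t)) \<and>
        (AE x in lebesgue. x \<in> unit_ivl \<longrightarrow> - r x = lam * a x * \<phi> x) \<and>
        p 0 = 0 \<and> p 1 = 0)"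

definition positive_principal_eigenvalue :: "(real \<Rightarrow> real) \<Rightarrow> real \<Rightarrow> bool" where
  "positive_principal_eigenvalue a lam \<longleftrightarrow>
     lam > 0 \<and> (\<exists>\<phi>. neumann_eigenfunction a lam \<phi> \<and> (\<forall>x\<in>{0..1}. \<phi> x > 0))"

end

theory Submission
  imports Defs "HOL-Probability.Helly_Selection"
begin

text \<open>
  Bounded variation solutions are the critical points of the energy
  \<open>\<integral> (\<surd>(1 + u'\<^sup>2) - 1) - lam \<integral> a F(u)\<close>, where \<open>F' = f\<close> on the positive half line and
  \<open>F = 0\<close> on the negative one. The energy is coercive: raising \<open>u\<close> by a large constant is
  penalised because \<open>\<integral> a < 0\<close> and \<open>F\<close> is unbounded, and oscillation costs its total variation
  but gains only sublinearly because \<open>f\<close> vanishes at infinity. For \<open>lam > lam0\<close> a small multiple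
  of the principal eigenfunction has negative energy, so that the zero function is not a minimiser.

  The minimisation is carried out on step functions that are constant on the \<open>n\<close> cells
  \<open>[i/n, (i+1)/n)\<close>. There a nonnegative minimiser \<open>u\<^sub>n\<close> exists by compactness, with bounds on its
  values and its variation that do not depend on \<open>n\<close> (\<open>discrete_energy_coercive\<close>). Moving all
  nodes up to the \<open>k\<close>-th at once gives the Euler-Lagrange equations in summed form
  (\<open>discrete_energy_Euler_Lagrange\<close>): the flux \<open>p\<^sub>n(x) = - lam \<integral>\<^sub>0\<^sup>x a f(u\<^sub>n)\<close> takes at each
  interior node the value \<open>s/\<surd>(1 + s\<^sup>2)\<close> for the slope \<open>s\<close> across that node, and \<open>p\<^sub>n(1) = 0\<close>.

  Helly's selection theorem makes \<open>u\<^sub>n\<close> converge almost everywhere to a function \<open>u\<close> of bounded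
  variation, and \<open>p\<^sub>n\<close> then converges uniformly to \<open>p(x) = - lam \<integral>\<^sub>0\<^sup>x a f(u)\<close>. The relation
  between flux and slope is monotone, and in the following form it survives the limit
  (\<open>continuum_limit\<close>): if \<open>p > \<xi>/\<surd>(1 + \<xi>\<^sup>2)\<close> on \<open>[x,y]\<close> then \<open>u(y) - u(x) \<ge> \<xi> (y - x)\<close>, and
  likewise with all signs reversed. So \<open>Du \<ge> \<xi> dx\<close> as measures on the open set where \<open>p\<close>
  exceeds \<open>\<xi>/\<surd>(1 + \<xi>\<^sup>2)\<close>. Letting \<open>\<xi>\<close> run through the rationals, the absolutely continuous part
  of \<open>Du\<close> satisfies \<open>Du\<^sup>a/\<surd>(1 + (Du\<^sup>a)\<^sup>2) = p\<close>, while the singular part can only live where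
  \<open>\<bar>p\<bar> = 1\<close> and has density \<open>p\<close> with respect to its variation (\<open>flux_inclusion\<close>). Hence the left
  hand side of the weak formulation is \<open>\<integral> p dD\<phi>\<close>, and integration by parts against the absolutely
  continuous \<open>p\<close>, which vanishes at both end points, yields the right hand side
  (\<open>BV_integration_by_parts\<close>).

  For the last step every test function of bounded variation is needed. By the lemma of
  du Bois-Reymond it agrees almost everywhere with a constant plus the distribution function of
  its derivative, and Fubini's theorem gives \<open>\<integral> p d\<nu> = - \<integral> p'(x) \<nu>((0,x]) dx\<close>
  (\<open>signed_integral_primitive\<close>). The right hand side is visibly linear in \<open>\<nu>\<close>.
\<close>

section \<open>Signed measures and their total variation\<close>

lemma signed_measure_empty: "signed_measure M \<nu> \<Longrightarrow> \<nu> {} = 0"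
  by (simp add: signed_measure_def)

lemma signed_measure_sums:
  assumes "signed_measure M \<nu>" "range (A :: nat \<Rightarrow> 'a set) \<subseteq> sets M" "disjoint_family A"
  shows "(\<lambda>n. \<nu> (A n)) sums \<nu> (\<Union>n. A n)"
  using assms by (simp add: signed_measure_def)

lemma signed_measure_Un:
  assumes \<nu>: "signed_measure M \<nu>" and A: "A \<in> sets M" and B: "B \<in> sets M" and AB: "A \<inter> B = {}"
  shows "\<nu> (A \<union> B) = \<nu> A + \<nu> B"
proof -
  have "(\<lambda>n. \<nu> (binaryset A B n)) sums \<nu> (\<Union>n. binaryset A B n)"
    using A B AB signed_measure_empty[OF \<nu>]
    by (intro signed_measure_sums[OF \<nu>])
       (auto simp: range_binaryset_eq disjoint_family_on_def binaryset_def)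
  moreover have "(\<lambda>n. \<nu> (binaryset A B n)) sums (\<nu> A + \<nu> B)"
    by (rule binaryset_sums) (rule signed_measure_empty[OF \<nu>])
  ultimately show ?thesis
    by (metis UN_binaryset_eq sums_unique2)
qed

lemma signed_measure_Diff:
  assumes \<nu>: "signed_measure M \<nu>" and A: "A \<in> sets M" and B: "B \<in> sets M" and AB: "B \<subseteq> A"
  shows "\<nu> (A - B) = \<nu> A - \<nu> B"
proof -
  have "\<nu> (B \<union> (A - B)) = \<nu> B + \<nu> (A - B)"
    using A B by (intro signed_measure_Un[OF \<nu>]) auto
  moreover have "B \<union> (A - B) = A" using AB by auto
  ultimately show ?thesis by simp
qed

lemma signed_measure_linear_combination:
  assumes "signed_measure M \<nu>" "signed_measure M \<mu>"
  shows "signed_measure M (\<lambda>A. \<alpha> * \<nu> A + \<beta> * \<mu> A)"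
  unfolding signed_measure_def
proof (intro conjI allI impI)
  fix A :: "nat \<Rightarrow> 'a set" assume A: "range A \<subseteq> sets M" "disjoint_family A"
  show "(\<lambda>n. \<alpha> * \<nu> (A n) + \<beta> * \<mu> (A n)) sums (\<alpha> * \<nu> (\<Union>n. A n) + \<beta> * \<mu> (\<Union>n. A n))"
    by (intro sums_add sums_mult signed_measure_sums[OF assms(1) A] signed_measure_sums[OF assms(2) A])
qed (simp add: signed_measure_empty[OF assms(1)] signed_measure_empty[OF assms(2)])

lemma signed_measure_restrict:
  assumes \<nu>: "signed_measure M \<nu>" and N: "N \<in> sets M"
  shows "signed_measure M (\<lambda>A. \<nu> (A \<inter> N))"
  unfolding signed_measure_def
proof (intro conjI allI impI)
  show "\<nu> ({} \<inter> N) = 0" using signed_measure_empty[OF \<nu>] by simp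
  fix A :: "nat \<Rightarrow> 'a set" assume A: "range A \<subseteq> sets M" "disjoint_family A"
  have "(\<lambda>n. \<nu> (A n \<inter> N)) sums \<nu> (\<Union>n. A n \<inter> N)"
    using A N by (intro signed_measure_sums[OF \<nu>]) (auto simp: disjoint_family_on_def)
  then show "(\<lambda>n. \<nu> (A n \<inter> N)) sums \<nu> ((\<Union>n. A n) \<inter> N)" by simp
qed

text \<open>
  The greedy choice in the proof of the Hahn decomposition. The values of \<open>\<nu>\<close> on subsets of \<open>E\<close>
  are not yet known to be bounded, which is why the quantity to be halved is capped at \<open>1\<close>.
\<close>

lemma signed_measure_almost_maximal_subset:
  assumes \<nu>: "signed_measure M \<nu>" and E: "E \<in> sets M"
  shows "\<exists>A. A \<in> sets M \<and> A \<subseteq> E \<and> 0 \<le> \<nu> A \<and>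
             (\<forall>A'\<in>sets M. A' \<subseteq> E \<longrightarrow> min 1 (\<nu> A' / 2) \<le> \<nu> A)"
proof (cases "\<exists>A\<in>sets M. A \<subseteq> E \<and> 1 \<le> \<nu> A")
  case True
  then show ?thesis by (meson min.cobounded1 order_trans zero_le_one)
next
  case False
  define S where "S = \<nu> ` {A\<in>sets M. A \<subseteq> E}"
  have z: "0 \<in> S"
    unfolding S_def using signed_measure_empty[OF \<nu>] by (intro image_eqI[of _ _ "{}"]) auto
  have bdd: "bdd_above S"
    using False by (intro bdd_aboveI[of _ 1]) (auto simp: S_def)
  have s0: "0 \<le> Sup S" using z bdd by (rule cSup_upper)
  show ?thesis
  proof (cases "Sup S = 0")
    case True
    have le: "\<nu> A' \<le> 0" if "A' \<in> sets M" "A' \<subseteq> E" for A'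
      using cSup_upper[OF _ bdd, of "\<nu> A'"] that True by (auto simp: S_def)
    show ?thesis
      using le signed_measure_empty[OF \<nu>] by (intro exI[of _ "{}"]) (auto simp: min_le_iff_disj)
  next
    case False
    then have "Sup S / 2 < Sup S" using s0 by simp
    then obtain x where x: "x \<in> S" "Sup S / 2 < x"
      using less_cSup_iff[of S "Sup S / 2"] z bdd by auto
    then obtain A where A: "A \<in> sets M" "A \<subseteq> E" "x = \<nu> A" by (auto simp: S_def)
    have "\<nu> A' / 2 \<le> \<nu> A" if "A' \<in> sets M" "A' \<subseteq> E" for A'
      using cSup_upper[OF _ bdd, of "\<nu> A'"] that x A by (auto simp: S_def)
    then show ?thesis
      using A x s0 by (intro exI[of _ A]) (auto simp: min_le_iff_disj)
  qed
qed

text \<open>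
  Remove almost maximal subsets one after the other. The removed sets are disjoint, so their
  values form a convergent series and tend to zero; nothing of positive value can remain.
\<close>

lemma signed_measure_negative_subset:
  assumes \<nu>: "signed_measure M \<nu>" and D: "D \<in> sets M"
  shows "\<exists>B. B \<in> sets M \<and> B \<subseteq> D \<and> \<nu> B \<le> \<nu> D \<and> (\<forall>A\<in>sets M. A \<subseteq> B \<longrightarrow> \<nu> A \<le> 0)"
proof -
  define c where "c E = (SOME A. A \<in> sets M \<and> A \<subseteq> E \<and> 0 \<le> \<nu> A \<and>
             (\<forall>A'\<in>sets M. A' \<subseteq> E \<longrightarrow> min 1 (\<nu> A' / 2) \<le> \<nu> A))" for E
  have c: "c E \<in> sets M" "c E \<subseteq> E" "0 \<le> \<nu> (c E)"
     "\<And>A'. A' \<in> sets M \<Longrightarrow> A' \<subseteq> E \<Longrightarrow> min 1 (\<nu> A' / 2) \<le> \<nu> (c E)" if "E \<in> sets M" for E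
    using someI_ex[OF signed_measure_almost_maximal_subset[OF \<nu> that]] unfolding c_def by blast+
  \<comment> \<open>\<open>E k\<close> is what remains of \<open>D\<close> after \<open>k\<close> removals.\<close>
  define E where "E = rec_nat D (\<lambda>_ X. X - c X)"
  have E0: "E 0 = D" and ES: "\<And>k. E (Suc k) = E k - c (E k)" by (simp_all add: E_def)
  have Es: "E k \<in> sets M" for k
    by (induction k) (auto simp: E0 ES D c)
  have dec: "E j \<subseteq> E i" if "i \<le> j" for i j
    using that by (induction rule: dec_induct) (auto simp: ES)
  have disj: "disjoint_family (\<lambda>k. c (E k))"
  proof -
    have "c (E i) \<inter> c (E j) = {}" if "i < j" for i j
    proof -
      have "E j \<subseteq> E (Suc i)" using that by (intro dec) auto
      then show ?thesis using c(2)[OF Es, of j] by (auto simp: ES)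
    qed
    then show ?thesis
      unfolding disjoint_family_on_def by (metis Int_commute linorder_neqE_nat)
  qed
  define U where "U = (\<Union>k. c (E k))"
  have U: "U \<in> sets M" unfolding U_def using c(1)[OF Es] by auto
  have UD: "U \<subseteq> D" unfolding U_def using c(2)[OF Es] dec[of 0] by (fastforce simp: E0)
  have sums: "(\<lambda>k. \<nu> (c (E k))) sums \<nu> U"
    unfolding U_def using c(1)[OF Es] disj by (intro signed_measure_sums[OF \<nu>]) auto
  have U0: "0 \<le> \<nu> U" using sums_le[OF _ sums_zero sums] c(3)[OF Es] by simp
  have lim: "(\<lambda>k. \<nu> (c (E k))) \<longlonglongrightarrow> 0"
    using sums sums_summable summable_LIMSEQ_zero by blast
  have sub: "D - U \<subseteq> E k" for k
    by (induction k) (auto simp: E0 ES U_def)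
  have "\<nu> A \<le> 0" if A: "A \<in> sets M" "A \<subseteq> D - U" for A
  proof -
    have "min 1 (\<nu> A / 2) \<le> \<nu> (c (E k))" for k
      using c(4)[OF Es A(1)] A(2) sub by blast
    then have "min 1 (\<nu> A / 2) \<le> 0" using lim by (auto intro: LIMSEQ_le_const)
    then show ?thesis by (auto simp: min_def split: if_splits)
  qed
  moreover have "\<nu> (D - U) \<le> \<nu> D"
    using signed_measure_Diff[OF \<nu> D U UD] U0 by simp
  ultimately show ?thesis using D U by (intro exI[of _ "D - U"]) auto
qed

lemma signed_measure_negative_UN:
  assumes \<nu>: "signed_measure M \<nu>" and B: "\<And>k :: nat. B k \<in> sets M"
    and neg: "\<And>k A. A \<in> sets M \<Longrightarrow> A \<subseteq> B k \<Longrightarrow> \<nu> A \<le> 0"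
    and A: "A \<in> sets M" "A \<subseteq> (\<Union>k. B k)"
  shows "\<nu> A \<le> 0"
proof -
  have ds: "disjointed B k \<in> sets M" for k
    using B sets.range_disjointed_sets[of B M] by blast
  have "(\<lambda>k. \<nu> (A \<inter> disjointed B k)) sums \<nu> (\<Union>k. A \<inter> disjointed B k)"
    using A ds disjoint_family_disjointed[of B]
    by (intro signed_measure_sums[OF \<nu>]) (auto simp: disjoint_family_on_def, blast)
  moreover have "(\<Union>k. A \<inter> disjointed B k) = A"
    using A UN_disjointed_eq[of B] by blast
  moreover have "\<nu> (A \<inter> disjointed B k) \<le> 0" for k
    using A ds disjointed_subset[of B k] by (intro neg[of _ k]) auto
  ultimately show ?thesis using sums_le[OF _ _ sums_zero] by metis
qed

text \<open>
  A negative set \<open>N\<close> of least value exists because negative sets are closed under countable unions.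
  A subset of its complement with negative value would contain a negative set, and adding that
  to \<open>N\<close> would contradict minimality.
\<close>

theorem signed_measure_Hahn_decomposition:
  assumes \<nu>: "signed_measure M \<nu>"
  obtains H where "H \<in> sets M" "\<And>A. A \<in> sets M \<Longrightarrow> A \<subseteq> H \<Longrightarrow> 0 \<le> \<nu> A"
    "\<And>A. A \<in> sets M \<Longrightarrow> A \<inter> H = {} \<Longrightarrow> \<nu> A \<le> 0"
proof -
  define Neg where "Neg = {B\<in>sets M. \<forall>A\<in>sets M. A \<subseteq> B \<longrightarrow> \<nu> A \<le> 0}"
  have "{} \<in> Neg" using signed_measure_empty[OF \<nu>] by (auto simp: Neg_def)
  then have "(\<lambda>B. ereal (\<nu> B)) ` Neg \<noteq> {}" by auto
  from Inf_as_limit[OF this] obtain y where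
    y: "\<And>k. y k \<in> (\<lambda>B. ereal (\<nu> B)) ` Neg" and lim: "y \<longlonglongrightarrow> (INF B\<in>Neg. ereal (\<nu> B))" by auto
  from y have "\<forall>k::nat. \<exists>B. B \<in> Neg \<and> y k = ereal (\<nu> B)" by blast
  from choice[OF this] obtain B where B: "\<And>k. B k \<in> Neg" "\<And>k. y k = ereal (\<nu> (B k))"
    by blast
  define N where "N = (\<Union>k. B k)"
  have Bs: "B k \<in> sets M" for k using B(1) by (auto simp: Neg_def)
  then have Ns: "N \<in> sets M" by (auto simp: N_def)
  have Nneg: "\<nu> A \<le> 0" if "A \<in> sets M" "A \<subseteq> N" for A
  proof (rule signed_measure_negative_UN[OF \<nu>, of B])
    show "\<nu> X \<le> 0" if "X \<in> sets M" "X \<subseteq> B k" for k X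
      using B(1)[of k] that by (simp add: Neg_def)
  qed (use that Bs in \<open>auto simp: N_def\<close>)
  have "\<nu> N \<le> \<nu> (B k)" for k
  proof -
    have "\<nu> (N - B k) = \<nu> N - \<nu> (B k)"
      using Ns Bs by (intro signed_measure_Diff[OF \<nu>]) (auto simp: N_def)
    moreover have "\<nu> (N - B k) \<le> 0" using Ns Bs by (intro Nneg) auto
    ultimately show ?thesis by simp
  qed
  then have "ereal (\<nu> N) \<le> (INF B\<in>Neg. ereal (\<nu> B))"
    by (intro LIMSEQ_le_const[OF lim]) (auto simp: B)
  then have min: "\<nu> N \<le> \<nu> B'" if "B' \<in> Neg" for B'
    using INF_lower[OF that, of "\<lambda>B. ereal (\<nu> B)"] by (metis ereal_less_eq(3) order_trans)
  have pos: "0 \<le> \<nu> A" if A: "A \<in> sets M" "A \<subseteq> space M - N" for A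
  proof (rule ccontr)
    assume neg: "\<not> 0 \<le> \<nu> A"
    obtain C where C: "C \<in> sets M" "C \<subseteq> A" "\<nu> C \<le> \<nu> A"
      "\<And>X. X \<in> sets M \<Longrightarrow> X \<subseteq> C \<Longrightarrow> \<nu> X \<le> 0"
      using signed_measure_negative_subset[OF \<nu> A(1)] by blast
    have "\<nu> X \<le> 0" if X: "X \<in> sets M" "X \<subseteq> N \<union> C" for X
    proof -
      have "\<nu> ((X \<inter> N) \<union> (X - N)) = \<nu> (X \<inter> N) + \<nu> (X - N)"
        using X Ns by (intro signed_measure_Un[OF \<nu>]) auto
      moreover have "(X \<inter> N) \<union> (X - N) = X" by auto
      moreover have "\<nu> (X \<inter> N) \<le> 0" using X Ns by (intro Nneg) auto
      moreover have "\<nu> (X - N) \<le> 0" using X Ns by (intro C) auto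
      ultimately show ?thesis by simp
    qed
    then have "N \<union> C \<in> Neg" using Ns C by (auto simp: Neg_def)
    moreover have "\<nu> (N \<union> C) = \<nu> N + \<nu> C"
      using Ns C A by (intro signed_measure_Un[OF \<nu>]) auto
    ultimately show False using min[of "N \<union> C"] C neg by auto
  qed
  show thesis
  proof (rule that[of "space M - N"])
    show "space M - N \<in> sets M" using Ns by auto
    show "\<nu> A \<le> 0" if "A \<in> sets M" "A \<inter> (space M - N) = {}" for A
      using that sets.sets_into_space[OF that(1)] by (intro Nneg) auto
  qed (rule pos)
qed

text \<open>
  The partition \<open>{A \<inter> H, A - H}\<close> attains the supremum, since on either side of a Hahn decomposition
  \<open>\<nu>\<close> has constant sign. In particular the supremum is countably additive.
\<close>

lemma total_variation_Hahn:
  assumes \<nu>: "signed_measure M \<nu>" and H: "H \<in> sets M"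
    and pos: "\<And>A. A \<in> sets M \<Longrightarrow> A \<subseteq> H \<Longrightarrow> 0 \<le> \<nu> A"
    and neg: "\<And>A. A \<in> sets M \<Longrightarrow> A \<inter> H = {} \<Longrightarrow> \<nu> A \<le> 0"
    and A: "A \<in> sets M"
  shows "emeasure (total_variation M \<nu>) A = ennreal (\<nu> (A \<inter> H) - \<nu> (A - H))"
proof -
  define t where "t A = \<nu> (A \<inter> H) - \<nu> (A - H)" for A
  have split: "\<nu> X = \<nu> (X \<inter> H) + \<nu> (X - H)" if "X \<in> sets M" for X
  proof -
    have "\<nu> ((X \<inter> H) \<union> (X - H)) = \<nu> (X \<inter> H) + \<nu> (X - H)"
      using that H by (intro signed_measure_Un[OF \<nu>]) auto
    moreover have "(X \<inter> H) \<union> (X - H) = X" by auto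
    ultimately show ?thesis by simp
  qed
  have p: "0 \<le> \<nu> (X \<inter> H)" and n: "\<nu> (X - H) \<le> 0" if "X \<in> sets M" for X
    using that H by (auto intro!: pos neg)
  have t0: "0 \<le> t X" and abs_t: "\<bar>\<nu> X\<bar> \<le> t X" if "X \<in> sets M" for X
    using p[OF that] n[OF that] split[OF that] by (auto simp: t_def)
  have t_empty: "t {} = 0" using signed_measure_empty[OF \<nu>] by (simp add: t_def)
  have t_sums: "(\<lambda>n. t (B n)) sums t (\<Union>n. B n)"
    if "range B \<subseteq> sets M" "disjoint_family B" for B :: "nat \<Rightarrow> 'a set"
  proof -
    have s1: "(\<lambda>n. \<nu> (B n \<inter> H)) sums \<nu> (\<Union>n. B n \<inter> H)"
      using that H by (intro signed_measure_sums[OF \<nu>]) (auto simp: disjoint_family_on_def)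
    have s2: "(\<lambda>n. \<nu> (B n - H)) sums \<nu> (\<Union>n. B n - H)"
      using that H by (intro signed_measure_sums[OF \<nu>]) (auto simp: disjoint_family_on_def)
    have "(\<Union>n. B n \<inter> H) = (\<Union>n. B n) \<inter> H" "(\<Union>n. B n - H) = (\<Union>n. B n) - H" by auto
    then show ?thesis using sums_diff[OF s1 s2] by (simp add: t_def)
  qed
  have t_signed: "signed_measure M t" unfolding signed_measure_def using t_empty t_sums by blast
  have t_fin: "(\<Sum>B\<in>P. t B) = t (\<Union>P)" if "finite P" "P \<subseteq> sets M" "disjoint P" for P
    using that
  proof (induction P)
    case (insert B P)
    have "B \<inter> \<Union>P = {}" using insert by (auto simp: disjoint_def)
    then have "t (B \<union> \<Union>P) = t B + t (\<Union>P)"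
      using insert by (intro signed_measure_Un[OF t_signed]) auto
    then show ?case using insert by (simp add: disjoint_def)
  qed (simp add: t_empty)
  define m where "m A = (SUP P \<in> {P. finite P \<and> P \<subseteq> sets M \<and> disjoint P \<and> \<Union>P = A}.
              \<Sum>B\<in>P. ennreal \<bar>\<nu> B\<bar>)" for A
  have m: "m X = ennreal (t X)" if X: "X \<in> sets M" for X
  proof (rule antisym)
    show "m X \<le> ennreal (t X)" unfolding m_def
    proof (rule SUP_least)
      fix P assume "P \<in> {P. finite P \<and> P \<subseteq> sets M \<and> disjoint P \<and> \<Union>P = X}"
      then have P: "finite P" "P \<subseteq> sets M" "disjoint P" "\<Union>P = X" by auto
      have "(\<Sum>B\<in>P. ennreal \<bar>\<nu> B\<bar>) = ennreal (\<Sum>B\<in>P. \<bar>\<nu> B\<bar>)"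
        by (rule sum_ennreal) simp
      also have "\<dots> \<le> ennreal (\<Sum>B\<in>P. t B)"
        using P abs_t by (intro ennreal_leI sum_mono) auto
      finally show "(\<Sum>B\<in>P. ennreal \<bar>\<nu> B\<bar>) \<le> ennreal (t X)" using t_fin[OF P(1-3)] P by simp
    qed
    define P where "P = {X \<inter> H, X - H}"
    have "ennreal (t X) = (\<Sum>B\<in>P. ennreal \<bar>\<nu> B\<bar>)"
    proof (cases "X = {}")
      case True then show ?thesis using signed_measure_empty[OF \<nu>] by (simp add: P_def t_def)
    next
      case False
      then have "X \<inter> H \<noteq> X - H" by auto
      then show ?thesis using p[OF X] n[OF X]
        by (simp add: P_def t_def flip: ennreal_plus)
    qed
    also have "\<dots> \<le> m X" unfolding m_def
      using X H by (intro SUP_upper) (auto simp: P_def disjoint_def)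
    finally show "ennreal (t X) \<le> m X" .
  qed
  have "emeasure (measure_of (space M) (sets M) m) A = m A"
  proof (rule emeasure_measure_of_sigma[OF sets.sigma_algebra_axioms _ _ A])
    show "positive (sets M) m" by (simp add: positive_def m t_empty)
    show "countably_additive (sets M) m"
    proof (rule countably_additiveI)
      fix B :: "nat \<Rightarrow> 'a set" assume B: "range B \<subseteq> sets M" "disjoint_family B" "(\<Union>i. B i) \<in> sets M"
      have "(\<lambda>i. t (B i)) sums t (\<Union>i. B i)" using B by (intro t_sums)
      moreover have "0 \<le> t (B i)" for i using B by (intro t0) auto
      ultimately have "(\<Sum>i. ennreal (t (B i))) = ennreal (t (\<Union>i. B i))"
        by (metis sums_unique suminf_ennreal_eq)
      then show "(\<Sum>i. m (B i)) = m (\<Union>i. B i)" using B by (simp add: m range_subsetD)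
    qed
  qed
  moreover have "total_variation M \<nu> = measure_of (space M) (sets M) m"
    unfolding total_variation_def m_def[abs_def] ..
  ultimately show ?thesis using m[OF A] by (simp only: t_def)
qed

lemma sets_total_variation [simp, measurable_cong]: "sets (total_variation M \<nu>) = sets M"
  by (simp add: total_variation_def sets.sigma_sets_eq)

lemma space_total_variation [simp]: "space (total_variation M \<nu>) = space M"
  by (simp add: total_variation_def space_measure_of_conv)

lemma finite_measure_total_variation:
  assumes \<nu>: "signed_measure M \<nu>"
  shows "finite_measure (total_variation M \<nu>)"
proof -
  obtain H where H: "H \<in> sets M" "\<And>A. A \<in> sets M \<Longrightarrow> A \<subseteq> H \<Longrightarrow> 0 \<le> \<nu> A"
    "\<And>A. A \<in> sets M \<Longrightarrow> A \<inter> H = {} \<Longrightarrow> \<nu> A \<le> 0" 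
    by (rule signed_measure_Hahn_decomposition[OF \<nu>]) blast
  show ?thesis
    by (rule finite_measureI) (simp add: total_variation_Hahn[OF \<nu> H])
qed

text \<open>
  The function that is \<open>1\<close> on a Hahn set and \<open>- 1\<close> off it is a density. Densities are unique up to null
  sets, so whatever density is chosen has modulus one.
\<close>

theorem polar_density:
  assumes \<nu>: "signed_measure M \<nu>"
  shows integrable_polar_density: "integrable (total_variation M \<nu>) (polar_density M \<nu>)" (is ?A)
    and signed_measure_eq_integral:
      "A \<in> sets M \<Longrightarrow> \<nu> A = (LINT x:A|total_variation M \<nu>. polar_density M \<nu> x)" (is "_ \<Longrightarrow> ?B A")
    and AE_abs_polar_density: "AE x in total_variation M \<nu>. \<bar>polar_density M \<nu> x\<bar> = 1" (is ?C)
proof -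
  obtain H where H: "H \<in> sets M" "\<And>A. A \<in> sets M \<Longrightarrow> A \<subseteq> H \<Longrightarrow> 0 \<le> \<nu> A"
    "\<And>A. A \<in> sets M \<Longrightarrow> A \<inter> H = {} \<Longrightarrow> \<nu> A \<le> 0" 
    by (rule signed_measure_Hahn_decomposition[OF \<nu>]) blast
  define T where "T = total_variation M \<nu>"
  have sT [simp, measurable_cong]: "sets T = sets M" and spT[simp]: "space T = space M" by (simp_all add: T_def)
  interpret T: finite_measure T unfolding T_def by (rule finite_measure_total_variation[OF \<nu>])
  define w where "w x = (if x \<in> H then 1 else - (1::real))" for x
  have mT: "measure T A = \<nu> (A \<inter> H) - \<nu> (A - H)" if A: "A \<in> sets M" for A
  proof -
    have "0 \<le> \<nu> (A \<inter> H)" "\<nu> (A - H) \<le> 0" using A H(1) by (auto intro!: H(2,3))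
    moreover have "emeasure T A = ennreal (\<nu> (A \<inter> H) - \<nu> (A - H))"
      unfolding T_def by (rule total_variation_Hahn[OF \<nu> H A])
    ultimately show ?thesis
      by (simp add: measure_def)
  qed
  have wm [measurable]: "w \<in> borel_measurable T" unfolding w_def using H by measurable
  have wi: "integrable T w"
    by (rule T.integrable_const_bound[of _ 1]) (auto simp: w_def)
  have w\<nu>: "\<nu> A = (LINT x:A|T. w x)" if A: "A \<in> sets M" for A
  proof -
    have "(LINT x:A|T. w x) = (LINT x|T. indicator (A \<inter> H) x - indicator (A - H) x)"
      unfolding set_lebesgue_integral_def by (intro Bochner_Integration.integral_cong) (auto simp: w_def indicator_def)
    also have "\<dots> = measure T (A \<inter> H) - measure T (A - H)"
      using A H by (subst Bochner_Integration.integral_diff)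
        (auto intro!: T.integrable_const_bound[of _ 1] simp: Int_absorb2[OF sets.sets_into_space])
    also have "\<dots> = \<nu> (A \<inter> H) + \<nu> (A - H)"
      using A H signed_measure_empty[OF \<nu>] by (simp add: mT Int_assoc Diff_Int_distrib2 Int_Diff)
    also have "\<dots> = \<nu> ((A \<inter> H) \<union> (A - H))"
      using A H by (intro signed_measure_Un[OF \<nu>, symmetric]) auto
    also have "(A \<inter> H) \<union> (A - H) = A" by auto
    finally show ?thesis by simp
  qed
  define \<sigma> where "\<sigma> = polar_density M \<nu>"
  have \<sigma>: "integrable T \<sigma> \<and> (\<forall>A\<in>sets M. \<nu> A = (LINT x:A|T. \<sigma> x))"
    unfolding \<sigma>_def polar_density_def T_def[symmetric]
    by (rule someI[of _ w]) (use wi w\<nu> in auto)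
  then show ?A and "A \<in> sets M \<Longrightarrow> ?B A" by (auto simp: T_def \<sigma>_def)
  have "AE x in T. \<sigma> x = w x"
    using \<sigma> wi w\<nu> by (intro density_unique_real) auto
  then show ?C unfolding T_def[symmetric] \<sigma>_def[symmetric]
    by eventually_elim (auto simp: w_def)
qed

lemma signed_measure_null_total_variation:
  assumes \<mu>: "signed_measure M \<mu>" and Z: "Z \<in> sets M" "emeasure (total_variation M \<mu>) Z = 0"
    and A: "A \<in> sets M" "A \<subseteq> Z"
  shows "\<mu> A = 0"
proof -
  have "Z \<in> null_sets (total_variation M \<mu>)" using Z by (auto simp: null_sets_def)
  then have "AE x in total_variation M \<mu>. x \<notin> Z" by (rule AE_not_in)
  then have "AE x in total_variation M \<mu>. indicator A x *\<^sub>R polar_density M \<mu> x = 0"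
    by eventually_elim (use A(2) in \<open>auto simp: indicator_def\<close>)
  then show ?thesis
    unfolding signed_measure_eq_integral[OF \<mu> A(1)] set_lebesgue_integral_def by (rule integral_eq_zero_AE)
qed

section \<open>Signed measures on the unit interval\<close>

lemma sets_borel_ivl: "A \<in> sets borel_ivl \<longleftrightarrow> A \<in> sets borel \<and> A \<subseteq> unit_ivl"
  by (subst sets_restrict_space_iff) auto

lemma space_borel_ivl [simp]: "space borel_ivl = unit_ivl"
  by (simp add: space_restrict_space)

text \<open>
  Functions on the interval are only Lebesgue measurable in general, whereas product measures and
  Fubini's theorem are used for Borel functions. This lemma and the next two exchange an
  integrand for a Borel representative that vanishes off the interval.
\<close>

lemma integral_unit_ivl_lebesgue_eq_lborel:
  fixes G G' :: "real \<Rightarrow> real"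
  assumes "(\<lambda>x. indicator unit_ivl x * G x) \<in> borel_measurable lebesgue"
    and "G' \<in> borel_measurable borel"
    and "AE x in lborel. indicator unit_ivl x * G x = G' x"
  shows "(LINT x:unit_ivl|lebesgue. G x) = (LINT x|lborel. G' x)"
proof -
  have "(LINT x:unit_ivl|lebesgue. G x) = (LINT x|lebesgue. G' x)"
    unfolding set_lebesgue_integral_def using assms AE_completion[OF assms(3)]
    by (intro integral_cong_AE) (auto intro: measurable_completion)
  also have "\<dots> = (LINT x|lborel. G' x)"
    using assms by (intro integral_completion) auto
  finally show ?thesis .
qed

lemma borel_representative:
  fixes g :: "real \<Rightarrow> real"
  assumes g: "set_integrable lebesgue unit_ivl g"
  obtains g' where "integrable lborel g'" "\<And>x. x \<notin> unit_ivl \<Longrightarrow> g' x = 0"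
    "AE x in lborel. indicator unit_ivl x * g x = g' x"
proof -
  let ?g = "\<lambda>x. indicator unit_ivl x * g x"
  have int: "integrable lebesgue ?g" using g by (simp add: set_integrable_def)
  obtain h where h: "h \<in> borel_measurable lborel" "AE x in lborel. ?g x = h x"
    using completion_ex_borel_measurable_real[OF borel_measurable_integrable[OF int]] by auto
  define g' where "g' x = indicator unit_ivl x * h x" for x
  have m: "g' \<in> borel_measurable lborel" unfolding g'_def using h by measurable
  have ae: "AE x in lborel. ?g x = g' x"
    using h(2)
  proof eventually_elim
    case (elim x)
    then show ?case by (cases "x \<in> unit_ivl") (simp_all add: g'_def)
  qed
  have "integrable lebesgue g'"
    using int m AE_completion[OF ae] by (subst integrable_cong_AE[symmetric]) (auto intro: measurable_completion)
  then have "integrable lborel g'" using m by (subst (asm) integrable_completion) auto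
  then show thesis using ae by (intro that[of g']) (auto simp: g'_def)
qed

lemma integral_borel_representative:
  fixes k k' m :: "real \<Rightarrow> real"
  assumes k: "set_integrable lebesgue unit_ivl k"
    and k': "k' \<in> borel_measurable borel" "AE x in lborel. indicator unit_ivl x * k x = k' x"
    and m: "m \<in> borel_measurable borel"
  shows "(LINT x:unit_ivl|lebesgue. m x * k x) = (LINT x|lborel. m x * k' x)"
proof (rule integral_unit_ivl_lebesgue_eq_lborel)
  have "(\<lambda>x. indicator unit_ivl x * k x) \<in> borel_measurable lebesgue"
    using k borel_measurable_integrable by (simp add: set_integrable_def)
  moreover have "m \<in> borel_measurable lebesgue"
    using measurable_completion[of m lborel borel] m by simp
  ultimately have "(\<lambda>x. m x * (indicator unit_ivl x * k x)) \<in> borel_measurable lebesgue"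
    using borel_measurable_times by blast
  then show "(\<lambda>x. indicator unit_ivl x * (m x * k x)) \<in> borel_measurable lebesgue"
    by (simp add: mult.left_commute)
  show "AE x in lborel. indicator unit_ivl x * (m x * k x) = m x * k' x"
    using k'(2) by eventually_elim (simp add: mult.left_commute)
qed (use k' m in measurable)

definition primitive :: "(real \<Rightarrow> real) \<Rightarrow> real \<Rightarrow> real" where
  "primitive r x = (LINT t|lborel. indicator {..x} t * r t)"

lemma integrable_indicator_mult:
  fixes k :: "'a \<Rightarrow> real"
  assumes "integrable M k" "A \<in> sets M"
  shows "integrable M (\<lambda>t. indicator A t * k t)"
  using integrable_mult_indicator[OF assms(2,1)] by simp

lemma abs_primitive_le:
  assumes r: "integrable lborel r"
  shows "\<bar>primitive r x\<bar> \<le> (LINT t|lborel. \<bar>r t\<bar>)"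
proof -
  have "\<bar>primitive r x\<bar> \<le> (LINT t|lborel. \<bar>indicator {..x} t * r t\<bar>)"
    unfolding primitive_def by (rule integral_abs_bound)
  also have "\<dots> \<le> (LINT t|lborel. \<bar>r t\<bar>)"
    using r by (intro integral_mono integrable_abs integrable_indicator_mult) (auto simp: indicator_def)
  finally show ?thesis .
qed

lemma continuous_primitive:
  assumes r: "integrable lborel r"
  shows "continuous_on UNIV (primitive r)"
proof -
  have "(primitive r \<circ> u) \<longlonglongrightarrow> primitive r x" if u: "u \<longlonglongrightarrow> x" for u :: "nat \<Rightarrow> real" and x
    unfolding primitive_def comp_def
  proof (rule integral_dominated_convergence)
    show "AE t in lborel. (\<lambda>i. indicat_real {..u i} t * r t) \<longlonglongrightarrow> indicat_real {..x} t * r t"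
    proof (rule AE_mp[OF AE_lborel_singleton[of x]], intro AE_I2 impI)
      fix t assume "t \<noteq> x"
      then have "\<forall>\<^sub>F i in sequentially. indicat_real {..u i} t = indicat_real {..x} t"
        using order_tendstoD[OF u, of t] by (cases "t < x") (auto elim!: eventually_mono simp: indicator_def)
      then show "(\<lambda>i. indicat_real {..u i} t * r t) \<longlonglongrightarrow> indicat_real {..x} t * r t"
        by (intro tendsto_mult tendsto_const tendsto_eventually)
    qed
    show "integrable lborel (\<lambda>t. \<bar>r t\<bar>)" using r by simp
    show "(\<lambda>t. indicat_real {..x} t * r t) \<in> borel_measurable lborel"
      using r by measurable
    show "(\<lambda>t. indicat_real {..u i} t * r t) \<in> borel_measurable lborel" for i
      using r by measurable
  qed (auto simp: indicator_def)
  then show ?thesis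
    by (auto simp: continuous_on_sequentially)
qed

lemma measurable_primitive [measurable]:
  "integrable lborel r \<Longrightarrow> primitive r \<in> borel_measurable borel"
  using continuous_primitive by (rule borel_measurable_continuous_onI)

lemma primitive_diff_eq:
  assumes r: "integrable lborel r" and "x \<le> y"
  shows "primitive r y - primitive r x = (LINT t|lborel. indicator {x<..y} t * r t)"
proof -
  have "primitive r y - primitive r x = (LINT t|lborel. indicator {..y} t * r t - indicator {..x} t * r t)"
    unfolding primitive_def using r
    by (intro Bochner_Integration.integral_diff[symmetric] integrable_indicator_mult) auto
  also have "\<dots> = (LINT t|lborel. indicator {x<..y} t * r t)"
    using \<open>x \<le> y\<close> by (intro Bochner_Integration.integral_cong) (auto simp: indicator_def)
  finally show ?thesis .
qed

lemma primitive_le_0: "(\<And>x. x \<notin> unit_ivl \<Longrightarrow> r x = 0) \<Longrightarrow> x \<le> 0 \<Longrightarrow> primitive r x = 0"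
  unfolding primitive_def
  by (subst Bochner_Integration.integral_cong[OF refl, of _ _ "\<lambda>_. 0"]) (auto simp: indicator_def)

lemma primitive_ge_1: "(\<And>x. x \<notin> unit_ivl \<Longrightarrow> r x = 0) \<Longrightarrow> 1 \<le> x \<Longrightarrow> primitive r x = (LINT t|lborel. r t)"
  unfolding primitive_def
  by (rule Bochner_Integration.integral_cong) (auto simp: indicator_def not_le)

text \<open>
  Equality uses that the single point \<open>t\<close>, counted on both sides, is a null set.
\<close>

lemma integral_tail_primitive:
  assumes r: "integrable lborel r"
  shows "(LINT x|lborel. indicator {t..} x * r x) = (LINT x|lborel. r x) - primitive r t"
proof -
  have "(LINT x|lborel. r x) - primitive r t = (LINT x|lborel. r x - indicator {..t} x * r x)"
    unfolding primitive_def using r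
    by (intro Bochner_Integration.integral_diff[symmetric] integrable_indicator_mult) auto
  also have "\<dots> = (LINT x|lborel. indicator {t..} x * r x)"
  proof (rule integral_cong_AE)
    show "AE x in lborel. r x - indicator {..t} x * r x = indicator {t..} x * r x"
      by (rule AE_mp[OF AE_lborel_singleton[of t]]) (auto simp: indicator_def)
  qed (use r in measurable)
  finally show ?thesis ..
qed

text \<open>
  Integration by parts in the form of Fubini's theorem on the triangle \<open>t \<le> x\<close>. The measure \<open>T\<close>
  may be Lebesgue measure as well as the variation of a derivative.
\<close>

lemma Fubini_triangle:
  fixes T :: "real measure" and r k :: "real \<Rightarrow> real"
  assumes T: "sigma_finite_measure T" and id [measurable]: "(\<lambda>t. t) \<in> borel_measurable T"
    and r: "integrable lborel r" and k: "integrable T k"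
  shows "(LINT x|lborel. r x * (LINT t|T. indicator {..x} t * k t)) =
         (LINT t|T. k t * ((LINT x|lborel. r x) - primitive r t))"
proof -
  interpret T: sigma_finite_measure T by fact
  interpret P: pair_sigma_finite lborel T ..
  have rm [measurable]: "r \<in> borel_measurable borel" using r by auto
  have km [measurable]: "k \<in> borel_measurable T" using k by auto
  have prod: "integrable (lborel \<Otimes>\<^sub>M T) (\<lambda>(x, t). r x * k t)"
    using r k by (intro P.Fubini_integrable) (auto simp: abs_mult)
  have int: "integrable (lborel \<Otimes>\<^sub>M T) (\<lambda>(x, t). (if t \<le> x then 1 else 0) * (r x * k t))"
    by (rule Bochner_Integration.integrable_bound[OF prod]) auto
  have "(LINT x|lborel. r x * (LINT t|T. indicator {..x} t * k t)) =
        (LINT x|lborel. (LINT t|T. (if t \<le> x then 1 else 0) * (r x * k t)))"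
    by (intro Bochner_Integration.integral_cong refl)
       (auto simp flip: integral_mult_right_zero intro!: Bochner_Integration.integral_cong simp: indicator_def)
  also have "\<dots> = (LINT t|T. (LINT x|lborel. (if t \<le> x then 1 else 0) * (r x * k t)))"
    using P.Fubini_integral[OF int] by simp
  also have "\<dots> = (LINT t|T. k t * (LINT x|lborel. indicator {t..} x * r x))"
    by (intro Bochner_Integration.integral_cong refl)
       (auto simp flip: integral_mult_right_zero intro!: Bochner_Integration.integral_cong simp: indicator_def)
  finally show ?thesis by (simp add: integral_tail_primitive[OF r])
qed

abbreviation distribution_function :: "(real set \<Rightarrow> real) \<Rightarrow> real \<Rightarrow> real" where
  "distribution_function \<nu> x \<equiv> \<nu> (unit_ivl \<inter> {..x})"

lemma distribution_function_eq_integral: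
  assumes \<nu>: "signed_measure borel_ivl \<nu>"
  shows "distribution_function \<nu> x =
    (LINT t|total_variation borel_ivl \<nu>. indicator {..x} t * polar_density borel_ivl \<nu> t)"
proof -
  have "distribution_function \<nu> x =
     (LINT t:(unit_ivl \<inter> {..x})|total_variation borel_ivl \<nu>. polar_density borel_ivl \<nu> t)"
    by (rule signed_measure_eq_integral[OF \<nu>]) (auto simp: sets_borel_ivl)
  also have "\<dots> = (LINT t|total_variation borel_ivl \<nu>. indicator {..x} t * polar_density borel_ivl \<nu> t)"
    unfolding set_lebesgue_integral_def
    by (rule Bochner_Integration.integral_cong) (auto simp: indicator_def)
  finally show ?thesis .
qed

lemma id_measurable_total_variation: "(\<lambda>t. t) \<in> borel_measurable (total_variation borel_ivl \<nu>)"
proof -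
  have "(\<lambda>t. t) \<in> borel_measurable borel_ivl" by (intro measurable_restrict_space1) simp
  then show ?thesis by (simp cong: measurable_cong_sets)
qed

lemma borel_measurable_total_variation:
  "g \<in> borel_measurable borel \<Longrightarrow> g \<in> borel_measurable (total_variation borel_ivl \<nu>)"
  by (rule measurable_compose[OF id_measurable_total_variation])

lemma measurable_distribution_function:
  assumes \<nu>: "signed_measure borel_ivl \<nu>"
  shows "distribution_function \<nu> \<in> borel_measurable borel"
proof -
  interpret finite_measure "total_variation borel_ivl \<nu>" by (rule finite_measure_total_variation[OF \<nu>])
  note [measurable] = id_measurable_total_variation[of \<nu>]
    borel_measurable_integrable[OF integrable_polar_density[OF \<nu>]]
  have "(\<lambda>x. (LINT t|total_variation borel_ivl \<nu>. (if t \<le> x then 1 else 0) * polar_density borel_ivl \<nu> t))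
     \<in> borel_measurable borel"
    by measurable
  moreover have "distribution_function \<nu> =
    (\<lambda>x. (LINT t|total_variation borel_ivl \<nu>. (if t \<le> x then 1 else 0) * polar_density borel_ivl \<nu> t))"
    unfolding distribution_function_eq_integral[OF \<nu>]
    by (intro ext Bochner_Integration.integral_cong) (auto simp: indicator_def)
  ultimately show ?thesis by simp
qed

lemma abs_signed_measure_le:
  assumes \<nu>: "signed_measure M \<nu>" and A: "A \<in> sets M"
  shows "\<bar>\<nu> A\<bar> \<le> (LINT t|total_variation M \<nu>. \<bar>polar_density M \<nu> t\<bar>)"
proof -
  have "\<bar>\<nu> A\<bar> \<le> (LINT t|total_variation M \<nu>. \<bar>indicator A t * polar_density M \<nu> t\<bar>)"
    unfolding signed_measure_eq_integral[OF \<nu> A] set_lebesgue_integral_def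
    using integral_abs_bound by simp
  also have "\<dots> \<le> (LINT t|total_variation M \<nu>. \<bar>polar_density M \<nu> t\<bar>)"
    using integrable_polar_density[OF \<nu>] A
    by (intro integral_mono integrable_abs integrable_indicator_mult) (auto simp: indicator_def)
  finally show ?thesis .
qed

text \<open>
  The basic formula for integrating an absolutely continuous function that vanishes at both end
  points. It replaces any manipulation of polar densities by the distribution function, which is
  additive in \<open>\<nu>\<close>.
\<close>

theorem signed_integral_primitive:
  assumes \<nu>: "signed_measure borel_ivl \<nu>" and r: "integrable lborel r" and r0: "(LINT x|lborel. r x) = 0"
  shows "signed_integral borel_ivl \<nu> (primitive r) = - (LINT x|lborel. r x * distribution_function \<nu> x)"
proof -
  interpret finite_measure "total_variation borel_ivl \<nu>" by (rule finite_measure_total_variation[OF \<nu>])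
  have "(LINT x|lborel. r x * distribution_function \<nu> x) =
     (LINT t|total_variation borel_ivl \<nu>. polar_density borel_ivl \<nu> t * (0 - primitive r t))"
    unfolding distribution_function_eq_integral[OF \<nu>]
    by (subst Fubini_triangle[OF _ id_measurable_total_variation r integrable_polar_density[OF \<nu>]])
       (auto simp: r0 sigma_finite_measure_axioms)
  then show ?thesis
    unfolding signed_integral_def by (simp add: mult.commute)
qed

text \<open>
  The sets \<open>(0,x]\<close> are stable under intersection and generate the Borel sets. Dynkin's argument
  applies to signed measures directly because it only uses complements and disjoint unions.
\<close>

lemma signed_measure_borel_ivl_eqI:
  assumes \<nu>: "signed_measure borel_ivl \<nu>" and \<mu>: "signed_measure borel_ivl \<mu>"
    and eq: "\<And>x. distribution_function \<nu> x = distribution_function \<mu> x"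
    and A: "A \<in> sets borel_ivl"
  shows "\<nu> A = \<mu> A"
proof -
  have U: "\<nu> unit_ivl = \<mu> unit_ivl" using eq[of 1] by (simp add: Int_absorb2 subset_eq)
  have "\<nu> (unit_ivl \<inter> B) = \<mu> (unit_ivl \<inter> B)"
    if B: "B \<in> sigma_sets UNIV (range (\<lambda>a::real. {..a}))" for B
  proof -
    have "Int_stable (range (\<lambda>a::real. {..a}))" "range (\<lambda>a::real. {..a}) \<subseteq> Pow UNIV" by (auto simp: Int_stable_def)
    from this B show ?thesis
  proof (induction rule: sigma_sets_induct_disjoint)
    case empty
    then show ?case by (simp add: signed_measure_empty[OF \<nu>] signed_measure_empty[OF \<mu>])
  next
    case (compl B)
    have B: "B \<in> sets borel" using compl by (simp add: borel_eq_atMost)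
    have "unit_ivl \<inter> (UNIV - B) = unit_ivl - (unit_ivl \<inter> B)" by auto
    then show ?case
      using B compl U by (simp add: signed_measure_Diff[OF \<nu>] signed_measure_Diff[OF \<mu>] sets_borel_ivl)
  next
    case (union B)
    have B: "B i \<in> sets borel" for i using union by (auto simp: borel_eq_atMost)
    have d: "disjoint_family (\<lambda>i. unit_ivl \<inter> B i)"
      using union by (auto simp: disjoint_family_on_def)
    have "(\<lambda>i. \<nu> (unit_ivl \<inter> B i)) sums \<nu> (\<Union>i. unit_ivl \<inter> B i)"
      using B d by (intro signed_measure_sums[OF \<nu>]) (auto simp: sets_borel_ivl)
    moreover have "(\<lambda>i. \<mu> (unit_ivl \<inter> B i)) sums \<mu> (\<Union>i. unit_ivl \<inter> B i)"
      using B d by (intro signed_measure_sums[OF \<mu>]) (auto simp: sets_borel_ivl)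
    ultimately show ?case using union by (simp add: sums_unique2)
  qed (auto simp: eq)
  qed
  moreover have "A \<in> sigma_sets UNIV (range (\<lambda>a::real. {..a}))"
    using A unfolding sets_borel_ivl by (simp add: borel_eq_atMost)
  moreover have "unit_ivl \<inter> A = A"
    using A by (auto simp: sets_borel_ivl)
  ultimately show ?thesis by metis
qed

section \<open>The lemma of du Bois-Reymond\<close>

lemma signed_measure_density:
  fixes g :: "'a \<Rightarrow> real"
  assumes g: "integrable M g"
    and N: "sets N \<subseteq> sets M"
  shows "signed_measure N (\<lambda>A. LINT x:A|M. g x)"
  unfolding signed_measure_def
proof (intro conjI allI impI)
  fix A :: "nat \<Rightarrow> 'a set"
  assume A: "range A \<subseteq> sets N" "disjoint_family A"
  have Am [measurable]: "A i \<in> sets M" for i using A N by blast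
  have gm [measurable]: "g \<in> borel_measurable M" using g by auto
  have "(\<lambda>n. LINT x|M. (\<Sum>i<n. indicator (A i) x) * g x) \<longlonglongrightarrow> (LINT x|M. indicator (\<Union>i. A i) x * g x)"
  proof (rule integral_dominated_convergence)
    show "integrable M (\<lambda>x. \<bar>g x\<bar>)" using g by simp
    have "(\<lambda>n. \<Sum>i<n. indicator (A i) x :: real) \<longlonglongrightarrow> indicator (\<Union>i. A i) x" for x
      using indicator_sums[of A x] A(2) by (auto simp: sums_def disjoint_family_on_def)
    then show "AE x in M. (\<lambda>n. (\<Sum>i<n. indicator (A i) x) * g x) \<longlonglongrightarrow> indicator (\<Union>i. A i) x * g x"
      by (intro AE_I2 tendsto_mult tendsto_const)
    have "(\<Sum>i<n. indicator (A i) x :: real) = indicator (\<Union>i<n. A i) x" for n x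
      using A(2) by (intro indicator_UN_disjoint[symmetric]) (auto simp: disjoint_family_on_def)
    then show "AE x in M. norm ((\<Sum>i<n. indicator (A i) x) * g x) \<le> \<bar>g x\<bar>" for n
      by (intro AE_I2) (auto simp: indicator_def)
  qed measurable
  moreover have "(LINT x|M. (\<Sum>i<n. indicator (A i) x) * g x) = (\<Sum>i<n. LINT x:A i|M. g x)" for n
    unfolding set_lebesgue_integral_def sum_distrib_right
    by (subst Bochner_Integration.integral_sum) (auto intro!: integrable_indicator_mult g)
  ultimately show "(\<lambda>n. LINT x:A n|M. g x) sums (LINT x:(\<Union>n. A n)|M. g x)"
    by (simp add: sums_def set_lebesgue_integral_def)
qed (simp add: set_lebesgue_integral_def)

lemma distribution_function_density:
  assumes "integrable lborel g" "\<And>x. x \<notin> unit_ivl \<Longrightarrow> g x = 0"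
  shows "(LINT t:(unit_ivl \<inter> {..x})|lborel. g t) = primitive g x"
  unfolding set_lebesgue_integral_def primitive_def using assms(2)
  by (intro Bochner_Integration.integral_cong) (auto simp: indicator_def)

lemma signed_measure_lborel_density:
  assumes "integrable lborel g"
  shows "signed_measure borel_ivl (\<lambda>A. LINT x:A|lborel. g x)"
  using assms by (intro signed_measure_density) (auto simp: sets_borel_ivl)

text \<open>
  A function with vanishing primitive is the density of the zero measure.
\<close>

lemma AE_eq_0_if_primitive_eq_0:
  assumes g: "integrable lborel g" "\<And>x. x \<notin> unit_ivl \<Longrightarrow> g x = 0"
    and 0: "\<And>x. primitive g x = 0"
  shows "AE x in lborel. g x = 0"
proof (rule density_unique_real[OF g(1)])
  fix A :: "real set" assume A: "A \<in> sets lborel"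
  have "(LINT x:(unit_ivl \<inter> A)|lborel. g x) = (LINT x:(unit_ivl \<inter> A)|lborel. 0)"
  proof (rule signed_measure_borel_ivl_eqI[OF signed_measure_lborel_density[OF g(1)]
           signed_measure_lborel_density[of "\<lambda>_. 0"]])
    show "(LINT t:(unit_ivl \<inter> {..x})|lborel. g t) = (LINT t:(unit_ivl \<inter> {..x})|lborel. 0)" for x
      using distribution_function_density[OF g, of x] 0[of x] by (simp add: set_lebesgue_integral_def)
  qed (use A in \<open>auto simp: sets_borel_ivl\<close>)
  moreover have "(LINT x:(unit_ivl \<inter> A)|lborel. g x) = (LINT x:A|lborel. g x)"
    unfolding set_lebesgue_integral_def using g(2)
    by (intro Bochner_Integration.integral_cong) (auto simp: indicator_def)
  ultimately show "(LINT x:A|lborel. g x) = (LINT x:A|lborel. 0)"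
    by (simp add: set_lebesgue_integral_def)
qed simp

text \<open>
  An antiderivative of \<open>g\<close> is constant on either side of the support of \<open>g\<close>, and the two constants
  agree because \<open>g\<close> has mean zero.
\<close>

lemma test_fun_with_derivative:
  assumes g: "continuous_on UNIV g" and ab: "0 < \<alpha>" "\<alpha> < \<beta>" "\<beta> < 1"
    and supp: "\<And>x. x \<notin> {\<alpha><..<\<beta>} \<Longrightarrow> g x = (0::real)"
    and int: "(LINT x|lborel. g x) = 0"
  shows "\<exists>\<psi>. test_fun \<psi> \<and> deriv \<psi> = g"
proof -
  have "\<exists>F. \<forall>x :: real. -\<infinity> < ereal x \<longrightarrow> ereal x < \<infinity> \<longrightarrow> (F has_vector_derivative g x) (at x)"
    using g by (intro einterval_antiderivative) (auto simp: continuous_on_eq_continuous_at)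
  then obtain F where F: "\<And>x. (F has_vector_derivative g x) (at x)" by auto
  have FTC: "F y - F x = (LINT t|lborel. indicator {x..y} t * g t)" if "x \<le> y" for x y
    using integral_FTC_atLeastAtMost[OF that, of F g] F g
    by (simp add: has_vector_derivative_at_within continuous_on_subset)
  have lo: "F x = F \<alpha>" if "x \<le> \<alpha>" for x
  proof -
    have "(\<lambda>t. indicator {x..\<alpha>} t * g t) = (\<lambda>t. 0)"
      using supp by (auto simp: indicator_def fun_eq_iff)
    then show ?thesis using FTC[OF that] by simp
  qed
  have hi: "F x = F \<alpha>" if "\<beta> \<le> x" for x
  proof -
    have "(\<lambda>t. indicator {\<alpha>..x} t * g t) = g"
    proof
      show "indicator {\<alpha>..x} t * g t = g t" for t
        using supp[of t] that by (cases "t \<in> {\<alpha>..x}") auto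
    qed
    then show ?thesis using FTC[of \<alpha> x] that ab int by simp
  qed
  define \<psi> where "\<psi> x = F x - F \<alpha>" for x
  have d: "(\<psi> has_vector_derivative g x) (at x)" for x
    unfolding \<psi>_def by (rule derivative_eq_intros F refl | simp)+
  have "{x. \<psi> x \<noteq> 0} \<subseteq> {\<alpha>..\<beta>}"
  proof -
    have "\<psi> x = 0" if "x \<notin> {\<alpha>..\<beta>}" for x
      using lo[of x] hi[of x] that by (auto simp: \<psi>_def not_le)
    then show ?thesis by blast
  qed
  then have sub: "closure {x. \<psi> x \<noteq> 0} \<subseteq> {\<alpha>..\<beta>}" by (intro closure_minimal) auto
  then have "compact (closure {x. \<psi> x \<noteq> 0})"
    using compact_Int_closed[OF compact_Icc[of \<alpha> \<beta>], of "closure {x. \<psi> x \<noteq> 0}"] by (simp add: Int_absorb1)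
  moreover have "closure {x. \<psi> x \<noteq> 0} \<subseteq> unit_ivl" using sub ab by auto
  moreover have "\<psi> C1_differentiable_on UNIV"
    unfolding C1_differentiable_on_def using d g by blast
  moreover have "deriv \<psi> = g"
    using d by (intro ext DERIV_imp_deriv) (simp add: has_real_derivative_iff_has_vector_derivative)
  ultimately show ?thesis unfolding test_fun_def by blast
qed

text \<open>
  Test functions are of the kind to which the integration formula for primitives applies.
\<close>

lemma test_fun_eq_primitive:
  assumes \<psi>: "test_fun \<psi>"
  shows "integrable lborel (deriv \<psi>)" "\<And>x. x \<notin> unit_ivl \<Longrightarrow> deriv \<psi> x = 0"
    "(LINT x|lborel. deriv \<psi> x) = 0" "primitive (deriv \<psi>) = \<psi>"
proof -
  define K where "K = closure {x. \<psi> x \<noteq> 0}"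
  have K: "closed K" "K \<subseteq> unit_ivl" "\<And>x. x \<notin> K \<Longrightarrow> \<psi> x = 0"
    using \<psi> closure_subset[of "{x. \<psi> x \<noteq> 0}"] by (auto simp: K_def test_fun_def)
  obtain D where D: "\<And>x. (\<psi> has_vector_derivative D x) (at x)" "continuous_on UNIV D"
    using \<psi> by (auto simp: test_fun_def C1_differentiable_on_def)
  have dD: "deriv \<psi> = D"
    using D by (intro ext DERIV_imp_deriv) (simp add: has_real_derivative_iff_has_vector_derivative)
  have D0: "D x = 0" if "x \<notin> unit_ivl" for x
  proof -
    have "x \<in> - K" using that K by auto
    moreover have "open (- K)" using K by auto
    ultimately have "((\<lambda>_. 0) has_vector_derivative D x) (at x)"
      using K(3) by (intro has_vector_derivative_transform_within_open[OF D(1)]) auto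
    then show ?thesis
      using vector_derivative_unique_at[of "\<lambda>_. 0" "D x" x 0] by simp
  qed
  have "set_integrable lborel {0..1} D"
    using D(2) by (intro borel_integrable_atLeastAtMost') (rule continuous_on_subset, auto)
  moreover have "(\<lambda>x. indicator {0..1} x *\<^sub>R D x) = D"
  proof
    show "indicator {0..1} x *\<^sub>R D x = D x" for x
      by (cases "x \<in> unit_ivl") (auto simp: D0)
  qed
  ultimately have int: "integrable lborel D" by (simp add: set_integrable_def)
  have pos: "primitive D x = \<psi> x" if "0 \<le> x" for x
  proof -
    have "primitive D x = (LINT t|lborel. indicator {0..x} t *\<^sub>R D t)"
      unfolding primitive_def using D0 by (intro Bochner_Integration.integral_cong) (auto simp: indicator_def)
    also have "\<dots> = \<psi> x - \<psi> 0"
      using that D by (intro integral_FTC_atLeastAtMost)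
       (auto intro: has_vector_derivative_at_within continuous_on_subset)
    also have "\<psi> 0 = 0" using K(2) by (intro K(3)) auto
    finally show ?thesis by simp
  qed
  have neg: "primitive D x = \<psi> x" if "x < 0" for x
  proof -
    have "x \<notin> K" using that K(2) by auto
    then show ?thesis using primitive_le_0[of D x, OF D0] that K(3) by simp
  qed
  show "primitive (deriv \<psi>) = \<psi>" unfolding dD using pos neg by (metis ext linorder_not_le)
  have "(LINT x|lborel. D x) = \<psi> 1" using primitive_ge_1[of D 1] D0 pos[of 1] by simp
  then show "(LINT x|lborel. deriv \<psi> x) = 0" using K(3)[of 1] K(2) unfolding dD by force
  show "integrable lborel (deriv \<psi>)" "\<And>x. x \<notin> unit_ivl \<Longrightarrow> deriv \<psi> x = 0"
    using int D0 by (auto simp: dD)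
qed

text \<open>
  Subtracting a multiple of a fixed bump \<open>\<rho>\<close> turns any continuous function with compact support into
  the derivative of a test function. Hence the integral of \<open>w\<close> against such functions is a constant
  multiple of their mean, and approximating indicators of intervals identifies \<open>w\<close> with that
  constant.
\<close>

lemma du_Bois_Reymond:
  assumes w: "integrable lborel w" "\<And>x. x \<notin> unit_ivl \<Longrightarrow> w x = 0"
    and test: "\<And>\<psi>. test_fun \<psi> \<Longrightarrow> (LINT x|lborel. w x * deriv \<psi> x) = 0"
  shows "\<exists>c. AE x in lborel. x \<in> unit_ivl \<longrightarrow> w x = c"
proof -
  \<comment> \<open>Continuous approximations of the indicator of \<open>(0,d)\<close>, supported in \<open>[1/k, d - 1/k]\<close>.\<close>
  define G where "G k d x = max 0 (min 1 (min (k * x - 1) (k * (d - x) - 1)))" for k d x :: real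
  have G: "0 \<le> G k d x" "G k d x \<le> 1" for k d x
    unfolding G_def by simp_all
  have Gc: "continuous_on UNIV (G k d)" for k d
    unfolding G_def by (intro continuous_intros)
  have Gm [measurable]: "G k d \<in> borel_measurable borel" for k d
    using Gc by (rule borel_measurable_continuous_onI)
  have Gsupp: "G k d x = 0" if "k > 0" "x \<le> 1 / k \<or> d - 1 / k \<le> x" for k d x
  proof -
    have "k * x - 1 \<le> 0 \<or> k * (d - x) - 1 \<le> 0" using that by (auto simp: field_simps)
    then show ?thesis unfolding G_def by linarith
  qed
  have Gint: "integrable lborel (G k d)" if "k > 0" "d \<le> 1" for k d
  proof (rule Bochner_Integration.integrable_bound)
    show "integrable lborel (indicator {0..1} :: real \<Rightarrow> real)" by simp
    have "\<bar>G k d x\<bar> \<le> indicator {0..1} x" for x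
    proof (cases "x \<in> {0..1}")
      case False
      moreover have "0 < 1 / k" using that by simp
      ultimately have "x \<le> 1 / k \<or> d - 1 / k \<le> x"
        using that unfolding atLeastAtMost_iff by linarith
      then show ?thesis using Gsupp[of k x d] that by simp
    qed (use G in auto)
    then show "AE x in lborel. norm (G k d x) \<le> norm (indicator {0..1} x :: real)" by simp
  qed simp
  define \<rho> where "\<rho> = G 4 1"
  define m where "m = (LINT x|lborel. \<rho> x)"
  have "(LINT x|lborel. indicator {3/8..5/8::real} x / 2) \<le> m" unfolding m_def \<rho>_def
  proof (intro integral_mono Gint)
    show "integrable lborel (\<lambda>x. indicat_real {3/8..5/8::real} x / 2)"
      by (intro integrable_divide integrable_real_indicator) auto
    show "indicat_real {3/8..5/8::real} x / 2 \<le> G 4 1 x" for x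
    proof (cases "x \<in> {3/8..5/8}")
      case True
      then have "1/2 \<le> 4 * x - 1" "1/2 \<le> 4 * (1 - x) - 1" by auto
      then show ?thesis using True unfolding G_def by simp
    qed (use G in auto)
  qed auto
  then have m: "m > 0" by simp
  define C where "C = (LINT x|lborel. w x * \<rho> x) / m"
  have wG: "integrable lborel (\<lambda>x. w x * G k d x)" for k d
    using w(1) by (rule Bochner_Integration.integrable_bound) (use w G in \<open>auto simp: abs_mult mult_left_le\<close>)
  have key: "(LINT x|lborel. w x * G k d x) = C * (LINT x|lborel. G k d x)" if k: "k > 0" "d \<le> 1" for k d
  proof -
    define t where "t = (LINT x|lborel. G k d x) / m"
    have "\<exists>\<psi>. test_fun \<psi> \<and> deriv \<psi> = (\<lambda>x. G k d x - t * \<rho> x)"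
    proof (rule test_fun_with_derivative[of _ "min (1/4) (1/k)" "max (3/4) (d - 1/k)"])
      show "continuous_on UNIV (\<lambda>x. G k d x - t * \<rho> x)" unfolding \<rho>_def by (intro continuous_intros Gc)
      show "(LINT x|lborel. G k d x - t * \<rho> x) = 0"
        using Gint[OF k] Gint[of 4 1] m by (simp add: t_def \<rho>_def m_def)
      show "G k d x - t * \<rho> x = 0" if "x \<notin> {min (1/4) (1/k)<..<max (3/4) (d - 1/k)}" for x
      proof -
        have "x \<le> 1/4 \<or> 1 - 1/4 \<le> x" "x \<le> 1/k \<or> d - 1/k \<le> x"
          using that unfolding greaterThanLessThan_iff by linarith+
        then show ?thesis using Gsupp[of k x d] Gsupp[of 4 x 1] k unfolding \<rho>_def by simp
      qed
      show "max (3/4) (d - 1/k) < 1" using k by (auto simp: less_le_trans[OF _ k(2)])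
    qed (use k in auto)
    then have "(LINT x|lborel. w x * (G k d x - t * \<rho> x)) = 0" using test by metis
    also have "(LINT x|lborel. w x * (G k d x - t * \<rho> x)) =
      (LINT x|lborel. w x * G k d x) - t * (LINT x|lborel. w x * \<rho> x)"
      using wG by (simp add: right_diff_distrib mult.left_commute \<rho>_def)
    finally show ?thesis by (simp add: t_def C_def)
  qed
  define v where "v x = w x - C * indicator unit_ivl x" for x
  have v: "integrable lborel v" "\<And>x. x \<notin> unit_ivl \<Longrightarrow> v x = 0"
  proof -
    show "integrable lborel v" unfolding v_def using w(1)
      by (intro Bochner_Integration.integrable_diff integrable_mult_right integrable_real_indicator) auto
    show "v x = 0" if "x \<notin> unit_ivl" for x using w(2)[OF that] that by (simp add: v_def)
  qed
  have vG: "(LINT x|lborel. v x * G k d x) = 0" if k: "k > 0" "d \<le> 1" for k d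
  proof -
    have "(LINT x|lborel. v x * G k d x) = (LINT x|lborel. w x * G k d x - C * G k d x)"
    proof (intro Bochner_Integration.integral_cong refl)
      fix x
      have "G k d x = 0" if "x \<notin> unit_ivl"
      proof -
        have "0 < 1 / k" using k by simp
        then have "x \<le> 1 / k \<or> d - 1 / k \<le> x"
          using that k unfolding greaterThanLessThan_iff by linarith
        then show ?thesis using Gsupp k by blast
      qed
      then show "v x * G k d x = w x * G k d x - C * G k d x"
        by (cases "x \<in> unit_ivl") (auto simp: v_def algebra_simps)
    qed
    also have "\<dots> = 0" using wG Gint[OF k] key[OF k] by simp
    finally show ?thesis .
  qed
  have prim01: "primitive v d = 0" if d: "0 < d" "d \<le> 1" for d
  proof -
    have "(\<lambda>k. LINT x|lborel. v x * G (real (Suc k)) d x) \<longlonglongrightarrow> (LINT x|lborel. v x * indicator {0<..<d} x)"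
    proof (rule integral_dominated_convergence)
      show "integrable lborel (\<lambda>x. \<bar>v x\<bar>)" using v by simp
      show "AE x in lborel. norm (v x * G (real (Suc k)) d x) \<le> \<bar>v x\<bar>" for k
        using G by (auto simp: abs_mult mult_left_le)
      have "(\<lambda>k. G (real (Suc k)) d x) \<longlonglongrightarrow> indicator {0<..<d} x" for x
      proof (rule tendsto_eventually)
        show "\<forall>\<^sub>F k in sequentially. G (real (Suc k)) d x = indicator {0<..<d} x"
        proof (cases "x \<in> {0<..<d}")
          case True
          have S: "filterlim (\<lambda>k. real (Suc k)) at_top sequentially"
            by (rule filterlim_compose[OF filterlim_real_sequentially filterlim_Suc])
          have "filterlim (\<lambda>k. x * real (Suc k)) at_top sequentially"
               "filterlim (\<lambda>k. (d - x) * real (Suc k)) at_top sequentially"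
            using True by (intro filterlim_tendsto_pos_mult_at_top[OF tendsto_const _ S]; simp)+
          then have "\<forall>\<^sub>F k in sequentially. 2 \<le> x * real (Suc k)"
                 "\<forall>\<^sub>F k in sequentially. 2 \<le> (d - x) * real (Suc k)"
            by (auto simp: filterlim_at_top)
          then show ?thesis
          proof eventually_elim
            case (elim k)
            then show ?case using True by (simp add: G_def mult.commute)
          qed
        next
          case False
          then have "G (real (Suc k)) d x = 0" for k
          proof (intro Gsupp)
            have "0 < 1 / real (Suc k)" by simp
            then show "x \<le> 1 / real (Suc k) \<or> d - 1 / real (Suc k) \<le> x"
              using False unfolding greaterThanLessThan_iff by linarith
          qed simp
          then show ?thesis using False by simp
        qed
      qed
      then show "AE x in lborel. (\<lambda>k. v x * G (real (Suc k)) d x) \<longlonglongrightarrow> v x * indicator {0<..<d} x"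
        by (intro AE_I2 tendsto_mult tendsto_const)
    qed (use v in measurable)
    moreover have "(LINT x|lborel. v x * G (real (Suc k)) d x) = 0" for k
      using d by (intro vG) auto
    ultimately have "(LINT x|lborel. v x * indicator {0<..<d} x) = 0" by (simp add: LIMSEQ_const_iff)
    also have "(LINT x|lborel. v x * indicator {0<..<d} x) = primitive v d"
      unfolding primitive_def
    proof (rule integral_cong_AE)
      show "AE x in lborel. v x * indicator {0<..<d} x = indicator {..d} x * v x"
        by (rule AE_mp[OF AE_lborel_singleton[of d]]) (use v in \<open>auto simp: indicator_def\<close>)
    qed (use v in measurable)
    finally show ?thesis .
  qed
  have "primitive v x = 0" for x
    using prim01[of x] prim01[of 1] primitive_le_0[of v x] primitive_ge_1[of v] v(2)
    by (metis le_cases linorder_not_le order_refl zero_less_one)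
  then have "AE x in lborel. v x = 0" by (intro AE_eq_0_if_primitive_eq_0 v)
  then have "AE x in lborel. x \<in> unit_ivl \<longrightarrow> w x = C" by eventually_elim (simp add: v_def)
  then show ?thesis by blast
qed

section \<open>Uniqueness of the distributional derivative\<close>

lemma integrable_mult_bounded:
  fixes r g :: "'a \<Rightarrow> real"
  assumes r: "integrable M r" and g: "g \<in> borel_measurable M" "\<And>x. \<bar>g x\<bar> \<le> C"
  shows "integrable M (\<lambda>x. r x * g x)"
proof (rule Bochner_Integration.integrable_bound)
  show "integrable M (\<lambda>x. C * r x)" using r by simp
  have "\<bar>r x\<bar> * \<bar>g x\<bar> \<le> \<bar>r x\<bar> * \<bar>C\<bar>" for x
    by (intro mult_left_mono order_trans[OF g(2)]) auto
  then show "AE x in M. norm (r x * g x) \<le> norm (C * r x)"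
    by (simp add: abs_mult mult.commute)
qed (use r g in measurable)

lemma integrable_on_unit_ivl:
  fixes g :: "real \<Rightarrow> real"
  assumes "g \<in> borel_measurable borel" "\<And>x. \<bar>g x\<bar> \<le> C"
  shows "integrable lborel (\<lambda>x. indicator unit_ivl x * g x)"
proof (rule Bochner_Integration.integrable_bound)
  show "integrable lborel (\<lambda>x. C * indicator unit_ivl x :: real)"
    by (intro integrable_mult_right integrable_real_indicator) auto
  show "AE x in lborel. norm (indicator unit_ivl x * g x) \<le> norm (C * indicator unit_ivl x)"
    by (intro AE_I2) (auto simp: indicator_def intro: order_trans[OF assms(2)])
qed (use assms(1) in measurable)

text \<open>
  Both functions have the same distributional derivative: for test functions the formula for
  primitives expresses the integral with respect to \<open>\<nu>\<close> through its distribution function.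
\<close>

lemma BV_eq_distribution_function:
  assumes v: "set_integrable lebesgue unit_ivl v" "has_distr_deriv v \<nu>"
  shows "\<exists>c. AE x in lborel. x \<in> unit_ivl \<longrightarrow> v x = distribution_function \<nu> x + c"
proof -
  have \<nu>: "signed_measure borel_ivl \<nu>" using v by (simp add: has_distr_deriv_def)
  let ?\<Phi> = "distribution_function \<nu>"
  obtain v' where v': "integrable lborel v'" "\<And>x. x \<notin> unit_ivl \<Longrightarrow> v' x = 0"
    "AE x in lborel. indicator unit_ivl x * v x = v' x"
    using borel_representative[OF v(1)] by blast
  note [measurable] = measurable_distribution_function[OF \<nu>]
  have \<Phi>i: "integrable lborel (\<lambda>x. indicator unit_ivl x * ?\<Phi> x)"
    by (rule integrable_on_unit_ivl[OF _ abs_signed_measure_le[OF \<nu>]]) (auto simp: sets_borel_ivl)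
  define w where "w x = v' x - indicator unit_ivl x * ?\<Phi> x" for x
  have wi: "integrable lborel w" unfolding w_def using v'(1) \<Phi>i by (rule Bochner_Integration.integrable_diff)
  have "\<exists>c. AE x in lborel. x \<in> unit_ivl \<longrightarrow> w x = c"
  proof (rule du_Bois_Reymond[OF wi])
    show "w x = 0" if "x \<notin> unit_ivl" for x using v'(2)[OF that] that by (simp add: w_def)
    fix \<psi> assume \<psi>: "test_fun \<psi>"
    note d = test_fun_eq_primitive[OF \<psi>]
    have dc: "deriv \<psi> \<in> borel_measurable borel" using d(1) by auto
    obtain D where D: "\<And>x. (\<psi> has_vector_derivative D x) (at x)" "continuous_on UNIV D"
      using \<psi> by (auto simp: test_fun_def C1_differentiable_on_def)
    have dD: "deriv \<psi> = D"
      using D by (intro ext DERIV_imp_deriv) (simp add: has_real_derivative_iff_has_vector_derivative)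
    have "compact (deriv \<psi> ` {0..1})" using D(2) unfolding dD
      by (intro compact_continuous_image) (auto intro: continuous_on_subset)
    then have "bounded (deriv \<psi> ` {0..1})" by (rule compact_imp_bounded)
    then have "\<exists>C. \<forall>x\<in>{0..1}. \<bar>deriv \<psi> x\<bar> \<le> C" by (auto simp: bounded_iff)
    then obtain C where C: "\<And>x. x \<in> {0..1} \<Longrightarrow> \<bar>deriv \<psi> x\<bar> \<le> C" by blast
    have C': "\<bar>deriv \<psi> x\<bar> \<le> \<bar>C\<bar>" for x
      using C[of x] d(2)[of x] by (cases "x \<in> unit_ivl") auto
    have i1: "integrable lborel (\<lambda>x. v' x * deriv \<psi> x)"
      using v'(1) dc C' by (intro integrable_mult_bounded) auto
    have i2: "integrable lborel (\<lambda>x. indicator unit_ivl x * ?\<Phi> x * deriv \<psi> x)"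
      using dc by (intro integrable_mult_bounded[OF \<Phi>i _ C']) auto
    have "(LINT x|lborel. v' x * deriv \<psi> x) = (LINT x:unit_ivl|lebesgue. v x * deriv \<psi> x)"
      using integral_borel_representative[OF v(1) _ v'(3) dc] v'(1) by (simp add: mult.commute)
    also have "\<dots> = - signed_integral borel_ivl \<nu> \<psi>" using v(2) \<psi> by (simp add: has_distr_deriv_def)
    also have "\<dots> = (LINT x|lborel. deriv \<psi> x * ?\<Phi> x)"
      using signed_integral_primitive[OF \<nu> d(1) d(3)] by (simp add: d(4))
    also have "\<dots> = (LINT x|lborel. indicator unit_ivl x * ?\<Phi> x * deriv \<psi> x)"
    proof (intro Bochner_Integration.integral_cong refl)
      show "deriv \<psi> x * ?\<Phi> x = indicator unit_ivl x * ?\<Phi> x * deriv \<psi> x" for x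
        using d(2)[of x] by (cases "x \<in> unit_ivl") auto
    qed
    finally show "(LINT x|lborel. w x * deriv \<psi> x) = 0"
      using i1 i2 unfolding w_def left_diff_distrib by simp
  qed
  then obtain c where c: "AE x in lborel. x \<in> unit_ivl \<longrightarrow> w x = c" by blast
  have "AE x in lborel. x \<in> unit_ivl \<longrightarrow> v x = ?\<Phi> x + c"
    using c v'(3) by eventually_elim (auto simp: w_def)
  then show ?thesis by blast
qed

text \<open>
  Dominated convergence. The hypothesis covers convergence from the right to an interior point as
  well as convergence from the left to the end point \<open>1\<close>, which carries no mass.
\<close>

lemma tendsto_distribution_function:
  assumes \<nu>: "signed_measure borel_ivl \<nu>"
    and u: "\<And>t. t \<in> unit_ivl \<Longrightarrow> \<forall>\<^sub>F n in sequentially. (t \<le> u n) = (t \<le> x)"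
  shows "(\<lambda>n. distribution_function \<nu> (u n)) \<longlonglongrightarrow> distribution_function \<nu> x"
  unfolding distribution_function_eq_integral[OF \<nu>]
proof (rule integral_dominated_convergence)
  let ?T = "total_variation borel_ivl \<nu>" and ?s = "polar_density borel_ivl \<nu>"
  have s [measurable]: "?s \<in> borel_measurable ?T" using integrable_polar_density[OF \<nu>] by auto
  have i: "(\<lambda>t. indicat_real {..y} t) \<in> borel_measurable ?T" for y
    by (rule borel_measurable_total_variation) measurable
  show "integrable ?T (\<lambda>t. \<bar>?s t\<bar>)" using integrable_polar_density[OF \<nu>] by simp
  show "(\<lambda>t. indicat_real {..x} t * ?s t) \<in> borel_measurable ?T" using i by measurable
  show "(\<lambda>t. indicat_real {..u n} t * ?s t) \<in> borel_measurable ?T" for n using i by measurable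
  show "AE t in ?T. norm (indicat_real {..u n} t * ?s t) \<le> \<bar>?s t\<bar>" for n
    by (intro AE_I2) (auto simp: indicator_def)
  show "AE t in ?T. (\<lambda>n. indicat_real {..u n} t * ?s t) \<longlonglongrightarrow> indicat_real {..x} t * ?s t"
  proof (intro AE_I2 tendsto_mult tendsto_const tendsto_eventually)
    fix t assume "t \<in> space ?T"
    then have "t \<in> unit_ivl" by simp
    from u[OF this] show "\<forall>\<^sub>F n in sequentially. indicat_real {..u n} t = indicat_real {..x} t"
      by eventually_elim (auto simp: indicator_def)
  qed
qed

lemma tendsto_distribution_function_right:
  assumes \<nu>: "signed_measure borel_ivl \<nu>" and u: "u \<longlonglongrightarrow> x" "\<And>n. x \<le> u n"
  shows "(\<lambda>n. distribution_function \<nu> (u n)) \<longlonglongrightarrow> distribution_function \<nu> x"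
proof (rule tendsto_distribution_function[OF \<nu>])
  fix t
  show "\<forall>\<^sub>F n in sequentially. (t \<le> u n) = (t \<le> x)"
  proof (cases "t \<le> x")
    case True
    then show ?thesis using u(2) order_trans by (intro always_eventually) blast
  next
    case False
    then have "\<forall>\<^sub>F n in sequentially. u n < t" using u(1) by (intro order_tendstoD) auto
    then show ?thesis by eventually_elim (use False in auto)
  qed
qed

text \<open>
  Right of the interval the distribution function is its limit at \<open>1\<close>.
\<close>

lemma signed_measure_eqI_unit_ivl:
  assumes \<nu>: "signed_measure borel_ivl \<nu>" and \<mu>: "signed_measure borel_ivl \<mu>"
    and eq: "\<And>x. x \<in> unit_ivl \<Longrightarrow> distribution_function \<nu> x = distribution_function \<mu> x"
    and A: "A \<in> sets borel_ivl"
  shows "\<nu> A = \<mu> A"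
proof (rule signed_measure_borel_ivl_eqI[OF \<nu> \<mu> _ A])
  fix x
  consider "x \<le> 0" | "x \<in> unit_ivl" | "1 \<le> x" by fastforce
  then show "distribution_function \<nu> x = distribution_function \<mu> x"
  proof cases
    case 1
    then have "unit_ivl \<inter> {..x} = {}" by auto
    then show ?thesis using signed_measure_empty[OF \<nu>] signed_measure_empty[OF \<mu>] by simp
  next
    case 3
    define u where "u n = 1 - 1 / real (n + 2)" for n
    have u1: "u n \<in> unit_ivl" for n by (simp add: u_def)
    have u: "u \<longlonglongrightarrow> 1"
      using tendsto_diff[OF tendsto_const LIMSEQ_ignore_initial_segment[OF lim_inverse_n', of 2], of "1::real"]
      by (simp add: u_def[abs_def])
    have ev: "\<forall>\<^sub>F n in sequentially. (t \<le> u n) = (t \<le> x)" if "t \<in> unit_ivl" for t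
      using order_tendstoD(1)[OF u, of t] that 3 by (auto elim!: eventually_mono)
    have "(\<lambda>n. distribution_function \<nu> (u n)) \<longlonglongrightarrow> distribution_function \<nu> x"
      by (rule tendsto_distribution_function[OF \<nu> ev])
    moreover have "(\<lambda>n. distribution_function \<nu> (u n)) \<longlonglongrightarrow> distribution_function \<mu> x"
      unfolding eq[OF u1] by (rule tendsto_distribution_function[OF \<mu> ev])
    ultimately show ?thesis by (rule LIMSEQ_unique)
  qed (rule eq)
qed

lemma AE_lborel_dense:
  assumes "AE x in lborel. P x" "(a::real) < b"
  shows "\<exists>x\<in>{a<..<b}. P x"
proof (rule ccontr)
  assume "\<not> ?thesis"
  then have "AE x in lborel. x \<notin> {a<..<b}" using assms(1) by (auto elim!: eventually_mono)
  then have "emeasure lborel {a<..<b} = 0"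
    by (subst (asm) AE_iff_measurable[where N="{a<..<b}"]) auto
  then show False using assms(2) by simp
qed

lemma AE_dense_from_right:
  assumes "AE x in lborel. P x" "(x::real) < b"
  obtains u :: "nat \<Rightarrow> real" where "u \<longlonglongrightarrow> x" "\<And>n. x < u n" "\<And>n. u n < b" "\<And>n. P (u n)"
proof -
  have "\<exists>y\<in>{x<..<min b (x + 1 / real (Suc n))}. P y" for n
    using assms by (intro AE_lborel_dense) auto
  then obtain u where u: "\<And>n. u n \<in> {x<..<min b (x + 1 / real (Suc n))}" "\<And>n. P (u n)" by metis
  have "u \<longlonglongrightarrow> x"
  proof (rule tendsto_sandwich[OF _ _ tendsto_const])
    show "(\<lambda>n. x + 1 / real (Suc n)) \<longlonglongrightarrow> x"
      using tendsto_add[OF tendsto_const LIMSEQ_inverse_real_of_nat, of x] by (simp add: inverse_eq_divide)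
  qed (use u(1) in \<open>auto intro!: always_eventually less_imp_le\<close>)
  then show thesis using u by (intro that[of u]) auto
qed

text \<open>
  Two derivatives have distribution functions that differ by a constant almost everywhere, hence
  everywhere by continuity from the right, and the constant is zero since both vanish at \<open>0\<close>.
\<close>

theorem distr_deriv_unique:
  assumes v: "set_integrable lebesgue unit_ivl v" "has_distr_deriv v \<nu>" "has_distr_deriv v \<mu>"
    and A: "A \<in> sets borel_ivl"
  shows "\<nu> A = \<mu> A"
proof -
  have \<nu>: "signed_measure borel_ivl \<nu>" and \<mu>: "signed_measure borel_ivl \<mu>"
    using v by (auto simp: has_distr_deriv_def)
  let ?F = "distribution_function \<nu>" and ?G = "distribution_function \<mu>"
  obtain c d where "AE x in lborel. x \<in> unit_ivl \<longrightarrow> v x = ?F x + c"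
    "AE x in lborel. x \<in> unit_ivl \<longrightarrow> v x = ?G x + d"
    using BV_eq_distribution_function[OF v(1) v(2)] BV_eq_distribution_function[OF v(1) v(3)] by blast
  then have ae: "AE x in lborel. x \<in> unit_ivl \<longrightarrow> ?F x - ?G x = d - c"
    by eventually_elim auto
  have const: "?F x - ?G x = d - c" if x: "0 \<le> x" "x < 1" for x
  proof -
    obtain u where u: "u \<longlonglongrightarrow> x" "\<And>n. x < u n" "\<And>n. u n < 1"
      "\<And>n. u n \<in> unit_ivl \<longrightarrow> ?F (u n) - ?G (u n) = d - c"
      using AE_dense_from_right[OF ae x(2)] by blast
    have "(\<lambda>n. ?F (u n) - ?G (u n)) \<longlonglongrightarrow> ?F x - ?G x"
      using u(1,2) \<nu> \<mu> by (intro tendsto_diff tendsto_distribution_function_right) (auto intro: less_imp_le)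
    moreover have "?F (u n) - ?G (u n) = d - c" for n using u(2,3,4)[of n] x(1) by auto
    ultimately show ?thesis by (simp add: LIMSEQ_const_iff)
  qed
  have "unit_ivl \<inter> {..0} = ({} :: real set)" by auto
  then have "?F 0 = 0" "?G 0 = 0" using signed_measure_empty[OF \<nu>] signed_measure_empty[OF \<mu>] by simp_all
  then have "d - c = 0" using const[of 0] by simp
  then have "?F x = ?G x" if "x \<in> unit_ivl" for x using const[of x] that by simp
  then show ?thesis by (rule signed_measure_eqI_unit_ivl[OF \<nu> \<mu> _ A])
qed

section \<open>Lebesgue decomposition and integration by parts\<close>

text \<open>
  A Lebesgue null set of maximal \<open>T\<close>-measure: a null set outside it with positive \<open>T\<close>-measure could be
  added to it.
\<close>

lemma singular_part_exists:
  assumes T: "finite_measure T" and sT: "sets T = sets borel_ivl"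
  obtains N where "N \<in> sets borel_ivl" "emeasure lborel N = 0"
    "\<And>A. A \<in> sets borel_ivl \<Longrightarrow> emeasure lborel A = 0 \<Longrightarrow> emeasure T (A - N) = 0"
proof -
  interpret finite_measure T by fact
  define NN where "NN = {N \<in> sets borel_ivl. emeasure lborel N = 0}"
  have "{} \<in> NN" by (simp add: NN_def)
  then have "emeasure T ` NN \<noteq> {}" by auto
  then obtain s :: "nat \<Rightarrow> ennreal" where s: "range s \<subseteq> emeasure T ` NN" "Sup (emeasure T ` NN) = (SUP i. s i)"
    using ennreal_Sup_countable_SUP by metis
  have "\<forall>i. \<exists>N. N \<in> NN \<and> s i = emeasure T N" using s(1) by blast
  then obtain B where B: "\<And>i. B i \<in> NN" "\<And>i. s i = emeasure T (B i)" by metis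
  define N where "N = (\<Union>i. B i)"
  have Bs: "B i \<in> sets borel_ivl" "emeasure lborel (B i) = 0" for i using B(1) by (auto simp: NN_def)
  have N: "N \<in> sets borel_ivl" using Bs(1) by (auto simp: N_def)
  have "N \<in> null_sets lborel"
    unfolding N_def using Bs by (intro null_sets_UN) (auto simp: null_sets_def sets_borel_ivl)
  then have N0: "emeasure lborel N = 0" by auto
  have max: "emeasure T X \<le> emeasure T N" if "X \<in> NN" for X
  proof -
    have "emeasure T X \<le> (SUP i. s i)" using that s(2) by (metis SUP_upper)
    also have "\<dots> \<le> emeasure T N"
      unfolding B(2) using N sT by (intro SUP_least emeasure_mono) (auto simp: N_def)
    finally show ?thesis .
  qed
  show thesis
  proof (rule that[OF N N0])
    fix A assume A: "A \<in> sets borel_ivl" "emeasure lborel A = 0"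
    have "A \<in> null_sets lborel" using A by (auto simp: null_sets_def sets_borel_ivl)
    then have "N \<union> A \<in> null_sets lborel" using \<open>N \<in> null_sets lborel\<close> by auto
    then have "N \<union> A \<in> NN" using A N by (auto simp: NN_def)
    have "emeasure T N + emeasure T (A - N) = emeasure T (N \<union> (A - N))"
      using A N sT by (intro plus_emeasure) auto
    also have "\<dots> = emeasure T (N \<union> A)" by simp
    also have "\<dots> \<le> emeasure T N" using \<open>N \<union> A \<in> NN\<close> by (rule max)
    finally show "emeasure T (A - N) = 0"
      using emeasure_finite[of N] by (simp add: ennreal_add_left_cancel_le[of _ _ 0, simplified])
  qed
qed

text \<open>
  Off a null set \<open>N\<close> that carries as much of the variation as possible, the variation is absolutely
  continuous. Its Radon-Nikodym density times the polar density is the density of \<open>\<nu>\<close> off \<open>N\<close>, and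
  the restriction of \<open>\<nu>\<close> to \<open>N\<close> is the singular part.
\<close>

theorem lebesgue_decomposition_exists:
  assumes \<nu>: "signed_measure borel_ivl \<nu>"
  shows "\<exists>g \<mu>. lebesgue_decomp \<nu> g \<mu>"
proof -
  define T where "T = total_variation borel_ivl \<nu>"
  define \<sigma> where "\<sigma> = polar_density borel_ivl \<nu>"
  have sT [simp, measurable_cong]: "sets T = sets borel_ivl" and spT: "space T = unit_ivl"
    by (simp_all add: T_def)
  interpret T: finite_measure T unfolding T_def by (rule finite_measure_total_variation[OF \<nu>])
  have \<sigma>: "integrable T \<sigma>" unfolding T_def \<sigma>_def by (rule integrable_polar_density[OF \<nu>])
  have \<sigma>m: "\<sigma> \<in> borel_measurable borel_ivl"
    using borel_measurable_integrable[OF \<sigma>] by (simp cong: measurable_cong_sets)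
  obtain N where N: "N \<in> sets borel_ivl" "emeasure lborel N = 0"
    "\<And>A. A \<in> sets borel_ivl \<Longrightarrow> emeasure lborel A = 0 \<Longrightarrow> emeasure T (A - N) = 0"
    using singular_part_exists[OF T.finite_measure_axioms sT] by blast
  define L where "L = restrict_space lborel unit_ivl"
  have sL [simp, measurable_cong]: "sets L = sets borel_ivl"
    unfolding L_def by (rule sets_restrict_space_cong) simp
  have spL: "space L = unit_ivl" by (simp add: L_def space_restrict_space)
  have eL: "emeasure L A = emeasure lborel A" if "A \<in> sets borel_ivl" for A
    unfolding L_def using that by (intro emeasure_restrict_space) (auto simp: sets_borel_ivl)
  interpret L: finite_measure L
    by (rule finite_measureI) (simp add: spL eL sets_borel_ivl)
  have Nc: "unit_ivl - N \<in> sets borel_ivl" using N(1) by (auto simp: sets_borel_ivl)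
  have Ncm: "(indicator (unit_ivl - N) :: real \<Rightarrow> real) \<in> borel_measurable T" using Nc by simp
  define T0 where "T0 = density T (\<lambda>x. ennreal (indicator (unit_ivl - N) x))"
  have sT0 [simp, measurable_cong]: "sets T0 = sets borel_ivl" by (simp add: T0_def)
  have eT0: "emeasure T0 A = emeasure T (A - N)" if A: "A \<in> sets borel_ivl" for A
  proof -
    have m: "(\<lambda>x. ennreal (indicator (unit_ivl - N) x)) \<in> borel_measurable T" using Ncm by measurable
    have "emeasure T0 A = (\<integral>\<^sup>+x. ennreal (indicator (unit_ivl - N) x) * indicator A x \<partial>T)"
      unfolding T0_def using A by (intro emeasure_density[OF m]) simp
    also have "\<dots> = (\<integral>\<^sup>+x. indicator (A - N) x \<partial>T)"
      using A by (intro nn_integral_cong) (auto simp: indicator_def sets_borel_ivl)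
    finally have "emeasure T0 A = (\<integral>\<^sup>+x. indicator (A - N) x \<partial>T)" .
    then show ?thesis using A N by (simp add: sets.Diff)
  qed
  have "absolutely_continuous L T0"
    unfolding absolutely_continuous_def
  proof
    fix A assume A: "A \<in> null_sets L"
    then have "A \<in> sets borel_ivl" "emeasure lborel A = 0" using eL by (auto simp: null_sets_def)
    then show "A \<in> null_sets T0" using N(3) eT0 by (auto simp: null_sets_def)
  qed
  then obtain f where f: "f \<in> borel_measurable L" "density L f = T0"
    using L.Radon_Nikodym[of T0] by auto
  have "(\<integral>\<^sup>+x. f x \<partial>L) = emeasure T0 (space L)"
    unfolding f(2)[symmetric] using f(1) by (subst emeasure_density) (auto intro!: nn_integral_cong simp: spL sets_borel_ivl)
  also have "\<dots> \<noteq> \<infinity>" using eT0[of unit_ivl] T.emeasure_finite by (simp add: spL sets_borel_ivl)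
  finally have "AE x in L. f x \<noteq> \<infinity>" using f(1) by (intro nn_integral_PInf_AE) auto
  define h where "h x = enn2real (f x)" for x
  have hm: "h \<in> borel_measurable L" unfolding h_def using f(1) by measurable
  have "density L (\<lambda>x. ennreal (h x)) = density L f"
  proof (rule density_cong)
    show "AE x in L. ennreal (h x) = f x"
      using \<open>AE x in L. f x \<noteq> \<infinity>\<close> by eventually_elim (simp add: h_def ennreal_enn2real_if)
  qed (use f hm in auto)
  then have T0L: "density L (\<lambda>x. ennreal (h x)) = T0" using f(2) by simp
  have \<sigma>L: "\<sigma> \<in> borel_measurable L" using \<sigma>m by (simp cong: measurable_cong_sets)
  have \<sigma>T: "\<sigma> \<in> borel_measurable T" using \<sigma> by auto
  have h0: "0 \<le> h x" for x by (simp add: h_def)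
  have "integrable T0 \<sigma>"
    unfolding T0_def using integrable_indicator_mult[OF \<sigma>, of "unit_ivl - N"] Nc Ncm \<sigma>T
    by (subst integrable_density) auto
  then have hi: "integrable L (\<lambda>x. h x * \<sigma> x)"
    unfolding T0L[symmetric] using hm \<sigma>L h0 by (subst (asm) integrable_density) auto
  define g where "g x = indicator unit_ivl x * (h x * \<sigma> x)" for x
  have gi: "integrable lborel g"
    using hi unfolding L_def g_def by (subst (asm) integrable_restrict_space) auto
  have gint: "(LINT x:A|lebesgue. g x) = \<nu> (A - N)" if A: "A \<in> sets borel_ivl" for A
  proof -
    have Ab: "A \<in> sets borel" "A \<subseteq> unit_ivl" using A by (auto simp: sets_borel_ivl)
    have Am: "(indicator A :: real \<Rightarrow> real) \<in> borel_measurable L" using A by simp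
    have "(LINT x:A|lebesgue. g x) = (LINT x|lborel. indicator A x * g x)"
      unfolding set_lebesgue_integral_def using gi Ab
      by (subst integral_completion) auto
    also have "\<dots> = (LINT x|lborel. indicator unit_ivl x *\<^sub>R (h x * (indicator A x * \<sigma> x)))"
      using Ab by (intro Bochner_Integration.integral_cong) (auto simp: g_def indicator_def)
    also have "\<dots> = (LINT x|L. h x *\<^sub>R (indicator A x * \<sigma> x))"
      unfolding L_def by (subst integral_restrict_space) auto
    also have "\<dots> = (LINT x|T0. indicator A x * \<sigma> x)"
      unfolding T0L[symmetric] using hm \<sigma>L h0 Am by (subst integral_density) auto
    also have "\<dots> = (LINT x|T. indicator (unit_ivl - N) x *\<^sub>R (indicator A x * \<sigma> x))"
      unfolding T0_def using Ncm \<sigma>T A by (subst integral_density) auto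
    also have "\<dots> = (LINT x:(A - N)|T. \<sigma> x)"
      unfolding set_lebesgue_integral_def
      using Ab by (intro Bochner_Integration.integral_cong) (auto simp: indicator_def)
    also have "\<dots> = \<nu> (A - N)"
      unfolding T_def \<sigma>_def using A N(1) by (intro signed_measure_eq_integral[OF \<nu>, symmetric]) auto
    finally show ?thesis .
  qed
  define \<mu> where "\<mu> A = \<nu> (A \<inter> N)" for A
  have \<mu>: "signed_measure borel_ivl \<mu>"
    unfolding \<mu>_def by (rule signed_measure_restrict[OF \<nu> N(1)])
  have "emeasure (total_variation borel_ivl \<mu>) (unit_ivl - N) = 0"
  proof -
    obtain H where H: "H \<in> sets borel_ivl" "\<And>A. A \<in> sets borel_ivl \<Longrightarrow> A \<subseteq> H \<Longrightarrow> 0 \<le> \<mu> A"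
      "\<And>A. A \<in> sets borel_ivl \<Longrightarrow> A \<inter> H = {} \<Longrightarrow> \<mu> A \<le> 0"
      by (rule signed_measure_Hahn_decomposition[OF \<mu>]) blast
    have e: "(unit_ivl - N) \<inter> H \<inter> N = {}" "(unit_ivl - N - H) \<inter> N = {}" by auto
    have "emeasure (total_variation borel_ivl \<mu>) (unit_ivl - N) =
        ennreal (\<mu> ((unit_ivl - N) \<inter> H) - \<mu> (unit_ivl - N - H))"
      by (rule total_variation_Hahn[OF \<mu> H Nc])
    then show ?thesis
      unfolding \<mu>_def e by (simp add: signed_measure_empty[OF \<nu>])
  qed
  moreover have "emeasure lebesgue N = 0" using N by (simp add: sets_borel_ivl)
  moreover have "\<nu> A = (LINT x:A|lebesgue. g x) + \<mu> A" if A: "A \<in> sets borel_ivl" for A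
  proof -
    have "\<nu> ((A - N) \<union> (A \<inter> N)) = \<nu> (A - N) + \<nu> (A \<inter> N)"
      using A N(1) by (intro signed_measure_Un[OF \<nu>]) auto
    moreover have "(A - N) \<union> (A \<inter> N) = A" by auto
    ultimately show ?thesis using gint[OF A] by (simp add: \<mu>_def)
  qed
  moreover have "set_integrable lebesgue unit_ivl g"
  proof -
    have "integrable lborel (\<lambda>x. indicator unit_ivl x * g x)"
      using gi by (intro integrable_indicator_mult) auto
    then show ?thesis
      unfolding set_integrable_def by (subst integrable_completion) auto
  qed
  ultimately show ?thesis unfolding lebesgue_decomp_def using \<mu> N(1) by blast
qed

lemma has_distr_deriv_distr_deriv: "v \<in> BV \<Longrightarrow> has_distr_deriv v (distr_deriv v)"
  unfolding BV_def distr_deriv_def by (auto intro: someI[of "has_distr_deriv v"])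

lemma lebesgue_decomp_deriv:
  assumes v: "v \<in> BV"
  shows "lebesgue_decomp (distr_deriv v) (deriv_ac v) (deriv_sing v)"
proof -
  have "signed_measure borel_ivl (distr_deriv v)"
    using has_distr_deriv_distr_deriv[OF v] by (simp add: has_distr_deriv_def)
  then have "\<exists>x. case x of (g, \<mu>) \<Rightarrow> lebesgue_decomp (distr_deriv v) g \<mu>"
    using lebesgue_decomposition_exists by auto
  from someI_ex[OF this] show ?thesis
    unfolding deriv_ac_def deriv_sing_def by (simp add: case_prod_unfold)
qed

text \<open>
  With \<open>p = primitive r\<close> this is \<open>\<integral> p dD\<phi> = - \<integral> p' \<phi>\<close>, the measure \<open>D\<phi>\<close> being split into its two
  parts as in the weak formulation. All three integrals are expressed by distribution functions;
  the constant by which \<open>\<phi>\<close> differs from that of \<open>D\<phi>\<close> disappears since \<open>r\<close> has mean zero.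
\<close>

theorem BV_integration_by_parts:
  assumes \<phi>: "\<phi> \<in> BV" and r: "integrable lborel r" "\<And>x. x \<notin> unit_ivl \<Longrightarrow> r x = 0"
    and r0: "(LINT x|lborel. r x) = 0"
  shows "(LINT x:unit_ivl|lebesgue. primitive r x * deriv_ac \<phi> x)
      + signed_integral borel_ivl (deriv_sing \<phi>) (primitive r)
      = - (LINT x:unit_ivl|lebesgue. r x * \<phi> x)"
proof -
  define \<nu> where "\<nu> = distr_deriv \<phi>"
  define \<mu> where "\<mu> = deriv_sing \<phi>"
  have dec: "lebesgue_decomp \<nu> (deriv_ac \<phi>) \<mu>" unfolding \<nu>_def \<mu>_def by (rule lebesgue_decomp_deriv[OF \<phi>])
  have h\<nu>: "has_distr_deriv \<phi> \<nu>" unfolding \<nu>_def by (rule has_distr_deriv_distr_deriv[OF \<phi>])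
  then have \<nu>: "signed_measure borel_ivl \<nu>" by (simp add: has_distr_deriv_def)
  have \<mu>: "signed_measure borel_ivl \<mu>" using dec by (simp add: lebesgue_decomp_def)
  have \<phi>i: "set_integrable lebesgue unit_ivl \<phi>" using \<phi> by (simp add: BV_def)
  have gi: "set_integrable lebesgue unit_ivl (deriv_ac \<phi>)" using dec by (simp add: lebesgue_decomp_def)
  obtain g where g: "integrable lborel g" "\<And>x. x \<notin> unit_ivl \<Longrightarrow> g x = 0"
    "AE x in lborel. indicator unit_ivl x * deriv_ac \<phi> x = g x"
    using borel_representative[OF gi] by blast
  have cdf: "distribution_function \<nu> x = primitive g x + distribution_function \<mu> x" for x
  proof -
    have "(LINT t:(unit_ivl \<inter> {..x})|lebesgue. deriv_ac \<phi> t) = (LINT t:unit_ivl|lebesgue. indicator {..x} t * deriv_ac \<phi> t)"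
      unfolding set_lebesgue_integral_def by (intro Bochner_Integration.integral_cong) (auto simp: indicator_def)
    also have "\<dots> = (LINT t|lborel. indicator {..x} t * g t)"
      using g(1) by (intro integral_borel_representative[OF gi _ g(3)]) auto
    finally show ?thesis
      using dec by (auto simp: lebesgue_decomp_def sets_borel_ivl primitive_def)
  qed
  have rm [measurable]: "r \<in> borel_measurable borel" using r(1) by auto
  have r\<nu>: "integrable lborel (\<lambda>x. r x * distribution_function \<nu> x)"
    using r(1) measurable_distribution_function[OF \<nu>]
    by (intro integrable_mult_bounded[where C="LINT t|total_variation borel_ivl \<nu>. \<bar>polar_density borel_ivl \<nu> t\<bar>"]
          abs_signed_measure_le[OF \<nu>]) (auto simp: sets_borel_ivl)
  have rg: "integrable lborel (\<lambda>x. r x * primitive g x)"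
    using r(1) g(1) by (intro integrable_mult_bounded[where C="LINT t|lborel. \<bar>g t\<bar>"] abs_primitive_le) auto
  obtain c where c: "AE x in lborel. x \<in> unit_ivl \<longrightarrow> \<phi> x = distribution_function \<nu> x + c"
    using BV_eq_distribution_function[OF \<phi>i h\<nu>] by blast
  have 1: "signed_integral borel_ivl \<mu> (primitive r) =
      - (LINT x|lborel. r x * distribution_function \<nu> x) + (LINT x|lborel. r x * primitive g x)"
  proof -
    have "r x * distribution_function \<mu> x = r x * distribution_function \<nu> x - r x * primitive g x" for x
      by (simp add: cdf algebra_simps)
    then show ?thesis unfolding signed_integral_primitive[OF \<mu> r(1) r0] using r\<nu> rg by simp
  qed
  have 2: "(LINT x|lborel. r x * primitive g x) = - (LINT x|lborel. primitive r x * g x)"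
    using Fubini_triangle[of lborel r g] r(1) g(1) r0
    by (simp add: primitive_def[of g] lborel.sigma_finite_measure_axioms mult.commute)
  have 3: "(LINT x:unit_ivl|lebesgue. primitive r x * deriv_ac \<phi> x) = (LINT x|lborel. primitive r x * g x)"
    using g(1) r(1) by (intro integral_borel_representative[OF gi _ g(3)]) auto
  have "AE x in lborel. indicator unit_ivl x * \<phi> x = indicator unit_ivl x * (distribution_function \<nu> x + c)"
    using c by eventually_elim (simp add: indicator_def)
  then have "(LINT x:unit_ivl|lebesgue. r x * \<phi> x) =
      (LINT x|lborel. r x * (indicator unit_ivl x * (distribution_function \<nu> x + c)))"
    using measurable_distribution_function[OF \<nu>] by (intro integral_borel_representative[OF \<phi>i _ _ rm]) auto
  also have "\<dots> = (LINT x|lborel. r x * (distribution_function \<nu> x + c))"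
  proof (intro Bochner_Integration.integral_cong refl)
    show "r x * (indicator unit_ivl x * (distribution_function \<nu> x + c)) = r x * (distribution_function \<nu> x + c)" for x
      by (cases "x \<in> unit_ivl") (simp_all add: r(2))
  qed
  also have "\<dots> = (LINT x|lborel. r x * distribution_function \<nu> x)"
    using r\<nu> r(1) r0 by (simp add: distrib_left)
  finally show ?thesis using 1 2 3 by (simp add: \<mu>_def)
qed

section \<open>The discrete energy and its minimisers\<close>

definition curvature_flux :: "real \<Rightarrow> real" where
  "curvature_flux s = s / sqrt (1 + s\<^sup>2)"

text \<open>
  The energy of the step function with values \<open>u 0, \<dots>, u (n - 1)\<close>, whose slopes \<open>n (u (i + 1) - u i)\<close>
  sit at the \<open>n - 1\<close> interior nodes. The weights \<open>c\<close> stand for \<open>lam\<close> times the integrals of the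
  coefficient over the cells.
\<close>

definition discrete_energy :: "nat \<Rightarrow> (nat \<Rightarrow> real) \<Rightarrow> (real \<Rightarrow> real) \<Rightarrow> (nat \<Rightarrow> real) \<Rightarrow> real" where
  "discrete_energy n c F u =
     (\<Sum>i<n - 1. (sqrt (1 + (real n * (u (Suc i) - u i))\<^sup>2) - 1) / real n) - (\<Sum>i<n. c i * F (u i))"

lemma one_plus_square_pos: "0 < 1 + (s::real)\<^sup>2"
  by (simp add: add_pos_nonneg)

lemma DERIV_sqrt_one_plus_square:
  "((\<lambda>s. sqrt (1 + s\<^sup>2)) has_real_derivative curvature_flux s) (at s)"
proof -
  have "((\<lambda>s. 1 + s\<^sup>2) has_real_derivative 2 * s) (at s)"
    by (auto intro!: derivative_eq_intros)
  from DERIV_chain2[OF DERIV_real_sqrt[OF one_plus_square_pos] this]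
  show ?thesis by (simp add: curvature_flux_def field_simps)
qed

text \<open>
  The energy is varied by shifting the nodes \<open>0, \<dots>, k\<close> simultaneously. Only the slope between the
  nodes \<open>k\<close> and \<open>k + 1\<close> changes, so the summed equation appears at once; for the last \<open>k\<close> no slope
  changes, which is the second boundary condition.
\<close>

lemma discrete_energy_Euler_Lagrange:
  assumes n: "n > 0" and k: "k < n"
    and F: "\<And>s. (F has_real_derivative f s) (at s)"
    and min: "\<And>v. discrete_energy n c F u \<le> discrete_energy n c F v"
  shows "(if Suc k < n then curvature_flux (real n * (u (Suc k) - u k)) else 0) = - (\<Sum>i\<le>k. c i * f (u i))"
proof -
  \<comment> \<open>The direction in which all nodes up to \<open>k\<close> move together.\<close>
  define e :: "nat \<Rightarrow> real" where "e i = of_bool (i \<le> k)" for i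
  define v where "v t i = u i + t * e i" for t i
  let ?s = "\<lambda>i. real n * (u (Suc i) - u i)"
  have "((\<lambda>t. (sqrt (1 + (real n * (v t (Suc i) - v t i))\<^sup>2) - 1) / real n)
     has_real_derivative curvature_flux (?s i) * (e (Suc i) - e i)) (at 0)" for i
  proof -
    have "((\<lambda>t. real n * (v t (Suc i) - v t i)) has_real_derivative real n * (e (Suc i) - e i)) (at 0)"
      unfolding v_def by (auto intro!: derivative_eq_intros)
    then have "((\<lambda>t. sqrt (1 + (real n * (v t (Suc i) - v t i))\<^sup>2)) has_real_derivative
        curvature_flux (?s i) * (real n * (e (Suc i) - e i))) (at 0)"
      using DERIV_sqrt_one_plus_square[of "?s i"]
      by (intro DERIV_chain2[where f="\<lambda>s. sqrt (1 + s\<^sup>2)"]) (auto simp: v_def)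
    from DERIV_cdivide[OF DERIV_diff[OF this DERIV_const[of 1]], of "real n"] n
    show ?thesis by simp
  qed
  moreover have "((\<lambda>t. c i * F (v t i)) has_real_derivative c i * (f (u i) * e i)) (at 0)" for i
  proof -
    have "((\<lambda>t. v t i) has_real_derivative e i) (at 0)"
      unfolding v_def by (auto intro!: derivative_eq_intros)
    then have "((\<lambda>t. F (v t i)) has_real_derivative f (u i) * e i) (at 0)"
      using F[of "u i"] by (intro DERIV_chain2[where f=F]) (auto simp: v_def)
    then show ?thesis by (auto intro!: derivative_eq_intros)
  qed
  ultimately have D: "((\<lambda>t. discrete_energy n c F (v t)) has_real_derivative
     (\<Sum>i<n - 1. curvature_flux (?s i) * (e (Suc i) - e i)) - (\<Sum>i<n. c i * (f (u i) * e i))) (at 0)"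
    unfolding discrete_energy_def by (intro DERIV_diff DERIV_sum)
  have M: "discrete_energy n c F (v 0) \<le> discrete_energy n c F (v t)" for t
  proof -
    have "v 0 = u" by (simp add: v_def fun_eq_iff)
    then show ?thesis using min[of "v t"] by simp
  qed
  have "(\<Sum>i<n - 1. curvature_flux (?s i) * (e (Suc i) - e i)) - (\<Sum>i<n. c i * (f (u i) * e i)) = 0"
    by (rule DERIV_local_min[OF D zero_less_one]) (use M in auto)
  moreover have "(\<Sum>i<n - 1. curvature_flux (?s i) * (e (Suc i) - e i)) =
     (\<Sum>i<n - 1. if i = k then - curvature_flux (?s k) else 0)"
    by (intro sum.cong) (auto simp: e_def)
  moreover have "\<dots> = - (if Suc k < n then curvature_flux (?s k) else 0)"
    using k by auto
  moreover have "(\<Sum>i<n. c i * (f (u i) * e i)) = (\<Sum>i\<in>{..<n} \<inter> {i. i \<le> k}. c i * f (u i))"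
    unfolding sum.inter_restrict[OF finite_lessThan] by (intro sum.cong) (auto simp: e_def)
  moreover have "{..<n} \<inter> {i. i \<le> k} = {..k}" using k by auto
  ultimately show ?thesis by simp
qed

lemma node_diff_le_variation:
  fixes u :: "nat \<Rightarrow> real"
  assumes "i < n" "j < n"
  shows "u i - u j \<le> (\<Sum>l<n - 1. \<bar>u (Suc l) - u l\<bar>)"
proof -
  have mono: "\<bar>u i - u j\<bar> \<le> (\<Sum>l<n - 1. \<bar>u (Suc l) - u l\<bar>)" if "j \<le> i" "i < n" for i j
  proof -
    have "\<bar>u i - u j\<bar> \<le> (\<Sum>l\<in>{j..<i}. \<bar>u (Suc l) - u l\<bar>)"
      using sum_Suc_diff'[OF that(1), of u] sum_abs[of "\<lambda>l. u (Suc l) - u l" "{j..<i}"] by simp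
    also have "\<dots> \<le> (\<Sum>l<n - 1. \<bar>u (Suc l) - u l\<bar>)"
      using that by (intro sum_mono2) auto
    finally show ?thesis .
  qed
  show ?thesis using mono[of i j] mono[of j i] assms by (cases "j \<le> i") auto
qed

text \<open>
  A function whose derivative tends to zero grows more slowly than any linear function, uniformly
  with respect to the starting point.
\<close>

lemma primitive_growth:
  assumes F: "\<And>s. (F has_real_derivative f s) (at s)" and F0: "F 0 = 0"
    and f: "\<And>s. 0 \<le> f s" and f_lim: "(f \<longlongrightarrow> 0) at_top" and \<epsilon>: "\<epsilon> > 0"
  shows "\<exists>C\<ge>0. \<forall>m\<ge>0. \<forall>V\<ge>0. F (m + V) - F m \<le> C + \<epsilon> * V"
proof -
  have mono: "F x \<le> F y" if "x \<le> y" for x y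
    using that F f by (intro DERIV_nonneg_imp_nondecreasing[of x y F]) auto
  have "\<forall>\<^sub>F s in at_top. f s < \<epsilon>" using f_lim \<epsilon> by (rule order_tendstoD)
  then obtain S0 where S0: "\<And>s. s \<ge> S0 \<Longrightarrow> f s < \<epsilon>" by (auto simp: eventually_at_top_linorder)
  define S where "S = max S0 0"
  have lin: "F y - F x \<le> \<epsilon> * (y - x)" if "S \<le> x" "x \<le> y" for x y
  proof -
    have "\<epsilon> * x - F x \<le> \<epsilon> * y - F y"
    proof (rule DERIV_nonneg_imp_nondecreasing[OF that(2)])
      fix s assume "x \<le> s" "s \<le> y"
      then have "f s < \<epsilon>" using that S0[of s] by (simp add: S_def)
      moreover have "((\<lambda>s. \<epsilon> * s - F s) has_real_derivative \<epsilon> - f s) (at s)"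
        by (auto intro!: derivative_eq_intros F)
      ultimately show "\<exists>y. ((\<lambda>s. \<epsilon> * s - F s) has_real_derivative y) (at s) \<and> 0 \<le> y"
        by (intro exI[of _ "\<epsilon> - f s"]) auto
    qed
    then show ?thesis by (simp add: algebra_simps)
  qed
  have FS: "0 \<le> F S" using mono[of 0 S] F0 by (simp add: S_def)
  have "F (m + V) - F m \<le> F S + \<epsilon> * V" if "m \<ge> 0" "V \<ge> 0" for m V
  proof -
    have m0: "0 \<le> F m" using mono[of 0 m] F0 that by simp
    consider "S \<le> m" | "m < S" "S \<le> m + V" | "m + V < S" by linarith
    then show ?thesis
    proof cases
      case 1
      then show ?thesis using lin[of m "m + V"] that FS by simp
    next
      case 2
      then have "F (m + V) - F S \<le> \<epsilon> * (m + V - S)" by (intro lin) auto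
      also have "\<dots> \<le> \<epsilon> * V" using 2 \<epsilon> by (intro mult_left_mono) auto
      finally show ?thesis using m0 by simp
    next
      case 3
      then have "F (m + V) \<le> F S" by (intro mono) simp
      moreover have "0 \<le> \<epsilon> * V" using \<epsilon> that by simp
      ultimately show ?thesis using m0 by simp
    qed
  qed
  then show ?thesis using FS by blast
qed

text \<open>
  Let \<open>m\<close> be the least value and \<open>V\<close> the variation of \<open>u\<close>. The kinetic part is at least \<open>V - 1\<close>. In the
  potential part, replacing every value by \<open>m\<close> contributes \<open>- A F(m)\<close>, and the error is at most
  \<open>B (F(m + V) - F(m))\<close>, which sublinear growth bounds by a constant plus \<open>V/2\<close>. So
  \<open>V/2 + A F(m)\<close> is bounded for energies below zero, by a constant that does not involve \<open>n\<close>.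
\<close>

theorem discrete_energy_coercive:
  assumes F: "\<And>s. (F has_real_derivative f s) (at s)" and F0: "F 0 = 0"
    and f: "\<And>s. 0 \<le> f s" and f_lim: "(f \<longlongrightarrow> 0) at_top" and F_lim: "filterlim F at_top at_top"
    and A: "A > 0" and B: "B \<ge> 0"
  shows "\<exists>R\<ge>0. \<forall>n c u. n > 0 \<longrightarrow> (\<Sum>i<n. c i) = - A \<longrightarrow> (\<Sum>i<n. \<bar>c i\<bar>) \<le> B \<longrightarrow>
     (\<forall>i<n. 0 \<le> u i) \<longrightarrow> discrete_energy n c F u \<le> 0 \<longrightarrow>
     (\<Sum>i<n - 1. \<bar>u (Suc i) - u i\<bar>) \<le> R \<and> (\<forall>i<n. u i \<le> R)"
proof -
  have mono: "F x \<le> F y" if "x \<le> y" for x y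
    using that F f by (intro DERIV_nonneg_imp_nondecreasing[of x y F]) auto
  \<comment> \<open>Any \<open>\<epsilon>\<close> with \<open>B \<epsilon> \<le> 1/2\<close> will do; the summand \<open>1\<close> admits \<open>B = 0\<close>.\<close>
  define \<epsilon> where "\<epsilon> = 1 / (2 * B + 1)"
  have \<epsilon>: "\<epsilon> > 0" "B * \<epsilon> \<le> 1 / 2" using B by (auto simp: \<epsilon>_def field_simps)
  obtain C where C: "C \<ge> 0" "\<And>m V. m \<ge> 0 \<Longrightarrow> V \<ge> 0 \<Longrightarrow> F (m + V) - F m \<le> C + \<epsilon> * V"
    using primitive_growth[OF F F0 f f_lim \<epsilon>(1)] by blast
  define V0 where "V0 = 2 * (1 + B * C)"
  have V0: "V0 \<ge> 0" using B C by (simp add: V0_def)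
  have "\<forall>\<^sub>F s in at_top. (1 + B * C) / A < F s" using F_lim by (auto simp: filterlim_at_top_dense)
  then obtain m0 where m0: "\<And>s. s \<ge> m0 \<Longrightarrow> (1 + B * C) / A < F s" by (auto simp: eventually_at_top_linorder)
  define R where "R = max m0 0 + V0"
  have "(\<Sum>i<n - 1. \<bar>u (Suc i) - u i\<bar>) \<le> R \<and> (\<forall>i<n. u i \<le> R)"
    if n: "n > 0" and cA: "(\<Sum>i<n. c i) = - A" and cB: "(\<Sum>i<n. \<bar>c i\<bar>) \<le> B"
     and u: "\<forall>i<n. 0 \<le> u i" and J: "discrete_energy n c F u \<le> 0" for n c u
  proof -
    define V where "V = (\<Sum>i<n - 1. \<bar>u (Suc i) - u i\<bar>)"
    have V: "V \<ge> 0" by (auto simp: V_def intro!: sum_nonneg)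
    define m where "m = Min (u ` {..<n})"
    have "m \<in> u ` {..<n}" unfolding m_def using n by (intro Min_in) auto
    then obtain l where l: "l < n" "u l = m" by auto
    have um: "m \<le> u i" if "i < n" for i unfolding m_def using that by (intro Min_le) auto
    have uV: "u i \<le> m + V" if "i < n" for i
      using node_diff_le_variation[OF that l(1), of u] l by (simp add: V_def)
    have m: "m \<ge> 0" using u l by auto
    have "(\<Sum>i<n - 1. \<bar>u (Suc i) - u i\<bar> - 1 / real n) = V - real (n - 1) * (1 / real n)"
      by (simp add: V_def sum_subtractf)
    moreover have "real (n - 1) * (1 / real n) \<le> 1" using n by (simp add: field_simps)
    ultimately have "V - 1 \<le> (\<Sum>i<n - 1. \<bar>u (Suc i) - u i\<bar> - 1 / real n)" by linarith
    also have "\<dots> \<le> (\<Sum>i<n - 1. (sqrt (1 + (real n * (u (Suc i) - u i))\<^sup>2) - 1) / real n)"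
    proof (rule sum_mono)
      fix i
      have "\<bar>real n * (u (Suc i) - u i)\<bar> \<le> sqrt (1 + (real n * (u (Suc i) - u i))\<^sup>2)"
        by (rule real_le_rsqrt) simp
      then have "(real n * \<bar>u (Suc i) - u i\<bar> - 1) / real n
         \<le> (sqrt (1 + (real n * (u (Suc i) - u i))\<^sup>2) - 1) / real n"
        using n by (intro divide_right_mono) (auto simp: abs_mult)
      then show "\<bar>u (Suc i) - u i\<bar> - 1 / real n \<le> (sqrt (1 + (real n * (u (Suc i) - u i))\<^sup>2) - 1) / real n"
        using n by (simp add: diff_divide_distrib)
    qed
    also have "\<dots> \<le> (\<Sum>i<n. c i * F (u i))" using J by (simp add: discrete_energy_def)
    also have "\<dots> = (\<Sum>i<n. c i * (F (u i) - F m)) + (\<Sum>i<n. c i) * F m"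
      by (simp add: right_diff_distrib sum_subtractf sum_distrib_right)
    also have "(\<Sum>i<n. c i * (F (u i) - F m)) \<le> (\<Sum>i<n. \<bar>c i\<bar> * (C + \<epsilon> * V))"
    proof (rule sum_mono)
      fix i assume "i \<in> {..<n}"
      then have i: "i < n" by simp
      have 1: "0 \<le> F (u i) - F m" using mono[OF um[OF i]] by simp
      have "F (u i) - F m \<le> F (m + V) - F m" using mono[OF uV[OF i]] by simp
      also have "\<dots> \<le> C + \<epsilon> * V" using m V by (rule C(2))
      finally have 2: "F (u i) - F m \<le> C + \<epsilon> * V" .
      have "c i * (F (u i) - F m) \<le> \<bar>c i\<bar> * (F (u i) - F m)" using 1 by (intro mult_right_mono) auto
      also have "\<dots> \<le> \<bar>c i\<bar> * (C + \<epsilon> * V)" using 2 by (intro mult_left_mono) auto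
      finally show "c i * (F (u i) - F m) \<le> \<bar>c i\<bar> * (C + \<epsilon> * V)" .
    qed
    also have "(\<Sum>i<n. \<bar>c i\<bar> * (C + \<epsilon> * V)) = (\<Sum>i<n. \<bar>c i\<bar>) * (C + \<epsilon> * V)" by (simp add: sum_distrib_right)
    also have "\<dots> \<le> B * (C + \<epsilon> * V)" using cB C \<epsilon> V by (intro mult_right_mono) auto
    also have "B * (C + \<epsilon> * V) = B * C + (B * \<epsilon>) * V" by (simp add: algebra_simps)
    also have "\<dots> \<le> B * C + 1 / 2 * V" using \<epsilon>(2) V by (intro add_left_mono mult_right_mono) auto
    finally have main: "V / 2 + A * F m \<le> 1 + B * C" using cA by simp
    have "0 \<le> F m" using mono[OF m] F0 by simp
    then have "0 \<le> A * F m" using A by simp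
    then have VV: "V \<le> V0" using main by (simp add: V0_def)
    have "A * F m \<le> 1 + B * C" using main V by simp
    then have "F m \<le> (1 + B * C) / A" using A by (simp add: field_simps)
    then have "m < m0" using m0[of m] by (meson not_le)
    then have "m + V \<le> R" using VV by (simp add: R_def)
    then have "V \<le> R" "\<forall>i<n. u i \<le> R" using uV m by (auto intro: order_trans)
    then show ?thesis unfolding V_def by blast
  qed
  moreover have "R \<ge> 0" using V0 by (simp add: R_def)
  ultimately show ?thesis by blast
qed

lemma discrete_energy_positive_part:
  assumes c: "\<And>s. s \<le> 0 \<Longrightarrow> F s = 0"
  shows "discrete_energy n c F (\<lambda>i. max (u i) 0) \<le> discrete_energy n c F u"
proof -
  have "F (max (u i) 0) = F (u i)" for i using c[of "u i"] c[of 0] by (auto simp: max_def)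
  moreover have "(sqrt (1 + (real n * (max (u (Suc i)) 0 - max (u i) 0))\<^sup>2) - 1) / real n
     \<le> (sqrt (1 + (real n * (u (Suc i) - u i))\<^sup>2) - 1) / real n" for i
  proof -
    have "\<bar>max (u (Suc i)) 0 - max (u i) 0\<bar> \<le> \<bar>u (Suc i) - u i\<bar>" by (auto simp: max_def)
    then have "(max (u (Suc i)) 0 - max (u i) 0)\<^sup>2 \<le> (u (Suc i) - u i)\<^sup>2"
      by (metis abs_le_square_iff)
    then show ?thesis
      by (intro divide_right_mono diff_right_mono real_sqrt_le_mono add_left_mono)
         (auto simp: power_mult_distrib intro!: mult_left_mono)
  qed
  ultimately show ?thesis unfolding discrete_energy_def by (auto intro!: diff_right_mono sum_mono)
qed

lemma compact_box: "compact {u :: nat \<Rightarrow> real. \<forall>i. u i \<in> {0..R}}"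
proof -
  have "compactin (product_topology (\<lambda>i::nat. euclidean :: real topology) UNIV) (PiE UNIV (\<lambda>i. {0..R}))"
    by (subst compactin_PiE) (auto simp: compactin_euclidean_iff)
  moreover have "PiE UNIV (\<lambda>i. {0..R}) = {u :: nat \<Rightarrow> real. \<forall>i. u i \<in> {0..R}}"
    by (auto simp: PiE_UNIV_domain)
  ultimately show ?thesis
    unfolding euclidean_product_topology compactin_euclidean_iff by simp
qed

text \<open>
  Taking positive parts does not increase the energy, and nonnegative competitors with energy at most
  that of zero lie in a compact box. Nodes from \<open>n\<close> onwards do not enter the energy.
\<close>

theorem discrete_energy_minimiser_exists:
  assumes n: "n > 0" and F: "continuous_on UNIV F" and F0: "\<And>s. s \<le> 0 \<Longrightarrow> F s = 0"
    and R: "R \<ge> 0" "\<And>u. (\<forall>i<n. 0 \<le> u i) \<Longrightarrow> discrete_energy n c F u \<le> 0 \<Longrightarrow> \<forall>i<n. u i \<le> R"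
  shows "\<exists>u. (\<forall>i. 0 \<le> u i) \<and> (\<forall>v. discrete_energy n c F u \<le> discrete_energy n c F v)"
proof -
  let ?K = "{u :: nat \<Rightarrow> real. \<forall>i. u i \<in> {0..R}}" and ?J = "discrete_energy n c F"
  have coord: "continuous_on ?K (\<lambda>u. u i)" for i :: nat
    by (rule continuous_on_subset[OF continuous_on_product_coordinates]) auto
  have Fc: "continuous_on ?K (\<lambda>u. F (u i))" for i :: nat
    by (rule continuous_on_compose2[OF F coord]) simp
  have cont: "continuous_on ?K ?J"
    unfolding discrete_energy_def divide_inverse
    by (intro continuous_on_diff continuous_on_sum continuous_on_mult continuous_on_const
        continuous_on_real_sqrt continuous_on_add continuous_on_power coord Fc)
  have ne: "?K \<noteq> {}" using R(1) by (auto intro!: exI[of _ "\<lambda>_. 0"])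
  obtain u where u: "u \<in> ?K" "\<And>v. v \<in> ?K \<Longrightarrow> ?J u \<le> ?J v"
    using continuous_attains_inf[OF compact_box ne cont] by meson
  have J0: "?J (\<lambda>_. 0) = 0" using F0[of 0] by (simp add: discrete_energy_def)
  have "?J u \<le> ?J v" for v
  proof (cases "?J (\<lambda>i. max (v i) 0) \<le> 0")
    case True
    let ?w = "\<lambda>i. if i < n then max (v i) 0 else 0"
    have "?J ?w = ?J (\<lambda>i. max (v i) 0)"
      unfolding discrete_energy_def by (intro arg_cong2[where f="(-)"] sum.cong refl) auto
    moreover have "?w \<in> ?K" using R(2)[OF _ True] R(1) by auto
    ultimately have "?J u \<le> ?J (\<lambda>i. max (v i) 0)" using u(2)[of ?w] by simp
    also have "\<dots> \<le> ?J v" by (rule discrete_energy_positive_part[OF F0])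
    finally show ?thesis .
  next
    case False
    have "?J u \<le> 0" using u(2)[of "\<lambda>_. 0"] J0 R(1) by simp
    also have "\<dots> \<le> ?J (\<lambda>i. max (v i) 0)" using False by simp
    also have "\<dots> \<le> ?J v" by (rule discrete_energy_positive_part[OF F0])
    finally show ?thesis .
  qed
  then show ?thesis using u(1) by auto
qed

section \<open>Step functions on a uniform grid\<close>

definition step_function :: "nat \<Rightarrow> (nat \<Rightarrow> real) \<Rightarrow> real \<Rightarrow> real" where
  "step_function n u x = u (nat \<lfloor>real n * x\<rfloor>)"

text \<open>
  The mean over a cell would differ by the factor \<open>n\<close>; sums over cells are then plain sums.
\<close>

definition cell_integral :: "(real \<Rightarrow> real) \<Rightarrow> nat \<Rightarrow> nat \<Rightarrow> real" where
  "cell_integral a n i = (LINT x|lborel. indicator {real i / real n..<real (Suc i) / real n} x * a x)"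

lemma measurable_step_function [measurable]: "step_function n u \<in> borel_measurable borel"
proof -
  have "(\<lambda>x. \<lfloor>real n * x\<rfloor>) \<in> measurable borel (count_space UNIV)" by measurable
  from measurable_compose[OF this, of "\<lambda>i. u (nat i)" borel] show ?thesis
    by (simp add: step_function_def[abs_def])
qed

lemma mem_cell_iff:
  assumes "n > 0" "0 \<le> x"
  shows "x \<in> {real i / real n..<real (Suc i) / real n} \<longleftrightarrow> nat \<lfloor>real n * x\<rfloor> = i"
proof -
  have "x \<in> {real i / real n..<real (Suc i) / real n} \<longleftrightarrow> real i \<le> real n * x \<and> real n * x < real i + 1"
    using assms by (simp add: field_simps)
  also have "\<dots> \<longleftrightarrow> \<lfloor>real n * x\<rfloor> = int i" by (auto simp: floor_eq_iff)
  also have "\<dots> \<longleftrightarrow> nat \<lfloor>real n * x\<rfloor> = i" using assms by auto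
  finally show ?thesis .
qed

lemma less_node_iff:
  assumes "n > 0" "0 \<le> x"
  shows "x < real (Suc k) / real n \<longleftrightarrow> nat \<lfloor>real n * x\<rfloor> \<le> k"
proof -
  have "x < real (Suc k) / real n \<longleftrightarrow> real n * x < real_of_int (int k + 1)"
    using assms by (simp add: field_simps)
  also have "\<dots> \<longleftrightarrow> \<lfloor>real n * x\<rfloor> < int k + 1" by (rule floor_less_iff[symmetric])
  also have "\<dots> \<longleftrightarrow> \<lfloor>real n * x\<rfloor> \<le> int k" by linarith
  also have "\<dots> \<longleftrightarrow> nat \<lfloor>real n * x\<rfloor> \<le> k" by linarith
  finally show ?thesis .
qed

text \<open>
  At the nodes, the primitive of \<open>a G(u)\<close> for a step function \<open>u\<close> is a finite sum. This turns the
  discrete Euler-Lagrange equations into statements about an absolutely continuous flux.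
\<close>

lemma sum_cell_integral:
  assumes a: "integrable lborel a" "\<And>x. x \<notin> unit_ivl \<Longrightarrow> a x = 0" and n: "n > 0"
  shows "(\<Sum>i\<le>k. cell_integral a n i * G (u i)) =
     primitive (\<lambda>x. a x * G (step_function n u x)) (real (Suc k) / real n)"
proof -
  let ?I = "\<lambda>i. {real i / real n..<real (Suc i) / real n}"
  have am [measurable]: "a \<in> borel_measurable borel" using a(1) by auto
  have Gm [measurable]: "(\<lambda>x. G (step_function n u x)) \<in> borel_measurable borel"
    using measurable_step_function[of n "\<lambda>i. G (u i)"] by (simp add: step_function_def[abs_def])
  have "(\<Sum>i\<le>k. cell_integral a n i * G (u i)) = (LINT x|lborel. (\<Sum>i\<le>k. indicator (?I i) x * a x * G (u i)))"
    unfolding cell_integral_def using a(1)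
    by (subst Bochner_Integration.integral_sum) (auto intro!: integrable_indicator_mult)
  also have "\<dots> = primitive (\<lambda>x. a x * G (step_function n u x)) (real (Suc k) / real n)"
    unfolding primitive_def
  proof (rule integral_cong_AE)
    show "AE x in lborel. (\<Sum>i\<le>k. indicator (?I i) x * a x * G (u i)) =
       indicator {..real (Suc k) / real n} x * (a x * G (step_function n u x))"
    proof (rule AE_mp[OF AE_lborel_singleton[of "real (Suc k) / real n"]], intro AE_I2 impI)
      fix x assume x: "x \<noteq> real (Suc k) / real n"
      show "(\<Sum>i\<le>k. indicator (?I i) x * a x * G (u i)) =
       indicator {..real (Suc k) / real n} x * (a x * G (step_function n u x))"
      proof (cases "x \<in> unit_ivl")
        case True
        define j where "j = nat \<lfloor>real n * x\<rfloor>"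
        have ind: "indicator (?I i) x = (if i = j then 1 else 0 :: real)" for i
          using mem_cell_iff[OF n, of x i] True by (auto simp: indicator_def j_def)
        have "(\<Sum>i\<le>k. indicator (?I i) x * a x * G (u i)) = (\<Sum>i\<le>k. if i = j then a x * G (u j) else 0)"
          unfolding ind by (intro sum.cong) auto
        also have "\<dots> = (if j \<le> k then a x * G (u j) else 0)" by simp
        also have "j \<le> k \<longleftrightarrow> x \<le> real (Suc k) / real n"
          using less_node_iff[OF n, of x k] True x by (auto simp: j_def)
        finally show ?thesis by (simp add: step_function_def j_def indicator_def)
      qed (simp add: a(2))
    qed
  qed measurable
  finally show ?thesis .
qed

lemma sum_cell_integral_total:
  assumes a: "integrable lborel a" "\<And>x. x \<notin> unit_ivl \<Longrightarrow> a x = 0" and n: "n > 0"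
  shows "(\<Sum>i<n. cell_integral a n i * G (u i)) = (LINT x|lborel. a x * G (step_function n u x))"
proof -
  have "{..<n} = {..n - 1}" "Suc (n - 1) = n" using n by auto
  then have "(\<Sum>i<n. cell_integral a n i * G (u i)) = primitive (\<lambda>x. a x * G (step_function n u x)) 1"
    using sum_cell_integral[OF a n, where k="n - 1" and G=G and u=u] n by simp
  also have "\<dots> = (LINT x|lborel. a x * G (step_function n u x))"
    by (rule primitive_ge_1) (simp_all add: a(2))
  finally show ?thesis .
qed

lemma sum_abs_cell_integral_le:
  assumes a: "integrable lborel a" "\<And>x. x \<notin> unit_ivl \<Longrightarrow> a x = 0" and n: "n > 0"
  shows "(\<Sum>i<n. \<bar>cell_integral a n i\<bar>) \<le> (LINT x|lborel. \<bar>a x\<bar>)"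
proof -
  have "(\<Sum>i<n. \<bar>cell_integral a n i\<bar>) \<le> (\<Sum>i<n. cell_integral (\<lambda>x. \<bar>a x\<bar>) n i)"
  proof (rule sum_mono)
    fix i
    let ?I = "{real i / real n..<real (Suc i) / real n}"
    have "\<bar>cell_integral a n i\<bar> \<le> (LINT x|lborel. \<bar>indicator ?I x * a x\<bar>)"
      unfolding cell_integral_def by (rule integral_abs_bound)
    then show "\<bar>cell_integral a n i\<bar> \<le> cell_integral (\<lambda>x. \<bar>a x\<bar>) n i"
      by (simp add: cell_integral_def abs_mult)
  qed
  also have "\<dots> = (LINT x|lborel. \<bar>a x\<bar>)"
    using sum_cell_integral_total[of "\<lambda>x. \<bar>a x\<bar>" n, where G="\<lambda>_. 1"] a n by simp
  finally show ?thesis .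
qed

lemma sqrt_one_plus_square_le: "sqrt (1 + s\<^sup>2) - 1 \<le> s\<^sup>2 / 2"
proof -
  have "sqrt (1 + s\<^sup>2) \<le> 1 + s\<^sup>2 / 2"
  proof (rule real_le_lsqrt)
    have "(1 + s\<^sup>2 / 2)\<^sup>2 = 1 + s\<^sup>2 + (s\<^sup>2 / 2)\<^sup>2"
      by (simp add: power2_eq_square algebra_simps)
    then show "1 + s\<^sup>2 \<le> (1 + s\<^sup>2 / 2)\<^sup>2" by simp
  qed simp
  then show ?thesis by simp
qed

text \<open>
  The Cauchy-Schwarz inequality on a cell, obtained by expanding the square of the deviation of \<open>\<rho>\<close>
  from its mean \<open>s\<close>.
\<close>

lemma square_cell_integral_le:
  assumes \<rho>: "integrable lborel \<rho>" and \<rho>2: "integrable lborel (\<lambda>x. (\<rho> x)\<^sup>2)" and n: "n > 0"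
  shows "(real n * cell_integral \<rho> n i)\<^sup>2 / real n \<le> cell_integral (\<lambda>x. (\<rho> x)\<^sup>2) n i"
proof -
  define s where "s = real n * cell_integral \<rho> n i"
  let ?I = "{real i / real n..<real (Suc i) / real n}"
  have I: "(LINT x|lborel. indicator ?I x :: real) = 1 / real n"
    using n by (simp add: diff_divide_distrib[symmetric] divide_right_mono)
  have "real i / real n \<le> real (Suc i) / real n" by (simp add: divide_right_mono)
  then have Ii: "integrable lborel (indicator ?I :: real \<Rightarrow> real)"
    by (intro integrable_real_indicator) (simp_all del: of_nat_Suc)
  have "0 \<le> (LINT x|lborel. indicator ?I x * (\<rho> x - s)\<^sup>2)"
    by (rule integral_nonneg_AE) auto
  also have "\<dots> = (LINT x|lborel. indicator ?I x * (\<rho> x)\<^sup>2 - (2 * s) * (indicator ?I x * \<rho> x) + s\<^sup>2 * indicator ?I x)"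
    by (intro Bochner_Integration.integral_cong) (auto simp: power2_eq_square algebra_simps)
  also have "\<dots> = cell_integral (\<lambda>x. (\<rho> x)\<^sup>2) n i - (2 * s) * cell_integral \<rho> n i + s\<^sup>2 * (1 / real n)"
    unfolding cell_integral_def I[symmetric] using \<rho> \<rho>2 Ii
    by (subst Bochner_Integration.integral_add Bochner_Integration.integral_diff;
        (intro Bochner_Integration.integrable_diff integrable_mult_right integrable_indicator_mult; simp)?)+ simp
  also have "\<dots> = cell_integral (\<lambda>x. (\<rho> x)\<^sup>2) n i - s\<^sup>2 / real n"
    using n by (simp add: s_def power2_eq_square field_simps)
  finally show ?thesis by (simp add: s_def)
qed

text \<open>
  Sampling a function at the nodes does not increase the quadratic Dirichlet integral, which in turn
  dominates the area functional.
\<close>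

lemma discrete_energy_sampled_le:
  assumes a: "integrable lborel a" "\<And>x. x \<notin> unit_ivl \<Longrightarrow> a x = 0" and n: "n > 0"
    and \<rho>: "integrable lborel \<rho>" "\<And>x. x \<notin> unit_ivl \<Longrightarrow> \<rho> x = 0" and \<rho>2: "integrable lborel (\<lambda>x. (\<rho> x)\<^sup>2)"
  shows "discrete_energy n (\<lambda>i. lam * cell_integral a n i) F (\<lambda>i. \<epsilon> * (c + primitive \<rho> (real i / real n)))
    \<le> \<epsilon>\<^sup>2 / 2 * (LINT x|lborel. (\<rho> x)\<^sup>2) -
      lam * (LINT x|lborel. a x * F (\<epsilon> * (c + primitive \<rho> (real_of_int \<lfloor>real n * x\<rfloor> / real n))))"
proof -
  define w where "w i = \<epsilon> * (c + primitive \<rho> (real i / real n))" for i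
  have cell: "primitive \<rho> (real (Suc i) / real n) - primitive \<rho> (real i / real n) = cell_integral \<rho> n i" for i
  proof -
    have "primitive \<rho> (real (Suc i) / real n) - primitive \<rho> (real i / real n)
       = (LINT t|lborel. indicator {real i / real n<..real (Suc i) / real n} t * \<rho> t)"
      using n by (intro primitive_diff_eq \<rho>) (simp add: divide_right_mono)
    also have "\<dots> = cell_integral \<rho> n i"
      unfolding cell_integral_def
    proof (rule integral_cong_AE)
      show "AE t in lborel. indicator {real i / real n<..real (Suc i) / real n} t * \<rho> t
        = indicator {real i / real n..<real (Suc i) / real n} t * \<rho> t"
        by (rule AE_mp[OF AE_lborel_singleton[of "real i / real n"]],
            rule AE_mp[OF AE_lborel_singleton[of "real (Suc i) / real n"]])
           (auto simp: indicator_def)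
    qed (use \<rho>(1) in measurable)
    finally show ?thesis .
  qed
  have "(\<Sum>i<n - 1. (sqrt (1 + (real n * (w (Suc i) - w i))\<^sup>2) - 1) / real n)
     \<le> (\<Sum>i<n - 1. \<epsilon>\<^sup>2 / 2 * cell_integral (\<lambda>x. (\<rho> x)\<^sup>2) n i)"
  proof (rule sum_mono)
    fix i
    have w: "real n * (w (Suc i) - w i) = \<epsilon> * (real n * cell_integral \<rho> n i)"
      unfolding cell[symmetric] w_def by (simp add: algebra_simps)
    have "(sqrt (1 + (real n * (w (Suc i) - w i))\<^sup>2) - 1) / real n
      \<le> ((real n * (w (Suc i) - w i))\<^sup>2 / 2) / real n"
      by (intro divide_right_mono sqrt_one_plus_square_le) auto
    also have "\<dots> = \<epsilon>\<^sup>2 / 2 * ((real n * cell_integral \<rho> n i)\<^sup>2 / real n)"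
      unfolding w by (simp add: power_mult_distrib)
    also have "\<dots> \<le> \<epsilon>\<^sup>2 / 2 * cell_integral (\<lambda>x. (\<rho> x)\<^sup>2) n i"
      by (intro mult_left_mono square_cell_integral_le[OF \<rho>(1) \<rho>2 n]) auto
    finally show "(sqrt (1 + (real n * (w (Suc i) - w i))\<^sup>2) - 1) / real n
       \<le> \<epsilon>\<^sup>2 / 2 * cell_integral (\<lambda>x. (\<rho> x)\<^sup>2) n i" .
  qed
  also have "\<dots> \<le> (\<Sum>i<n. \<epsilon>\<^sup>2 / 2 * cell_integral (\<lambda>x. (\<rho> x)\<^sup>2) n i)"
    unfolding cell_integral_def by (intro sum_mono2 mult_nonneg_nonneg integral_nonneg_AE) auto
  also have "\<dots> = \<epsilon>\<^sup>2 / 2 * (LINT x|lborel. (\<rho> x)\<^sup>2)"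
  proof -
    have "(\<Sum>i<n. cell_integral (\<lambda>x. (\<rho> x)\<^sup>2) n i) = (LINT x|lborel. (\<rho> x)\<^sup>2)"
      using sum_cell_integral_total[of "\<lambda>x. (\<rho> x)\<^sup>2" n, where G="\<lambda>_. 1"] \<rho>(2) \<rho>2 n by simp
    then show ?thesis by (simp only: sum_distrib_left[symmetric])
  qed
  finally have kin: "(\<Sum>i<n - 1. (sqrt (1 + (real n * (w (Suc i) - w i))\<^sup>2) - 1) / real n)
     \<le> \<epsilon>\<^sup>2 / 2 * (LINT x|lborel. (\<rho> x)\<^sup>2)" .
  have "(\<Sum>i<n. lam * cell_integral a n i * F (w i)) = lam * (LINT x|lborel. a x * F (step_function n w x))"
    using sum_cell_integral_total[OF a n, where G=F and u=w] by (simp add: sum_distrib_left[symmetric] mult.assoc)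
  also have "(LINT x|lborel. a x * F (step_function n w x)) =
     (LINT x|lborel. a x * F (\<epsilon> * (c + primitive \<rho> (real_of_int \<lfloor>real n * x\<rfloor> / real n))))"
  proof (intro Bochner_Integration.integral_cong refl)
    fix x
    show "a x * F (step_function n w x) = a x * F (\<epsilon> * (c + primitive \<rho> (real_of_int \<lfloor>real n * x\<rfloor> / real n)))"
    proof (cases "x \<in> unit_ivl")
      case True
      then have "real (nat \<lfloor>real n * x\<rfloor>) = real_of_int \<lfloor>real n * x\<rfloor>" by simp
      then show ?thesis by (simp add: step_function_def w_def)
    qed (simp add: a(2))
  qed
  finally show ?thesis using kin unfolding discrete_energy_def w_def by linarith
qed

section \<open>Negative energy above the principal eigenvalue\<close>

text \<open>
  The eigenfunction is written as \<open>c + primitive \<rho>\<close> with \<open>\<rho>\<close> its derivative. As \<open>\<rho>\<close> vanishes off the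
  interval, the extension is constant on both sides and therefore positive everywhere. Testing the
  eigenvalue equation with the eigenfunction itself gives the final identity; the boundary terms
  vanish by the Neumann conditions.
\<close>

lemma eigenfunction_primitive:
  assumes eig: "neumann_eigenfunction a lam0 \<phi>" and pos: "\<And>x. x \<in> {0..1} \<Longrightarrow> \<phi> x > 0"
    and b: "integrable lborel b" "\<And>x. x \<notin> unit_ivl \<Longrightarrow> b x = 0"
      "AE x in lborel. indicator unit_ivl x * a x = b x"
  obtains c \<rho> where "integrable lborel \<rho>" "\<And>x. x \<notin> unit_ivl \<Longrightarrow> \<rho> x = 0"
    "integrable lborel (\<lambda>x. (\<rho> x)\<^sup>2)" "\<And>x. 0 < c + primitive \<rho> x"
    "(LINT x|lborel. (\<rho> x)\<^sup>2) = lam0 * (LINT x|lborel. b x * (c + primitive \<rho> x)\<^sup>2)"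
proof -
  obtain p r0 where d: "\<And>x. x \<in> {0..1} \<Longrightarrow> (\<phi> has_real_derivative p x) (at x within {0..1})"
    and r0: "set_integrable lebesgue unit_ivl r0"
    and p: "\<And>x. x \<in> {0..1} \<Longrightarrow> p x = p 0 + (LINT t:{0<..<x}|lebesgue. r0 t)"
    and eq: "AE x in lebesgue. x \<in> unit_ivl \<longrightarrow> - r0 x = lam0 * a x * \<phi> x"
    and p01: "p 0 = 0" "p 1 = 0"
    using eig unfolding neumann_eigenfunction_def by blast
  obtain r where r: "integrable lborel r" "\<And>x. x \<notin> unit_ivl \<Longrightarrow> r x = 0"
    "AE x in lborel. indicator unit_ivl x * r0 x = r x"
    using borel_representative[OF r0] by blast
  have rm [measurable]: "r \<in> borel_measurable borel" using r(1) by auto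
  define \<rho> where "\<rho> = primitive r"
  have p\<rho>: "p x = \<rho> x" if x: "x \<in> {0..1}" for x
  proof -
    have "(LINT t:{0<..<x}|lebesgue. r0 t) = (LINT t:unit_ivl|lebesgue. indicator {0<..<x} t * r0 t)"
      unfolding set_lebesgue_integral_def using x
      by (intro Bochner_Integration.integral_cong) (auto simp: indicator_def)
    also have "\<dots> = (LINT t|lborel. indicator {0<..<x} t * r t)"
      by (intro integral_borel_representative[OF r0 _ r(3)]) auto
    also have "\<dots> = \<rho> x"
      unfolding \<rho>_def primitive_def
    proof (rule integral_cong_AE)
      show "AE t in lborel. indicator {0<..<x} t * r t = indicator {..x} t * r t"
      proof (rule AE_mp[OF AE_lborel_singleton[of x]], intro AE_I2 impI)
        show "indicator {0<..<x} t * r t = indicator {..x} t * r t" if "t \<noteq> x" for t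
          using r(2)[of t] that by (cases "t \<in> unit_ivl") (auto simp: indicator_def)
      qed
    qed measurable
    finally show ?thesis using p[OF x] p01 by simp
  qed
  have r1: "(LINT x|lborel. r x) = 0"
    using primitive_ge_1[of r 1, OF r(2)] p\<rho>[of 1] p01 by (simp add: \<rho>_def)
  have \<rho>0: "\<rho> x = 0" if "x \<notin> unit_ivl" for x
  proof (cases "x \<le> 0")
    case True
    then show ?thesis unfolding \<rho>_def by (intro primitive_le_0 r(2))
  next
    case False
    then have "\<rho> x = (LINT x|lborel. r x)"
      unfolding \<rho>_def using that by (intro primitive_ge_1 r(2)) auto
    then show ?thesis using r1 by simp
  qed
  define M where "M = (LINT t|lborel. \<bar>r t\<bar>)"
  have \<rho>M: "\<bar>\<rho> x\<bar> \<le> M" for x unfolding \<rho>_def M_def by (rule abs_primitive_le[OF r(1)])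
  have \<rho>c: "continuous_on UNIV \<rho>" unfolding \<rho>_def by (rule continuous_primitive[OF r(1)])
  have \<rho>m [measurable]: "\<rho> \<in> borel_measurable borel" using \<rho>c by (rule borel_measurable_continuous_onI)
  have "(\<lambda>x. indicator unit_ivl x * \<rho> x) = \<rho>" using \<rho>0 by (force simp: indicator_def fun_eq_iff)
  then have \<rho>i: "integrable lborel \<rho>" using integrable_on_unit_ivl[OF \<rho>m \<rho>M] by simp
  have \<rho>2: "integrable lborel (\<lambda>x. (\<rho> x)\<^sup>2)"
    unfolding power2_eq_square by (rule integrable_mult_bounded[OF \<rho>i _ \<rho>M]) simp
  define c where "c = \<phi> 0"
  define \<psi> where "\<psi> x = c + primitive \<rho> x" for x
  have \<psi>\<phi>: "\<psi> x = \<phi> x" if x: "x \<in> {0..1}" for x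
  proof -
    have "(LINT t|lborel. indicator {0..x} t *\<^sub>R \<rho> t) = \<phi> x - \<phi> 0"
    proof (rule integral_FTC_atLeastAtMost)
      fix t assume t: "0 \<le> t" "t \<le> x"
      then have "(\<phi> has_real_derivative \<rho> t) (at t within {0..1})"
        using d[of t] p\<rho>[of t] x by simp
      then have "(\<phi> has_real_derivative \<rho> t) (at t within {0..x})"
        using x by (rule_tac DERIV_subset) auto
      then show "(\<phi> has_vector_derivative \<rho> t) (at t within {0..x})"
        by (simp add: has_real_derivative_iff_has_vector_derivative)
    qed (use x \<rho>c in \<open>auto intro: continuous_on_subset\<close>)
    moreover have "(LINT t|lborel. indicator {0..x} t *\<^sub>R \<rho> t) = primitive \<rho> x"
      unfolding primitive_def
    proof (intro Bochner_Integration.integral_cong refl)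
      show "indicator {0..x} t *\<^sub>R \<rho> t = indicator {..x} t * \<rho> t" for t
        using \<rho>0[of t] by (cases "t \<in> unit_ivl") (auto simp: indicator_def)
    qed
    ultimately show ?thesis by (simp add: \<psi>_def c_def)
  qed
  have \<psi>_pos: "0 < \<psi> x" for x
  proof -
    consider "x < 0" | "x \<in> {0..1}" | "1 < x" by fastforce
    then show ?thesis
    proof cases
      case 1
      then have "primitive \<rho> x = 0" by (intro primitive_le_0 \<rho>0) auto
      then show ?thesis using pos[of 0] by (simp add: \<psi>_def c_def)
    next
      case 2
      then show ?thesis using \<psi>\<phi> pos by simp
    next
      case 3
      have "primitive \<rho> x = (LINT t|lborel. \<rho> t)" using 3 by (intro primitive_ge_1 \<rho>0) auto
      also have "\<dots> = primitive \<rho> 1" by (intro primitive_ge_1[symmetric] \<rho>0) auto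
      finally show ?thesis using \<psi>\<phi>[of 1] pos[of 1] by (simp add: \<psi>_def)
    qed
  qed
  have \<psi>b: "\<bar>\<psi> x\<bar> \<le> \<bar>c\<bar> + (LINT t|lborel. \<bar>\<rho> t\<bar>)" for x
    unfolding \<psi>_def using abs_primitive_le[OF \<rho>i, of x] by linarith
  have \<psi>m [measurable]: "\<psi> \<in> borel_measurable borel"
    unfolding \<psi>_def using measurable_primitive[OF \<rho>i] by measurable
  have r\<psi>: "integrable lborel (\<lambda>x. r x * \<psi> x)"
    by (rule integrable_mult_bounded[OF r(1) _ \<psi>b]) simp
  have "(LINT x|lborel. (\<rho> x)\<^sup>2) = (LINT x|lborel. \<rho> x * (LINT t|lborel. indicator {..x} t * r t))"
    by (simp add: \<rho>_def primitive_def power2_eq_square)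
  also have "\<dots> = (LINT t|lborel. r t * ((LINT x|lborel. \<rho> x) - primitive \<rho> t))"
    by (rule Fubini_triangle[OF lborel.sigma_finite_measure_axioms _ \<rho>i r(1)]) simp
  also have "\<dots> = (LINT t|lborel. (c + (LINT x|lborel. \<rho> x)) * r t - r t * \<psi> t)"
    by (intro Bochner_Integration.integral_cong refl) (simp add: \<psi>_def algebra_simps)
  also have "\<dots> = - (LINT t|lborel. r t * \<psi> t)"
    using r(1) r\<psi> r1 by simp
  also have "(LINT t|lborel. r t * \<psi> t) = (LINT t|lborel. - lam0 * (b t * (\<psi> t)\<^sup>2))"
  proof (rule integral_cong_AE)
    have "AE x in lborel. x \<in> unit_ivl \<longrightarrow> - r0 x = lam0 * a x * \<phi> x"
      using eq by (simp add: AE_completion_iff)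
    then show "AE t in lborel. r t * \<psi> t = - lam0 * (b t * (\<psi> t)\<^sup>2)"
      using r(3) b(3)
    proof eventually_elim
      case (elim t)
      show ?case
      proof (cases "t \<in> unit_ivl")
        case True
        then have "- r t = lam0 * b t * \<psi> t" using elim \<psi>\<phi>[of t] by simp
        then have "r t = - (lam0 * b t * \<psi> t)" by linarith
        then show ?thesis by (simp add: power2_eq_square)
      qed (simp add: r(2) b(2))
    qed
  qed (use b(1) in measurable)
  finally have "(LINT x|lborel. (\<rho> x)\<^sup>2) = lam0 * (LINT x|lborel. b x * (c + primitive \<rho> x)\<^sup>2)"
    by (simp add: \<psi>_def)
  then show thesis using \<rho>i \<rho>0 \<rho>2 \<psi>_pos by (intro that[of \<rho> c]) (auto simp: \<psi>_def)
qed

text \<open>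
  If the right hand side vanished then so would the derivative \<open>\<rho>\<close>. The eigenfunction would be a
  nonzero constant, and the weighted integral a positive multiple of \<open>\<integral> b < 0\<close>.
\<close>

lemma eigenfunction_weight_pos:
  assumes b: "integrable lborel b" "(LINT x|lborel. b x) < 0"
    and \<rho>: "integrable lborel \<rho>" "integrable lborel (\<lambda>x. (\<rho> x)\<^sup>2)" and pos: "\<And>x. 0 < c + primitive \<rho> x"
    and lam0: "lam0 > 0"
    and eq: "(LINT x|lborel. (\<rho> x)\<^sup>2) = lam0 * (LINT x|lborel. b x * (c + primitive \<rho> x)\<^sup>2)"
  shows "0 < (LINT x|lborel. b x * (c + primitive \<rho> x)\<^sup>2)"
proof (rule ccontr)
  assume neg: "\<not> ?thesis"
  have "0 \<le> (LINT x|lborel. (\<rho> x)\<^sup>2)" by simp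
  then have K0: "(LINT x|lborel. b x * (c + primitive \<rho> x)\<^sup>2) = 0" "(LINT x|lborel. (\<rho> x)\<^sup>2) = 0"
    using neg eq lam0 by (auto simp: zero_le_mult_iff not_less)
  then have "AE x in lborel. (\<rho> x)\<^sup>2 = 0"
    using \<rho>(2) by (subst (asm) integral_nonneg_eq_0_iff_AE) auto
  then have ae: "AE x in lborel. \<rho> x = 0" by simp
  have "primitive \<rho> x = 0" for x
    unfolding primitive_def
  proof (rule integral_eq_zero_AE)
    show "AE t in lborel. indicator {..x} t * \<rho> t = 0" using ae by eventually_elim simp
  qed
  then have "c\<^sup>2 * (LINT x|lborel. b x) = 0" "c > 0" using K0 pos[of 0] by (auto simp: mult.commute)
  then show False using b(2) by simp
qed

text \<open>
  The primitive inherits \<open>F(s) = s\<^sup>2/2 + o(s\<^sup>2)\<close> by comparing derivatives.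
\<close>

lemma primitive_quadratic_at_0:
  assumes F: "\<And>s. (F has_real_derivative f s) (at s)" and F0: "F 0 = (0::real)"
    and f: "((\<lambda>s. f s / s) \<longlongrightarrow> 1) (at_right 0)" and f0: "f 0 = 0" and \<eta>: "\<eta> > 0"
  obtains d where "d > 0" "\<And>s. 0 \<le> s \<Longrightarrow> s \<le> d \<Longrightarrow> \<bar>F s - s\<^sup>2 / 2\<bar> \<le> \<eta> * s\<^sup>2 / 2"
proof -
  have "\<forall>\<^sub>F s in at_right 0. \<bar>f s / s - 1\<bar> < \<eta>"
    using tendstoD[OF f \<eta>] by (simp add: dist_real_def)
  then obtain d where d: "d > 0" "\<And>s. 0 < s \<Longrightarrow> s < d \<Longrightarrow> \<bar>f s / s - 1\<bar> < \<eta>"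
    by (auto simp: eventually_at_right_field)
  have fs: "\<bar>f s - s\<bar> \<le> \<eta> * s" if "0 \<le> s" "s < d" for s
  proof (cases "s = 0")
    case False
    then have "s > 0" using that by simp
    have "\<bar>f s - s\<bar> = \<bar>f s / s - 1\<bar> * s"
      using \<open>s > 0\<close> by (simp add: abs_mult_pos[symmetric] field_simps)
    also have "\<dots> \<le> \<eta> * s" using d(2)[of s] \<open>s > 0\<close> that by (intro mult_right_mono) auto
    finally show ?thesis .
  qed (simp add: f0)
  have "\<bar>F s - s\<^sup>2 / 2\<bar> \<le> \<eta> * s\<^sup>2 / 2" if s: "0 \<le> s" "s \<le> d / 2" for s
  proof -
    have "(\<lambda>t. \<eta> * t\<^sup>2 / 2 - (F t - t\<^sup>2 / 2)) 0 \<le> (\<lambda>t. \<eta> * t\<^sup>2 / 2 - (F t - t\<^sup>2 / 2)) s"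
    proof (rule DERIV_nonneg_imp_nondecreasing[OF s(1)])
      fix t assume t: "0 \<le> t" "t \<le> s"
      have "((\<lambda>t. \<eta> * t\<^sup>2 / 2 - (F t - t\<^sup>2 / 2)) has_real_derivative \<eta> * t - (f t - t)) (at t)"
        by (auto intro!: derivative_eq_intros F)
      moreover have "0 \<le> \<eta> * t - (f t - t)" using fs[of t] t s d by (auto simp: abs_le_iff)
      ultimately show "\<exists>y. ((\<lambda>t. \<eta> * t\<^sup>2 / 2 - (F t - t\<^sup>2 / 2)) has_real_derivative y) (at t) \<and> 0 \<le> y" by blast
    qed
    moreover have "(\<lambda>t. \<eta> * t\<^sup>2 / 2 + (F t - t\<^sup>2 / 2)) 0 \<le> (\<lambda>t. \<eta> * t\<^sup>2 / 2 + (F t - t\<^sup>2 / 2)) s"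
    proof (rule DERIV_nonneg_imp_nondecreasing[OF s(1)])
      fix t assume t: "0 \<le> t" "t \<le> s"
      have "((\<lambda>t. \<eta> * t\<^sup>2 / 2 + (F t - t\<^sup>2 / 2)) has_real_derivative \<eta> * t + (f t - t)) (at t)"
        by (auto intro!: derivative_eq_intros F)
      moreover have "0 \<le> \<eta> * t + (f t - t)" using fs[of t] t s d by (auto simp: abs_le_iff)
      ultimately show "\<exists>y. ((\<lambda>t. \<eta> * t\<^sup>2 / 2 + (F t - t\<^sup>2 / 2)) has_real_derivative y) (at t) \<and> 0 \<le> y" by blast
    qed
    ultimately have "F s - s\<^sup>2 / 2 \<le> \<eta> * s\<^sup>2 / 2" "- (F s - s\<^sup>2 / 2) \<le> \<eta> * s\<^sup>2 / 2"
      using F0 by simp_all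
    then show ?thesis by (simp only: abs_le_iff)
  qed
  then show thesis using d(1) by (intro that[of "d / 2"]) auto
qed

lemma tendsto_floor_div:
  "(\<lambda>m. real_of_int \<lfloor>real (k m) * x\<rfloor> / real (k m)) \<longlonglongrightarrow> x" if k: "filterlim k at_top sequentially"
proof -
  have "(\<lambda>n. real_of_int \<lfloor>real n * x\<rfloor> / real n) \<longlonglongrightarrow> x"
  proof (rule tendsto_sandwich)
    show "(\<lambda>n. x - 1 / real n) \<longlonglongrightarrow> x"
      using tendsto_diff[OF tendsto_const lim_inverse_n', of x] by simp
    show "\<forall>\<^sub>F n in sequentially. x - 1 / real n \<le> real_of_int \<lfloor>real n * x\<rfloor> / real n"
      using eventually_gt_at_top[of 0]
    proof eventually_elim
      case (elim n)
      have "real n * x - 1 \<le> real_of_int \<lfloor>real n * x\<rfloor>" by linarith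
      then have "(real n * x - 1) / real n \<le> real_of_int \<lfloor>real n * x\<rfloor> / real n"
        by (intro divide_right_mono) auto
      then show ?case using elim by (simp add: diff_divide_distrib)
    qed
    show "\<forall>\<^sub>F n in sequentially. real_of_int \<lfloor>real n * x\<rfloor> / real n \<le> x"
      using eventually_gt_at_top[of 0]
    proof eventually_elim
      case (elim n)
      have "real_of_int \<lfloor>real n * x\<rfloor> \<le> real n * x" by linarith
      then show ?case using elim by (simp add: field_simps)
    qed
  qed simp
  from filterlim_compose[OF this k] show ?thesis .
qed

lemma tendsto_sampled_integral:
  assumes a: "integrable lborel a" and g: "continuous_on UNIV (g :: real \<Rightarrow> real)" "\<And>x. \<bar>g x\<bar> \<le> C"
  shows "(\<lambda>n. LINT x|lborel. a x * g (real_of_int \<lfloor>real n * x\<rfloor> / real n)) \<longlonglongrightarrow> (LINT x|lborel. a x * g x)"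
proof (rule integral_dominated_convergence)
  have gm [measurable]: "g \<in> borel_measurable borel" using g(1) by (rule borel_measurable_continuous_onI)
  have am [measurable]: "a \<in> borel_measurable borel" using a by auto
  show "(\<lambda>x. a x * g x) \<in> borel_measurable lborel" by measurable
  show "(\<lambda>x. a x * g (real_of_int \<lfloor>real n * x\<rfloor> / real n)) \<in> borel_measurable lborel" for n by measurable
  show "integrable lborel (\<lambda>x. \<bar>a x\<bar> * C)" using a by simp
  show "AE x in lborel. norm (a x * g (real_of_int \<lfloor>real n * x\<rfloor> / real n)) \<le> \<bar>a x\<bar> * C" for n
    using g(2) by (intro AE_I2) (auto simp: abs_mult intro!: mult_left_mono)
  show "AE x in lborel. (\<lambda>n. a x * g (real_of_int \<lfloor>real n * x\<rfloor> / real n)) \<longlonglongrightarrow> a x * g x"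
  proof (intro AE_I2 tendsto_mult tendsto_const)
    fix x :: real
    have "(\<lambda>n. real_of_int \<lfloor>real n * x\<rfloor> / real n) \<longlonglongrightarrow> x"
      by (rule tendsto_floor_div[OF filterlim_ident])
    then show "(\<lambda>n. g (real_of_int \<lfloor>real n * x\<rfloor> / real n)) \<longlonglongrightarrow> g x"
      using g(1) by (intro isCont_tendsto_compose[of x g]) (auto simp: continuous_on_eq_continuous_at)
  qed
qed

text \<open>
  For a small multiple \<open>\<epsilon> \<psi>\<close> of the eigenfunction the energy is
  \<open>\<epsilon>\<^sup>2/2 (lam0 - lam) \<integral> b \<psi>\<^sup>2\<close> up to smaller terms. The accuracy \<open>\<eta>\<close> of the quadratic approximation
  of \<open>F\<close> is chosen so that these terms use up at most half of that, and passing from \<open>\<psi>\<close> to its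
  samples uses up at most another quarter.
\<close>

theorem discrete_energy_eventually_negative:
  assumes b: "integrable lborel b" "\<And>x. x \<notin> unit_ivl \<Longrightarrow> b x = 0" "(LINT x|lborel. b x) < 0"
    and \<rho>: "integrable lborel \<rho>" "\<And>x. x \<notin> unit_ivl \<Longrightarrow> \<rho> x = 0" "integrable lborel (\<lambda>x. (\<rho> x)\<^sup>2)"
    and pos: "\<And>x. 0 < c + primitive \<rho> x"
    and eq: "(LINT x|lborel. (\<rho> x)\<^sup>2) = lam0 * (LINT x|lborel. b x * (c + primitive \<rho> x)\<^sup>2)"
    and lam: "0 < lam0" "lam0 < lam"
    and F: "\<And>s. (F has_real_derivative f s) (at s)" "F 0 = 0"
    and f: "((\<lambda>s. f s / s) \<longlongrightarrow> 1) (at_right 0)" "f 0 = 0"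
  shows "\<exists>\<delta>>0. \<forall>\<^sub>F n in sequentially. \<exists>w. discrete_energy n (\<lambda>i. lam * cell_integral b n i) F w \<le> - \<delta>"
proof -
  define \<psi> where "\<psi> x = c + primitive \<rho> x" for x
  define K where "K = (LINT x|lborel. b x * (\<psi> x)\<^sup>2)"
  define D where "D = (LINT x|lborel. \<bar>b x\<bar> * (\<psi> x)\<^sup>2)"
  have K: "K > 0" unfolding K_def \<psi>_def
    by (rule eigenfunction_weight_pos[OF b(1,3) \<rho>(1,3) pos lam(1) eq])
  have D: "D \<ge> 0" unfolding D_def by simp
  have lamp: "lam > 0" using lam by simp
  \<comment> \<open>The summand \<open>1\<close> only serves to make \<open>M\<close> positive.\<close>
  define M where "M = \<bar>c\<bar> + (LINT t|lborel. \<bar>\<rho> t\<bar>) + 1"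
  have \<psi>M: "\<bar>\<psi> x\<bar> \<le> M" for x
    using abs_primitive_le[OF \<rho>(1), of x] by (simp add: \<psi>_def M_def)
  have M: "M > 0" by (simp add: M_def add_nonneg_pos)
  have \<psi>c: "continuous_on UNIV \<psi>"
    unfolding \<psi>_def by (intro continuous_intros continuous_primitive \<rho>(1))
  have \<psi>m [measurable]: "\<psi> \<in> borel_measurable borel" using \<psi>c by (rule borel_measurable_continuous_onI)
  have bm [measurable]: "b \<in> borel_measurable borel" using b(1) by auto
  define \<eta> where "\<eta> = (lam - lam0) * K / (2 * lam * (D + 1))"
  have \<eta>: "\<eta> > 0" using lam K D lamp by (simp add: \<eta>_def)
  have \<eta>D: "lam * \<eta> * D \<le> (lam - lam0) * K / 2"
  proof -
    have "lam * (X / (2 * lam * (D + 1))) = X / (2 * (D + 1))" for X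
      using lamp by simp
    then have "lam * \<eta> * D = (lam - lam0) * K / 2 * (D / (D + 1))"
      by (simp add: \<eta>_def)
    also have "\<dots> \<le> (lam - lam0) * K / 2 * 1" using lam K D by (intro mult_left_mono) auto
    finally show ?thesis by simp
  qed
  obtain d where d: "d > 0" "\<And>s. 0 \<le> s \<Longrightarrow> s \<le> d \<Longrightarrow> \<bar>F s - s\<^sup>2 / 2\<bar> \<le> \<eta> * s\<^sup>2 / 2"
    using primitive_quadratic_at_0[OF F f \<eta>] by blast
  define \<epsilon> where "\<epsilon> = d / M"
  have \<epsilon>: "\<epsilon> > 0" using d M by (simp add: \<epsilon>_def)
  have \<epsilon>\<psi>: "0 \<le> \<epsilon> * \<psi> x" "\<epsilon> * \<psi> x \<le> d" for x
  proof -
    show "0 \<le> \<epsilon> * \<psi> x" using \<epsilon> pos[of x] by (simp add: \<psi>_def)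
    have "\<epsilon> * \<psi> x \<le> \<epsilon> * M" using \<epsilon> \<psi>M[of x] by (intro mult_left_mono) auto
    then show "\<epsilon> * \<psi> x \<le> d" using M by (simp add: \<epsilon>_def)
  qed
  have Fq: "\<bar>F (\<epsilon> * \<psi> x) - (\<epsilon> * \<psi> x)\<^sup>2 / 2\<bar> \<le> \<eta> * (\<epsilon> * \<psi> x)\<^sup>2 / 2" for x
    using d(2)[OF \<epsilon>\<psi>] .
  have Fc: "continuous_on UNIV F" using F(1) by (intro DERIV_continuous_on) (auto intro: has_field_derivative_at_within)
  define g where "g x = F (\<epsilon> * \<psi> x)" for x
  have gc: "continuous_on UNIV g"
    unfolding g_def by (intro continuous_on_compose2[OF Fc] continuous_intros \<psi>c) auto
  have gm [measurable]: "g \<in> borel_measurable borel" using gc by (rule borel_measurable_continuous_onI)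
  have gb: "\<bar>g x\<bar> \<le> (1 + \<eta>) * d\<^sup>2 / 2" for x
  proof -
    have "(\<epsilon> * \<psi> x)\<^sup>2 \<le> d\<^sup>2" using \<epsilon>\<psi>[of x] by (intro power_mono) auto
    have "(1 + \<eta>) * (\<epsilon> * \<psi> x)\<^sup>2 / 2 = (\<epsilon> * \<psi> x)\<^sup>2 / 2 + \<eta> * (\<epsilon> * \<psi> x)\<^sup>2 / 2"
      by (simp add: distrib_right add_divide_distrib)
    moreover have "0 \<le> (\<epsilon> * \<psi> x)\<^sup>2 / 2" by simp
    ultimately have "\<bar>g x\<bar> \<le> (1 + \<eta>) * (\<epsilon> * \<psi> x)\<^sup>2 / 2"
      using Fq[of x] unfolding g_def by linarith
    also have "\<dots> \<le> (1 + \<eta>) * d\<^sup>2 / 2"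
      using \<open>(\<epsilon> * \<psi> x)\<^sup>2 \<le> d\<^sup>2\<close> \<eta> by (intro divide_right_mono mult_left_mono) auto
    finally show ?thesis .
  qed
  have \<psi>2b: "\<bar>(\<psi> x)\<^sup>2\<bar> \<le> M\<^sup>2" for x
    using \<psi>M[of x] M by (simp add: abs_le_square_iff[symmetric])
  have "(\<lambda>x. (\<psi> x)\<^sup>2) \<in> borel_measurable lborel" "g \<in> borel_measurable lborel" by measurable
  note m = this
  have ib: "integrable lborel (\<lambda>x. b x * (\<psi> x)\<^sup>2)" "integrable lborel (\<lambda>x. \<bar>b x\<bar> * (\<psi> x)\<^sup>2)"
    "integrable lborel (\<lambda>x. b x * g x)"
    by (rule integrable_mult_bounded[OF b(1) m(1) \<psi>2b]
       integrable_mult_bounded[OF integrable_abs[OF b(1)] m(1) \<psi>2b]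
       integrable_mult_bounded[OF b(1) m(2) gb])+
  have "\<epsilon>\<^sup>2 / 2 * K - (LINT x|lborel. b x * g x) = (LINT x|lborel. \<epsilon>\<^sup>2 / 2 * (b x * (\<psi> x)\<^sup>2) - b x * g x)"
    using ib by (simp add: K_def)
  also have "\<dots> \<le> (LINT x|lborel. \<eta> * \<epsilon>\<^sup>2 / 2 * (\<bar>b x\<bar> * (\<psi> x)\<^sup>2))"
  proof (rule integral_mono)
    fix x
    have "\<epsilon>\<^sup>2 / 2 * (b x * (\<psi> x)\<^sup>2) - b x * g x = - (b x * (g x - (\<epsilon> * \<psi> x)\<^sup>2 / 2))"
      by (simp add: algebra_simps power_mult_distrib)
    also have "\<dots> \<le> \<bar>b x\<bar> * \<bar>g x - (\<epsilon> * \<psi> x)\<^sup>2 / 2\<bar>"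
      by (metis abs_ge_self abs_minus_cancel abs_mult)
    also have "\<dots> \<le> \<bar>b x\<bar> * (\<eta> * (\<epsilon> * \<psi> x)\<^sup>2 / 2)"
      using Fq[of x] by (intro mult_left_mono) (auto simp: g_def)
    finally show "\<epsilon>\<^sup>2 / 2 * (b x * (\<psi> x)\<^sup>2) - b x * g x \<le> \<eta> * \<epsilon>\<^sup>2 / 2 * (\<bar>b x\<bar> * (\<psi> x)\<^sup>2)"
      by (simp add: algebra_simps power_mult_distrib)
  qed (use ib in auto)
  also have "\<dots> = \<eta> * \<epsilon>\<^sup>2 / 2 * D" by (simp add: D_def)
  finally have low: "\<epsilon>\<^sup>2 / 2 * K - \<eta> * \<epsilon>\<^sup>2 / 2 * D \<le> (LINT x|lborel. b x * g x)" by simp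
  define G where "G = (LINT x|lborel. b x * g x)"
  define \<delta> where "\<delta> = \<epsilon>\<^sup>2 / 8 * ((lam - lam0) * K)"
  have \<delta>: "\<delta> > 0" using \<epsilon> lam K by (simp add: \<delta>_def)
  have lim_neg: "\<epsilon>\<^sup>2 / 2 * (lam0 * K) - lam * G \<le> - 2 * \<delta>"
  proof -
    have "lam * (\<epsilon>\<^sup>2 / 2 * K - \<eta> * \<epsilon>\<^sup>2 / 2 * D) \<le> lam * G"
      using low lamp unfolding G_def by (intro mult_left_mono) auto
    then have "\<epsilon>\<^sup>2 / 2 * (lam0 * K) - lam * G \<le> \<epsilon>\<^sup>2 / 2 * (lam0 * K - lam * K + lam * \<eta> * D)"
      by (simp add: algebra_simps)
    also have "\<dots> \<le> \<epsilon>\<^sup>2 / 2 * (lam0 * K - lam * K + (lam - lam0) * K / 2)"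
      using \<eta>D by (intro mult_left_mono add_left_mono) auto
    also have "\<dots> = - 2 * \<delta>" by (simp add: \<delta>_def field_simps)
    finally show ?thesis .
  qed
  have "(\<lambda>n. LINT x|lborel. b x * g (real_of_int \<lfloor>real n * x\<rfloor> / real n)) \<longlonglongrightarrow> G"
    unfolding G_def by (rule tendsto_sampled_integral[OF b(1) gc gb])
  then have "(\<lambda>n. \<epsilon>\<^sup>2 / 2 * (lam0 * K) - lam * (LINT x|lborel. b x * g (real_of_int \<lfloor>real n * x\<rfloor> / real n)))
     \<longlonglongrightarrow> \<epsilon>\<^sup>2 / 2 * (lam0 * K) - lam * G"
    by (intro tendsto_intros)
  then have "\<forall>\<^sub>F n in sequentially. \<epsilon>\<^sup>2 / 2 * (lam0 * K) - lam * (LINT x|lborel. b x * g (real_of_int \<lfloor>real n * x\<rfloor> / real n)) < - \<delta>"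
    by (rule order_tendstoD) (use lim_neg \<delta> in auto)
  then have "\<forall>\<^sub>F n in sequentially. \<exists>w. discrete_energy n (\<lambda>i. lam * cell_integral b n i) F w \<le> - \<delta>"
    using eventually_gt_at_top[of 0]
  proof eventually_elim
    case (elim n)
    have "discrete_energy n (\<lambda>i. lam * cell_integral b n i) F (\<lambda>i. \<epsilon> * (c + primitive \<rho> (real i / real n)))
      \<le> \<epsilon>\<^sup>2 / 2 * (lam0 * K) - lam * (LINT x|lborel. b x * g (real_of_int \<lfloor>real n * x\<rfloor> / real n))"
      using discrete_energy_sampled_le[OF b(1,2) elim(2) \<rho>, of lam F \<epsilon> c]
      by (simp add: eq g_def \<psi>_def K_def)
    then show ?case using elim(1) by (intro exI) (rule order_trans, assumption, simp)
  qed
  then show ?thesis using \<delta> by blast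
qed

section \<open>Slopes and fluxes of the discrete solutions\<close>

lemma curvature_flux_less_iff: "curvature_flux s < curvature_flux t \<longleftrightarrow> s < t"
proof -
  have "((\<lambda>s. s / sqrt (1 + s\<^sup>2)) has_real_derivative 1 / ((1 + s\<^sup>2) * sqrt (1 + s\<^sup>2))) (at s)" for s :: real
  proof -
    have p: "0 < sqrt (1 + s\<^sup>2)" using one_plus_square_pos[of s] by simp
    have "((\<lambda>s. s / sqrt (1 + s\<^sup>2)) has_real_derivative
       (1 * sqrt (1 + s\<^sup>2) - s * curvature_flux s) / (sqrt (1 + s\<^sup>2) * sqrt (1 + s\<^sup>2))) (at s)"
      using p by (intro DERIV_divide DERIV_ident DERIV_sqrt_one_plus_square) auto
    moreover have "(1 * sqrt (1 + s\<^sup>2) - s * curvature_flux s) = 1 / sqrt (1 + s\<^sup>2)"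
      using p one_plus_square_pos[of s]
      by (simp add: curvature_flux_def field_simps power2_eq_square[symmetric])
    ultimately show ?thesis using one_plus_square_pos[of s] by (simp add: mult.commute)
  qed
  then have "curvature_flux s < curvature_flux t" if "s < t" for s t
    unfolding curvature_flux_def
    using that one_plus_square_pos
    by (intro DERIV_pos_imp_increasing[OF that]) (metis divide_pos_pos mult_pos_pos real_sqrt_gt_0_iff zero_less_one)
  then show ?thesis by (metis less_asym linorder_neqE)
qed

lemma curvature_flux_minus: "curvature_flux (- s) = - curvature_flux s"
  by (simp add: curvature_flux_def)

lemma abs_curvature_flux_less: "\<bar>curvature_flux s\<bar> < 1"
proof -
  have "\<bar>s\<bar> < sqrt (1 + s\<^sup>2)" by (rule real_less_rsqrt) simp
  moreover have "0 < sqrt (1 + s\<^sup>2)" using one_plus_square_pos[of s] by simp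
  ultimately show ?thesis by (simp add: curvature_flux_def divide_less_eq)
qed

text \<open>
  Every slope is admissible in the limit, so the condition \<open>p > - 1\<close> is exhausted by the conditions
  that the flux exceeds that of slope \<open>- k\<close>.
\<close>

lemma curvature_flux_near_minus_one:
  assumes "- 1 < y" obtains k :: nat where "curvature_flux (- real k) < y"
proof -
  obtain k :: nat where k: "1 / (y + 1) < real k" using reals_Archimedean2 by blast
  have y: "y + 1 > 0" using assms by simp
  have k0: "real k > 0" using k y by (meson divide_pos_pos less_trans zero_less_one)
  have "sqrt (1 + (real k)\<^sup>2) \<le> real k + 1"
    by (rule real_le_lsqrt) (auto simp: power2_eq_square algebra_simps)
  then have "real k / (real k + 1) \<le> real k / sqrt (1 + (real k)\<^sup>2)"
    using k0 one_plus_square_pos[of "real k"] by (intro divide_left_mono) auto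
  then have "curvature_flux (- real k) \<le> - (real k / (real k + 1))"
    by (simp add: curvature_flux_def)
  also have "\<dots> = 1 / (real k + 1) - 1" using k0 by (simp add: field_simps)
  also have "\<dots> < y"
  proof -
    have "1 < real k * (y + 1)" using k y by (simp add: pos_divide_less_eq)
    also have "\<dots> \<le> (real k + 1) * (y + 1)" using y by (intro mult_right_mono) auto
    finally have "1 / (real k + 1) < y + 1" using k0 by (simp add: pos_divide_less_eq mult.commute)
    then show ?thesis by simp
  qed
  finally show thesis by (rule that)
qed

lemma continuous_curvature_flux: "continuous_on UNIV curvature_flux"
  unfolding curvature_flux_def[abs_def]
  using one_plus_square_pos by (intro continuous_intros) (metis less_irrefl real_sqrt_eq_zero_cancel_iff UNIV_I)

lemma rational_slope_between:
  assumes "curvature_flux s < y"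
  obtains q :: rat where "s < of_rat q" "curvature_flux (of_rat q) < y"
proof -
  have "isCont curvature_flux s" using continuous_curvature_flux by (simp add: continuous_on_eq_continuous_at)
  then have "\<forall>\<^sub>F t in at s. curvature_flux t < y" unfolding isCont_def by (rule order_tendstoD) (rule assms)
  then obtain d where d: "d > 0" "\<And>t. t \<noteq> s \<Longrightarrow> dist t s < d \<Longrightarrow> curvature_flux t < y"
    by (auto simp: eventually_at)
  obtain q where q: "s < of_rat q" "of_rat q < s + d" using of_rat_dense[of s "s + d"] d(1) by auto
  have "curvature_flux (of_rat q) < y" using q by (intro d(2)) (auto simp: dist_real_def)
  then show thesis using q(1) by (rule that[rotated])
qed

text \<open>
  The discrete problem in the form used for the limit: one bound \<open>R\<close> serves all \<open>n\<close>, and the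
  Euler-Lagrange equations are stated for the primitive of the right hand side. The case
  \<open>Suc k = n\<close> says that the flux vanishes at \<open>1\<close>.
\<close>

lemma discrete_solutions_exist:
  assumes b: "integrable lborel b" "\<And>x. x \<notin> unit_ivl \<Longrightarrow> b x = 0" "(LINT x|lborel. b x) < 0"
    and lam: "lam > 0"
    and F: "\<And>s. (F has_real_derivative f s) (at s)" "\<And>s. s \<le> 0 \<Longrightarrow> F s = 0"
    and f: "\<And>s. 0 \<le> f s" "(f \<longlongrightarrow> 0) at_top" and F_lim: "filterlim F at_top at_top"
  shows "\<exists>R\<ge>0. \<forall>n>0. \<exists>u. (\<forall>i. 0 \<le> u i) \<and> (\<forall>i<n. u i \<le> R) \<and>
     (\<Sum>i<n - 1. \<bar>u (Suc i) - u i\<bar>) \<le> R \<and>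
     (\<forall>v. discrete_energy n (\<lambda>i. lam * cell_integral b n i) F u
        \<le> discrete_energy n (\<lambda>i. lam * cell_integral b n i) F v) \<and>
     (\<forall>k<n. primitive (\<lambda>x. - lam * (b x * f (step_function n u x))) (real (Suc k) / real n) =
        (if Suc k < n then curvature_flux (real n * (u (Suc k) - u k)) else 0))"
proof -
  define A where "A = - lam * (LINT x|lborel. b x)"
  define B where "B = lam * (LINT x|lborel. \<bar>b x\<bar>)"
  have A: "A > 0" using lam b(3) by (simp add: A_def mult_pos_neg)
  have B: "B \<ge> 0" using lam by (simp add: B_def)
  let ?c = "\<lambda>n i. lam * cell_integral b n i"
  have F0: "F 0 = 0" using F(2) by simp
  obtain R where R: "R \<ge> 0" "\<And>n c u. n > 0 \<Longrightarrow> (\<Sum>i<n. c i) = - A \<Longrightarrow> (\<Sum>i<n. \<bar>c i\<bar>) \<le> B \<Longrightarrow>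
     (\<forall>i<n. 0 \<le> u i) \<Longrightarrow> discrete_energy n c F u \<le> 0 \<Longrightarrow>
     (\<Sum>i<n - 1. \<bar>u (Suc i) - u i\<bar>) \<le> R \<and> (\<forall>i<n. u i \<le> R)"
    using discrete_energy_coercive[OF F(1) F0 f F_lim A B] by blast
  have Fc: "continuous_on UNIV F" using F(1) by (intro DERIV_continuous_on) (auto intro: has_field_derivative_at_within)
  show ?thesis
  proof (intro exI[of _ R] conjI allI impI R(1))
    fix n :: nat assume n: "n > 0"
    have cA: "(\<Sum>i<n. ?c n i) = - A"
      using sum_cell_integral_total[OF b(1,2) n, where G="\<lambda>_. 1"]
      by (simp add: A_def sum_distrib_left[symmetric])
    have cB: "(\<Sum>i<n. \<bar>?c n i\<bar>) \<le> B"
    proof -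
      have "(\<Sum>i<n. \<bar>?c n i\<bar>) = lam * (\<Sum>i<n. \<bar>cell_integral b n i\<bar>)"
        using lam by (simp add: abs_mult sum_distrib_left)
      then show ?thesis unfolding B_def
        using sum_abs_cell_integral_le[OF b(1,2) n] lam by (simp add: mult_left_mono)
    qed
    have bd: "(\<Sum>i<n - 1. \<bar>u (Suc i) - u i\<bar>) \<le> R \<and> (\<forall>i<n. u i \<le> R)"
      if "\<forall>i<n. 0 \<le> u i" "discrete_energy n (?c n) F u \<le> 0" for u
      using R(2)[OF n cA cB] that by blast
    obtain u where u: "\<forall>i. 0 \<le> u i" "\<forall>v. discrete_energy n (?c n) F u \<le> discrete_energy n (?c n) F v"
      using discrete_energy_minimiser_exists[OF n Fc F(2) R(1), of "?c n"] bd by blast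
    have "discrete_energy n (?c n) F u \<le> discrete_energy n (?c n) F (\<lambda>_. 0)" using u(2) by blast
    also have "\<dots> = 0" using F0 by (simp add: discrete_energy_def)
    finally have J0: "discrete_energy n (?c n) F u \<le> 0" .
    have EL: "primitive (\<lambda>x. - lam * (b x * f (step_function n u x))) (real (Suc k) / real n) =
        (if Suc k < n then curvature_flux (real n * (u (Suc k) - u k)) else 0)" if k: "k < n" for k
    proof -
      have "primitive (\<lambda>x. - lam * (b x * f (step_function n u x))) (real (Suc k) / real n)
        = - lam * primitive (\<lambda>x. b x * f (step_function n u x)) (real (Suc k) / real n)"
        unfolding primitive_def by (simp add: mult.left_commute flip: integral_mult_right_zero)
      also have "\<dots> = - (\<Sum>i\<le>k. ?c n i * f (u i))"
        using sum_cell_integral[OF b(1,2) n, where k=k and G=f and u=u]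
        by (simp add: sum_distrib_left[symmetric] mult.assoc)
      also have "\<dots> = (if Suc k < n then curvature_flux (real n * (u (Suc k) - u k)) else 0)"
        using discrete_energy_Euler_Lagrange[OF n k F(1), of "?c n" u] u(2) by simp
      finally show ?thesis .
    qed
    show "\<exists>u. (\<forall>i. 0 \<le> u i) \<and> (\<forall>i<n. u i \<le> R) \<and> (\<Sum>i<n - 1. \<bar>u (Suc i) - u i\<bar>) \<le> R \<and>
     (\<forall>v. discrete_energy n (?c n) F u \<le> discrete_energy n (?c n) F v) \<and>
     (\<forall>k<n. primitive (\<lambda>x. - lam * (b x * f (step_function n u x))) (real (Suc k) / real n) =
        (if Suc k < n then curvature_flux (real n * (u (Suc k) - u k)) else 0))"
      using u EL bd[OF _ J0] by (intro exI[of _ u]) auto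
  qed
qed

text \<open>
  The factor \<open>if \<dots> \<le> x\<close> makes the function continuous from the right, as Helly's theorem requires.
\<close>

definition jump_function :: "nat \<Rightarrow> (nat \<Rightarrow> real) \<Rightarrow> real \<Rightarrow> real" where
  "jump_function n d x = (\<Sum>i<n - 1. d i * (if real (Suc i) / real n \<le> x then 1 else 0))"

lemma mono_jump_function: "(\<And>i. 0 \<le> d i) \<Longrightarrow> mono (jump_function n d)"
  unfolding jump_function_def by (intro monoI sum_mono mult_left_mono) auto

lemma right_continuous_jump_function: "continuous (at_right x) (jump_function n d)"
proof -
  have "continuous (at_right x) (\<lambda>x. if c \<le> x then 1 else 0 :: real)" for c
  proof -
    have "\<forall>\<^sub>F y in at_right x. (if c \<le> y then 1 else 0 :: real) = (if c \<le> x then 1 else 0)"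
    proof (cases "c \<le> x")
      case True
      then show ?thesis by (auto simp: eventually_at_right_field intro!: exI[of _ "x + 1"])
    next
      case False
      then show ?thesis by (auto simp: eventually_at_right_field intro!: exI[of _ c])
    qed
    then show ?thesis unfolding continuous_within by (rule tendsto_eventually)
  qed
  then show ?thesis unfolding jump_function_def by (intro continuous_intros)
qed

lemma abs_jump_function_le:
  assumes "\<And>i. 0 \<le> d i" shows "\<bar>jump_function n d x\<bar> \<le> (\<Sum>i<n - 1. d i)"
proof -
  have "0 \<le> jump_function n d x" unfolding jump_function_def using assms by (intro sum_nonneg) auto
  moreover have "jump_function n d x \<le> (\<Sum>i<n - 1. d i)"
    unfolding jump_function_def using assms by (intro sum_mono) auto
  ultimately show ?thesis by simp
qed

lemma nat_floor_less: "n > 0 \<Longrightarrow> x < 1 \<Longrightarrow> nat \<lfloor>real n * x\<rfloor> < n"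
proof -
  assume n: "n > 0" and x: "x < 1"
  have "real n * x < real n * 1" using n x by (intro mult_strict_left_mono) auto
  then have "\<lfloor>real n * x\<rfloor> < int n" by (simp add: floor_less_iff)
  then show ?thesis using n by linarith
qed

text \<open>
  The Jordan decomposition of a step function into its upward and its downward jumps.
\<close>

lemma step_function_eq_jump_functions:
  assumes n: "n > 0" and x: "0 \<le> x" "x < 1"
  shows "step_function n u x = u 0 + jump_function n (\<lambda>i. max 0 (u (Suc i) - u i)) x
     - jump_function n (\<lambda>i. max 0 (u i - u (Suc i))) x"
proof -
  define j where "j = nat \<lfloor>real n * x\<rfloor>"
  have j: "j < n" unfolding j_def using n x(2) by (rule nat_floor_less)
  have node: "real (Suc i) / real n \<le> x \<longleftrightarrow> i < j" for i
    using less_node_iff[OF n x(1), of i] by (auto simp: j_def not_le)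
  have "jump_function n (\<lambda>i. max 0 (u (Suc i) - u i)) x - jump_function n (\<lambda>i. max 0 (u i - u (Suc i))) x
     = (\<Sum>i<n - 1. if i < j then u (Suc i) - u i else 0)"
    unfolding jump_function_def node sum_subtractf[symmetric]
    by (intro sum.cong) (auto simp: max_def)
  also have "\<dots> = (\<Sum>i\<in>{..<n - 1} \<inter> {i. i < j}. u (Suc i) - u i)"
    by (simp add: sum.inter_restrict)
  also have "{..<n - 1} \<inter> {i. i < j} = {..<j}" using j by auto
  also have "(\<Sum>i<j. u (Suc i) - u i) = u j - u 0" by (rule sum_lessThan_telescope)
  finally show ?thesis by (simp add: step_function_def j_def)
qed

text \<open>
  Every jump between \<open>x\<close> and \<open>y\<close> happens at a node where the flux exceeds that of the slope \<open>\<xi>\<close>, so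
  \<open>\<sigma>\<close> times each jump is larger than \<open>\<xi>/n\<close>. The sign \<open>\<sigma>\<close> treats lower and upper bounds for the slope at the same
  time, the flux being an odd function of the slope.
\<close>

lemma step_function_increment:
  assumes n: "n > 0" and xy: "0 \<le> x" "x \<le> y" "y < 1" and \<sigma>: "\<sigma> = 1 \<or> \<sigma> = - 1"
    and EL: "\<And>k. Suc k < n \<Longrightarrow> p (real (Suc k) / real n) = curvature_flux (real n * (u (Suc k) - u k))"
    and p: "\<And>t. x \<le> t \<Longrightarrow> t \<le> y \<Longrightarrow> curvature_flux \<xi> < \<sigma> * p t"
  shows "\<xi> * (real_of_int \<lfloor>real n * y\<rfloor> / real n - real_of_int \<lfloor>real n * x\<rfloor> / real n)
     \<le> \<sigma> * (step_function n u y - step_function n u x)"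
proof -
  define i where "i = nat \<lfloor>real n * x\<rfloor>"
  define j where "j = nat \<lfloor>real n * y\<rfloor>"
  have ri: "real i = real_of_int \<lfloor>real n * x\<rfloor>" and rj: "real j = real_of_int \<lfloor>real n * y\<rfloor>"
    using xy by (simp_all add: i_def j_def)
  have "\<lfloor>real n * x\<rfloor> \<le> \<lfloor>real n * y\<rfloor>" using xy by (intro floor_mono mult_left_mono) auto
  then have ij: "i \<le> j" unfolding i_def j_def by (rule nat_mono)
  have jn: "j < n" unfolding j_def using n xy(3) by (rule nat_floor_less)
  have "\<xi> / real n \<le> \<sigma> * (u (Suc l) - u l)" if l: "l \<in> {i..<j}" for l
  proof -
    have "x \<le> real (Suc l) / real n" using less_node_iff[OF n xy(1), of l] l
      by (smt (verit) atLeastLessThan_iff i_def)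
    moreover have "real (Suc l) / real n \<le> y" using less_node_iff[OF n, of y l] l xy
      by (smt (verit) atLeastLessThan_iff j_def not_le)
    ultimately have "curvature_flux \<xi> < \<sigma> * p (real (Suc l) / real n)" by (rule p)
    also have "\<dots> = curvature_flux (\<sigma> * (real n * (u (Suc l) - u l)))"
      using EL[of l] l jn \<sigma> by (auto simp: curvature_flux_minus[symmetric])
    finally have "\<xi> < \<sigma> * (real n * (u (Suc l) - u l))" by (simp add: curvature_flux_less_iff)
    then show ?thesis using n by (simp add: field_simps)
  qed
  then have "(\<Sum>l\<in>{i..<j}. \<xi> / real n) \<le> (\<Sum>l\<in>{i..<j}. \<sigma> * (u (Suc l) - u l))" by (rule sum_mono)
  also have "\<dots> = \<sigma> * (u j - u i)"
    using sum_Suc_diff'[OF ij, of u] by (simp add: sum_distrib_left[symmetric])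
  also have "(\<Sum>l\<in>{i..<j}. \<xi> / real n) = \<xi> * (real j / real n - real i / real n)"
    using ij by (simp add: of_nat_diff diff_divide_distrib[symmetric])
  finally show ?thesis by (simp add: step_function_def i_def[symmetric] j_def[symmetric] ri rj)
qed

section \<open>The continuum limit\<close>

lemma tendsto_right_continuous:
  assumes "continuous (at_right x) f" "y \<longlonglongrightarrow> x" "\<And>n. x < y n"
  shows "(\<lambda>n. f (y n)) \<longlonglongrightarrow> f (x :: real)"
proof -
  have "filterlim y (at_right x) sequentially"
    using assms(2,3) by (intro tendsto_imp_filterlim_at_right) auto
  moreover have "(f \<longlongrightarrow> f x) (at_right x)" using assms(1) by (simp add: continuous_within)
  ultimately show ?thesis by (rule filterlim_compose[rotated])
qed

text \<open>
  The integrated form of the inclusion of \<open>p\<close> in the maximal monotone graph of the relation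
  \<open>p = w'/\<surd>(1 + w'\<^sup>2)\<close>. It makes sense for functions \<open>w\<close> with jumps and is stable under pointwise
  convergence of \<open>w\<close> and uniform convergence of \<open>p\<close>.
\<close>

definition flux_controls_increments :: "(real \<Rightarrow> real) \<Rightarrow> (real \<Rightarrow> real) \<Rightarrow> bool" where
  "flux_controls_increments p w \<longleftrightarrow>
     (\<forall>\<sigma> \<xi> x y. (\<sigma> = 1 \<or> \<sigma> = - 1) \<and> 0 < x \<and> x < y \<and> y < 1 \<and> (\<forall>t. x \<le> t \<and> t \<le> y \<longrightarrow> curvature_flux \<xi> < \<sigma> * p t)
        \<longrightarrow> \<xi> * (y - x) \<le> \<sigma> * (w y - w x))"

text \<open>
  Upward and downward jumps of the discrete solutions converge separately by Helly's theorem, which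
  gives the two monotone functions. If the limit vanished then the potential energies would tend to
  zero, which contradicts the uniform bound \<open>- \<delta>\<close> on the minimal energies.
\<close>

theorem continuum_limit:
  assumes b: "integrable lborel b" "\<And>x. x \<notin> unit_ivl \<Longrightarrow> b x = 0" "(LINT x|lborel. b x) < 0"
    and lam: "lam > 0"
    and F: "\<And>s. (F has_real_derivative f s) (at s)" "\<And>s. s \<le> 0 \<Longrightarrow> F s = 0"
    and f: "\<And>s. 0 \<le> f s" "(f \<longlongrightarrow> 0) at_top" "continuous_on UNIV f" and F_lim: "filterlim F at_top at_top"
    and neg: "\<delta> > 0" "\<forall>\<^sub>F n in sequentially. \<exists>w. discrete_energy n (\<lambda>i. lam * cell_integral b n i) F w \<le> - \<delta>"
  obtains P N R where "mono P" "mono N" "\<And>x. continuous (at_right x) P" "\<And>x. continuous (at_right x) N"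
    "\<And>x. \<bar>P x\<bar> \<le> R" "\<And>x. \<bar>N x\<bar> \<le> R"
    "\<And>x. x \<in> unit_ivl \<Longrightarrow> 0 \<le> P x - N x"
    "\<not> (AE x in lborel. x \<in> unit_ivl \<longrightarrow> P x - N x = 0)"
    "(LINT x|lborel. b x * f (P x - N x)) = 0"
    "\<And>x. \<bar>primitive (\<lambda>x. - lam * (b x * f (P x - N x))) x\<bar> \<le> 1"
    "flux_controls_increments (primitive (\<lambda>x. - lam * (b x * f (P x - N x)))) (\<lambda>x. P x - N x)"
proof -
  let ?J = "\<lambda>n. discrete_energy n (\<lambda>i. lam * cell_integral b n i) F"
  have bm [measurable]: "b \<in> borel_measurable borel" using b(1) by auto
  have fm [measurable]: "f \<in> borel_measurable borel" using f(3) by (rule borel_measurable_continuous_onI)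
  have Fc: "continuous_on UNIV F" using F(1) by (intro DERIV_continuous_on) (auto intro: has_field_derivative_at_within)
  have Fm [measurable]: "F \<in> borel_measurable borel" using Fc by (rule borel_measurable_continuous_onI)
  define Q where "Q R n u \<longleftrightarrow> (\<forall>i. 0 \<le> u i) \<and> (\<forall>i<n. u i \<le> R) \<and>
     (\<Sum>i<n - 1. \<bar>u (Suc i) - u i\<bar>) \<le> R \<and> (\<forall>v. ?J n u \<le> ?J n v) \<and>
     (\<forall>k<n. primitive (\<lambda>x. - lam * (b x * f (step_function n u x))) (real (Suc k) / real n) =
        (if Suc k < n then curvature_flux (real n * (u (Suc k) - u k)) else 0))" for R n u
  obtain R where R: "R \<ge> 0" "\<forall>n>0. \<exists>u. Q R n u"
    using discrete_solutions_exist[OF b lam F f(1,2) F_lim] unfolding Q_def[symmetric] by blast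
  then obtain u where "\<And>n. n > 0 \<Longrightarrow> Q R n (u n)" by metis
  then have u: "\<And>n i. n > 0 \<Longrightarrow> 0 \<le> u n i" "\<And>n i. n > 0 \<Longrightarrow> i < n \<Longrightarrow> u n i \<le> R"
    "\<And>n. n > 0 \<Longrightarrow> (\<Sum>i<n - 1. \<bar>u n (Suc i) - u n i\<bar>) \<le> R" "\<And>n v. n > 0 \<Longrightarrow> ?J n (u n) \<le> ?J n v"
    "\<And>n k. n > 0 \<Longrightarrow> k < n \<Longrightarrow>
       primitive (\<lambda>x. - lam * (b x * f (step_function n (u n) x))) (real (Suc k) / real n) =
        (if Suc k < n then curvature_flux (real n * (u n (Suc k) - u n k)) else 0)"
    unfolding Q_def by simp_all
  define Pn where "Pn m x = u (Suc m) 0 + jump_function (Suc m) (\<lambda>i. max 0 (u (Suc m) (Suc i) - u (Suc m) i)) x" for m x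
  define Nn where "Nn m x = jump_function (Suc m) (\<lambda>i. max 0 (u (Suc m) i - u (Suc m) (Suc i))) x" for m x
  have var: "(\<Sum>i<Suc m - 1. max 0 (u (Suc m) (Suc i) - u (Suc m) i)) \<le> R"
    "(\<Sum>i<Suc m - 1. max 0 (u (Suc m) i - u (Suc m) (Suc i))) \<le> R" for m
  proof -
    have "(\<Sum>i<Suc m - 1. max 0 (u (Suc m) (Suc i) - u (Suc m) i)) \<le> (\<Sum>i<Suc m - 1. \<bar>u (Suc m) (Suc i) - u (Suc m) i\<bar>)"
      "(\<Sum>i<Suc m - 1. max 0 (u (Suc m) i - u (Suc m) (Suc i))) \<le> (\<Sum>i<Suc m - 1. \<bar>u (Suc m) (Suc i) - u (Suc m) i\<bar>)"
      by (intro sum_mono; simp)+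
    then show "(\<Sum>i<Suc m - 1. max 0 (u (Suc m) (Suc i) - u (Suc m) i)) \<le> R"
      "(\<Sum>i<Suc m - 1. max 0 (u (Suc m) i - u (Suc m) (Suc i))) \<le> R"
      using u(3)[of "Suc m"] by (meson order_trans zero_less_Suc)+
  qed
  have PnR: "\<bar>Pn m x\<bar> \<le> 2 * R" for m x
  proof -
    have "\<bar>jump_function (Suc m) (\<lambda>i. max 0 (u (Suc m) (Suc i) - u (Suc m) i)) x\<bar> \<le> R"
      by (rule order_trans[OF abs_jump_function_le var(1)]) simp
    then show ?thesis using u(1,2)[of "Suc m" 0] by (simp add: Pn_def)
  qed
  have NnR: "\<bar>Nn m x\<bar> \<le> 2 * R" for m x
  proof -
    have "\<bar>Nn m x\<bar> \<le> R" unfolding Nn_def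
      by (rule order_trans[OF abs_jump_function_le var(2)]) simp
    then show ?thesis using R(1) by simp
  qed
  have Pn_mono: "mono (Pn m)" and Nn_mono: "mono (Nn m)" for m
    unfolding Pn_def[abs_def] Nn_def[abs_def]
    by (auto intro!: monoI add_left_mono monoD[OF mono_jump_function])
  have Pn_rc: "continuous (at_right x) (Pn m)" and Nn_rc: "continuous (at_right x) (Nn m)" for m x
    unfolding Pn_def[abs_def] Nn_def[abs_def] using right_continuous_jump_function by (auto intro!: continuous_intros)
  obtain s1 P where s1: "strict_mono s1" and P: "\<And>x. continuous (at_right x) P" "mono P" "\<And>x. \<bar>P x\<bar> \<le> 2 * R"
    "\<And>x. isCont P x \<Longrightarrow> (\<lambda>m. Pn (s1 m) x) \<longlonglongrightarrow> P x"
    using Helly_selection[of Pn "2 * R", OF Pn_rc Pn_mono PnR] by blast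
  obtain s2 N where s2: "strict_mono s2" and N: "\<And>x. continuous (at_right x) N" "mono N" "\<And>x. \<bar>N x\<bar> \<le> 2 * R"
    "\<And>x. isCont N x \<Longrightarrow> (\<lambda>m. Nn (s1 (s2 m)) x) \<longlonglongrightarrow> N x"
    using Helly_selection[of "\<lambda>m. Nn (s1 m)" "2 * R", OF Nn_rc Nn_mono NnR] by blast
  define k where "k m = Suc (s1 (s2 m))" for m
  have k_pos: "k m > 0" for m by (simp add: k_def)
  have k_lim: "filterlim k at_top sequentially"
  proof -
    have "strict_mono (\<lambda>m. s1 (s2 m))" using s1 s2 by (simp add: strict_mono_def)
    then have "filterlim (\<lambda>m. s1 (s2 m)) at_top sequentially" by (rule filterlim_subseq)
    from filterlim_compose[OF filterlim_Suc this] show ?thesis by (simp add: k_def[abs_def])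
  qed
  define U where "U m = step_function (k m) (u (k m))" for m
  define w where "w x = P x - N x" for x
  have Um [measurable]: "U m \<in> borel_measurable borel" for m unfolding U_def by (rule measurable_step_function)
  have Pm [measurable]: "P \<in> borel_measurable borel" using P(2) by (rule borel_measurable_mono)
  have Nm [measurable]: "N \<in> borel_measurable borel" using N(2) by (rule borel_measurable_mono)
  have wm [measurable]: "w \<in> borel_measurable borel" unfolding w_def by measurable
  have U_eq: "U m x = Pn (s1 (s2 m)) x - Nn (s1 (s2 m)) x" if "0 \<le> x" "x < 1" for m x
    unfolding U_def Pn_def Nn_def k_def using step_function_eq_jump_functions[of "Suc (s1 (s2 m))" x] that by simp
  have U_lim: "(\<lambda>m. U m x) \<longlonglongrightarrow> w x" if x: "0 \<le> x" "x < 1" "isCont P x" "isCont N x" for x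
  proof -
    have "(\<lambda>m. Pn (s1 (s2 m)) x) \<longlonglongrightarrow> P x"
      using LIMSEQ_subseq_LIMSEQ[OF P(4)[OF x(3)] s2] by (simp add: comp_def)
    then have "(\<lambda>m. Pn (s1 (s2 m)) x - Nn (s1 (s2 m)) x) \<longlonglongrightarrow> w x"
      unfolding w_def using N(4)[OF x(4)] by (intro tendsto_diff)
    then show ?thesis using U_eq[OF x(1,2)] by simp
  qed
  have U_bd: "U m x \<in> {0..R}" if "0 \<le> x" "x < 1" for m x
    unfolding U_def step_function_def using u(1,2)[OF k_pos] nat_floor_less[OF k_pos that(2)] by simp
  define bad where "bad = {x. \<not> isCont P x} \<union> {x. \<not> isCont N x}"
  have bad: "countable bad" unfolding bad_def by (intro countable_Un mono_ctble_discont P(2) N(2))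
  have good: "AE x in lborel. isCont P x \<and> isCont N x"
    by (rule AE_I'[OF countable_imp_null_set_lborel[OF bad]]) (simp add: bad_def subset_eq)
  have w_right: "(\<lambda>n. w (y n)) \<longlonglongrightarrow> w x" if "y \<longlonglongrightarrow> x" "\<And>n. x < y n" for y x
    unfolding w_def
    by (rule tendsto_diff[OF tendsto_right_continuous[OF P(1) that] tendsto_right_continuous[OF N(1) that]])
  have w_bd: "w x \<in> {0..R}" if x: "0 \<le> x" "x < 1" for x
  proof -
    obtain y where y: "y \<longlonglongrightarrow> x" "\<And>n. x < y n" "\<And>n. y n < 1" "\<And>n. isCont P (y n) \<and> isCont N (y n)"
      using AE_dense_from_right[OF good x(2)] by blast
    have y0: "0 \<le> y n" for n using y(2)[of n] x(1) by simp
    have "w (y n) \<in> {0..R}" for n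
    proof (rule closed_sequentially[OF closed_atLeastAtMost])
      show "(\<lambda>m. U m (y n)) \<longlonglongrightarrow> w (y n)"
        using y(4)[of n] by (intro U_lim y0 y(3)) auto
      show "U m (y n) \<in> {0..R}" for m by (rule U_bd[OF y0 y(3)])
    qed
    then show ?thesis by (rule closed_sequentially[OF closed_atLeastAtMost _ w_right[OF y(1,2)]])
  qed
  have conv: "(\<lambda>m. LINT x|lborel. \<bar>b x\<bar> * \<bar>g (U m x) - g (w x)\<bar>) \<longlonglongrightarrow> 0"
    and int: "integrable lborel (\<lambda>x. b x * g (U m x))" "integrable lborel (\<lambda>x. b x * g (w x))"
    if gc: "continuous_on UNIV g" for g :: "real \<Rightarrow> real" and m
  proof -
    have gm [measurable]: "g \<in> borel_measurable borel" using gc by (rule borel_measurable_continuous_onI)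
    have "compact (g ` {0..R})" using gc by (intro compact_continuous_image) (auto intro: continuous_on_subset)
    then have "\<exists>C. \<forall>x\<in>{0..R}. \<bar>g x\<bar> \<le> C" by (auto dest!: compact_imp_bounded simp: bounded_iff)
    then obtain C where C: "\<And>x. x \<in> {0..R} \<Longrightarrow> \<bar>g x\<bar> \<le> C" by blast
    have bU: "\<bar>b x * g (U m x)\<bar> \<le> \<bar>b x\<bar> * C" "\<bar>b x * g (w x)\<bar> \<le> \<bar>b x\<bar> * C" for m x
    proof -
      have "\<bar>b x * g z\<bar> \<le> \<bar>b x\<bar> * C" if "x \<in> unit_ivl \<longrightarrow> z \<in> {0..R}" for z
      proof (cases "x \<in> unit_ivl")
        case True
        then show ?thesis using C[of z] that by (simp add: abs_mult mult_left_mono)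
      next
        case False
        then show ?thesis using b(2)[OF False] by simp
      qed
      then show "\<bar>b x * g (U m x)\<bar> \<le> \<bar>b x\<bar> * C" "\<bar>b x * g (w x)\<bar> \<le> \<bar>b x\<bar> * C"
        using U_bd[of x m] w_bd[of x] by auto
    qed
    have bC: "integrable lborel (\<lambda>x. \<bar>b x\<bar> * C)" using b(1) by simp
    show "integrable lborel (\<lambda>x. b x * g (U m x))"
      by (rule Bochner_Integration.integrable_bound[OF bC]) (measurable, use bU(1) in \<open>force intro!: AE_I2 order_trans[OF bU(1)]\<close>)
    show "integrable lborel (\<lambda>x. b x * g (w x))"
      by (rule Bochner_Integration.integrable_bound[OF bC]) (measurable, use bU(2) in \<open>force intro!: AE_I2 order_trans[OF bU(2)]\<close>)
    have "(\<lambda>m. LINT x|lborel. \<bar>b x * g (U m x) - b x * g (w x)\<bar>) \<longlonglongrightarrow> integral\<^sup>L lborel (\<lambda>_::real. 0 :: real)"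
    proof (rule integral_dominated_convergence)
      show "integrable lborel (\<lambda>x. 2 * (\<bar>b x\<bar> * C))" using bC by simp
      show "AE x in lborel. norm \<bar>b x * g (U m x) - b x * g (w x)\<bar> \<le> 2 * (\<bar>b x\<bar> * C)" for m
      proof (rule AE_I2)
        show "norm \<bar>b x * g (U m x) - b x * g (w x)\<bar> \<le> 2 * (\<bar>b x\<bar> * C)" for x
          using bU(1)[of x m] bU(2)[of x] unfolding real_norm_def by linarith
      qed
      show "AE x in lborel. (\<lambda>m. \<bar>b x * g (U m x) - b x * g (w x)\<bar>) \<longlonglongrightarrow> 0"
        using good
      proof eventually_elim
        case (elim x)
        show ?case
        proof (cases "x \<in> unit_ivl")
          case True
          have "(\<lambda>m. g (U m x)) \<longlonglongrightarrow> g (w x)"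
            using True elim gc by (intro isCont_tendsto_compose[of _ g] U_lim) (auto simp: continuous_on_eq_continuous_at)
          then have "(\<lambda>m. \<bar>b x * g (U m x) - b x * g (w x)\<bar>) \<longlonglongrightarrow> \<bar>b x * g (w x) - b x * g (w x)\<bar>"
            by (intro tendsto_intros)
          then show ?thesis by simp
        qed (simp add: b(2))
      qed
    qed measurable
    then show "(\<lambda>m. LINT x|lborel. \<bar>b x\<bar> * \<bar>g (U m x) - g (w x)\<bar>) \<longlonglongrightarrow> 0"
      by (simp add: abs_mult flip: right_diff_distrib)
  qed
  define pm where "pm m = primitive (\<lambda>x. - lam * (b x * f (U m x)))" for m
  define p where "p = primitive (\<lambda>x. - lam * (b x * f (w x)))"
  define e where "e m = lam * (LINT x|lborel. \<bar>b x\<bar> * \<bar>f (U m x) - f (w x)\<bar>)" for m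
  have e_lim: "e \<longlonglongrightarrow> 0" unfolding e_def[abs_def] using tendsto_mult[OF tendsto_const conv[OF f(3)], of lam] by simp
  have ri: "integrable lborel (\<lambda>x. - lam * (b x * f (w x)))" "integrable lborel (\<lambda>x. - lam * (b x * f (U m x)))" for m
    using int[OF f(3)] by simp_all
  have p_e: "\<bar>pm m x - p x\<bar> \<le> e m" for m x
  proof -
    let ?d = "\<lambda>x. - lam * (b x * f (U m x)) - - lam * (b x * f (w x))"
    have di: "integrable lborel ?d" by (intro Bochner_Integration.integrable_diff ri)
    have eq: "pm m x - p x = primitive ?d x"
      unfolding pm_def p_def primitive_def right_diff_distrib
      by (intro Bochner_Integration.integral_diff[symmetric] integrable_indicator_mult ri) auto
    have abs_d: "\<bar>?d t\<bar> = lam * (\<bar>b t\<bar> * \<bar>f (U m t) - f (w t)\<bar>)" for t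
    proof -
      have "?d t = - (lam * (b t * (f (U m t) - f (w t))))" by (simp add: algebra_simps)
      then show ?thesis using lam by (simp add: abs_mult)
    qed
    have "\<bar>pm m x - p x\<bar> \<le> (LINT t|lborel. \<bar>?d t\<bar>)"
      unfolding eq by (rule abs_primitive_le[OF di])
    also have "\<dots> = e m" unfolding abs_d e_def by simp
    finally show ?thesis .
  qed
  have pc: "continuous_on UNIV p" unfolding p_def by (rule continuous_primitive[OF ri(1)])
  have EL: "pm m (real (Suc l) / real (k m)) =
     (if Suc l < k m then curvature_flux (real (k m) * (u (k m) (Suc l) - u (k m) l)) else 0)" if "l < k m" for m l
    unfolding pm_def U_def by (rule u(5)[OF k_pos that])
  have p1: "p 1 = 0"
  proof -
    have "pm m 1 = 0" for m using EL[of "k m - 1" m] k_pos[of m] by simp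
    then have "\<bar>p 1\<bar> \<le> e m" for m using p_e[of m 1] by simp
    then have "\<bar>p 1\<bar> \<le> 0" using e_lim by (intro LIMSEQ_le_const[of e]) auto
    then show ?thesis by simp
  qed
  have r_off: "- lam * (b x * f (w x)) = 0" if "x \<notin> unit_ivl" for x using b(2)[OF that] by simp
  have tot: "(LINT x|lborel. b x * f (w x)) = 0"
    using primitive_ge_1[of "\<lambda>x. - lam * (b x * f (w x))" 1, OF r_off] p1 lam by (simp add: p_def)
  have p_abs: "\<bar>p x\<bar> \<le> 1" for x
  proof -
    consider "x \<le> 0" | "1 \<le> x" | "x \<in> unit_ivl" by fastforce
    then show ?thesis
    proof cases
      case 1
      then have "p x = 0" unfolding p_def by (intro primitive_le_0 r_off)
      then show ?thesis by simp
    next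
      case 2
      then have "p x = (LINT x|lborel. - lam * (b x * f (w x)))" unfolding p_def by (intro primitive_ge_1 r_off)
      then show ?thesis using tot by simp
    next
      case 3
      \<comment> \<open>The nodes next to the right of \<open>x\<close>, where the discrete flux is explicitly known.\<close>
      define y where "y m = real (Suc (nat \<lfloor>real (k m) * x\<rfloor>)) / real (k m)" for m
      have "y = (\<lambda>m. real_of_int \<lfloor>real (k m) * x\<rfloor> / real (k m) + 1 / real (k m))"
        using 3 by (intro ext) (simp add: y_def add_divide_distrib)
      moreover have "(\<lambda>m. real_of_int \<lfloor>real (k m) * x\<rfloor> / real (k m) + 1 / real (k m)) \<longlonglongrightarrow> x + 0"
        by (intro tendsto_add tendsto_floor_div k_lim filterlim_compose[OF lim_inverse_n' k_lim])
      ultimately have "y \<longlonglongrightarrow> x" by simp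
      then have "(\<lambda>m. \<bar>p (y m)\<bar>) \<longlonglongrightarrow> \<bar>p x\<bar>"
        using pc by (intro tendsto_intros isCont_tendsto_compose[of _ p]) (auto simp: continuous_on_eq_continuous_at)
      moreover have "(\<lambda>m. 1 + e m) \<longlonglongrightarrow> 1 + 0" by (intro tendsto_intros e_lim)
      moreover have "\<bar>p (y m)\<bar> \<le> 1 + e m" for m
      proof -
        have "nat \<lfloor>real (k m) * x\<rfloor> < k m" using 3 by (intro nat_floor_less k_pos) auto
        then have "\<bar>pm m (y m)\<bar> \<le> 1"
          using abs_curvature_flux_less[THEN less_imp_le] unfolding y_def by (simp add: EL del: of_nat_Suc)
        then show ?thesis using p_e[of m "y m"] by linarith
      qed
      ultimately show ?thesis using LIMSEQ_le by fastforce
    qed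
  qed
  have incr_good: "\<xi> * (y - x) \<le> \<sigma> * (w y - w x)"
    if \<sigma>: "\<sigma> = 1 \<or> \<sigma> = - 1" and xy: "0 < x" "x < y" "y < 1"
      and g: "isCont P x \<and> isCont N x" "isCont P y \<and> isCont N y"
      and gt: "\<And>t. x \<le> t \<Longrightarrow> t \<le> y \<Longrightarrow> curvature_flux \<xi> < \<sigma> * p t" for \<sigma> \<xi> x y
  proof -
    have "\<exists>t0\<in>{x..y}. \<forall>t\<in>{x..y}. \<sigma> * p t0 \<le> \<sigma> * p t"
      using xy by (intro continuous_attains_inf) (auto intro!: continuous_intros continuous_on_subset[OF pc])
    then obtain t0 where t0: "t0 \<in> {x..y}" "\<And>t. t \<in> {x..y} \<Longrightarrow> \<sigma> * p t0 \<le> \<sigma> * p t" by blast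
    \<comment> \<open>The gap by which \<open>\<sigma> p\<close> exceeds the threshold on the whole interval; it absorbs the error \<open>e m\<close>.\<close>
    define \<eta> where "\<eta> = \<sigma> * p t0 - curvature_flux \<xi>"
    have \<eta>: "\<eta> > 0" using gt[of t0] t0(1) by (simp add: \<eta>_def)
    have ev: "\<forall>\<^sub>F m in sequentially. e m < \<eta>" using e_lim \<eta> by (rule order_tendstoD)
    have "\<forall>\<^sub>F m in sequentially. \<xi> * (real_of_int \<lfloor>real (k m) * y\<rfloor> / real (k m) - real_of_int \<lfloor>real (k m) * x\<rfloor> / real (k m))
       \<le> \<sigma> * (U m y - U m x)"
      using ev
    proof eventually_elim
      case (elim m)
      show ?case unfolding U_def
      proof (rule step_function_increment[where p="pm m", OF k_pos])
        show "pm m (real (Suc l) / real (k m)) = curvature_flux (real (k m) * (u (k m) (Suc l) - u (k m) l))"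
          if "Suc l < k m" for l using EL[of l m] that by simp
        fix t assume t: "x \<le> t" "t \<le> y"
        have "\<sigma> * p t0 \<le> \<sigma> * p t" using t0 t by auto
        moreover have "\<bar>\<sigma> * pm m t - \<sigma> * p t\<bar> \<le> e m" using p_e[of m t] \<sigma> by (auto simp: abs_minus_commute)
        ultimately show "curvature_flux \<xi> < \<sigma> * pm m t" using elim unfolding \<eta>_def by linarith
      qed (use xy \<sigma> in auto)
    qed
    moreover have "(\<lambda>m. \<xi> * (real_of_int \<lfloor>real (k m) * y\<rfloor> / real (k m) - real_of_int \<lfloor>real (k m) * x\<rfloor> / real (k m))) \<longlonglongrightarrow> \<xi> * (y - x)"
      by (intro tendsto_intros tendsto_floor_div k_lim)
    moreover have "(\<lambda>m. \<sigma> * (U m y - U m x)) \<longlonglongrightarrow> \<sigma> * (w y - w x)"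
      using xy g by (intro tendsto_intros U_lim) auto
    ultimately show ?thesis by (intro tendsto_le[OF sequentially_bot])
  qed
  have incr: "\<xi> * (y - x) \<le> \<sigma> * (w y - w x)"
    if \<sigma>: "\<sigma> = 1 \<or> \<sigma> = - 1" and xy: "0 < x" "x < y" "y < 1"
      and gt: "\<And>t. x \<le> t \<Longrightarrow> t \<le> y \<Longrightarrow> curvature_flux \<xi> < \<sigma> * p t" for \<sigma> \<xi> x y
  proof -
    have "isCont (\<lambda>t. \<sigma> * p t) y" using pc by (intro continuous_intros) (auto simp: continuous_on_eq_continuous_at)
    moreover have "curvature_flux \<xi> < \<sigma> * p y" using gt[of y] xy by simp
    ultimately have "\<forall>\<^sub>F t in at y. curvature_flux \<xi> < \<sigma> * p t" unfolding isCont_def by (rule order_tendstoD)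
    then obtain d where d: "d > 0" "\<And>t. t \<noteq> y \<Longrightarrow> dist t y < d \<Longrightarrow> curvature_flux \<xi> < \<sigma> * p t"
      by (auto simp: eventually_at)
    \<comment> \<open>Approximation is possible only from the right, so the interval is first enlarged beyond \<open>y\<close>.\<close>
  define z where "z = min 1 (y + d)"
    have z: "y < z" "z \<le> 1" using d xy by (auto simp: z_def)
    have gt': "curvature_flux \<xi> < \<sigma> * p t" if "x \<le> t" "t < z" for t
      using gt[of t] d(2)[of t] that by (cases "t \<le> y") (auto simp: z_def dist_real_def)
    obtain X where X: "X \<longlonglongrightarrow> x" "\<And>n. x < X n" "\<And>n. X n < y" "\<And>n. isCont P (X n) \<and> isCont N (X n)"
      using AE_dense_from_right[OF good xy(2)] by blast
    obtain Y where Y: "Y \<longlonglongrightarrow> y" "\<And>n. y < Y n" "\<And>n. Y n < z" "\<And>n. isCont P (Y n) \<and> isCont N (Y n)"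
      using AE_dense_from_right[OF good z(1)] by blast
    have "\<xi> * (Y n - X n) \<le> \<sigma> * (w (Y n) - w (X n))" for n
    proof (rule incr_good[OF \<sigma>])
      show "0 < X n" "X n < Y n" "Y n < 1" using X(2,3)[of n] Y(2,3)[of n] xy z by linarith+
      show "curvature_flux \<xi> < \<sigma> * p t" if "X n \<le> t" "t \<le> Y n" for t
        using X(2)[of n] Y(3)[of n] that by (intro gt') linarith+
    qed (use X Y in auto)
    moreover have "(\<lambda>n. \<xi> * (Y n - X n)) \<longlonglongrightarrow> \<xi> * (y - x)" by (intro tendsto_intros X Y)
    moreover have "(\<lambda>n. \<sigma> * (w (Y n) - w (X n))) \<longlonglongrightarrow> \<sigma> * (w y - w x)"
      using X Y by (intro tendsto_intros w_right)
    ultimately show ?thesis by (intro LIMSEQ_le) auto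
  qed
  have nontriv: "\<not> (AE x in lborel. x \<in> unit_ivl \<longrightarrow> w x = 0)"
  proof
    assume z: "AE x in lborel. x \<in> unit_ivl \<longrightarrow> w x = 0"
    have F0: "F 0 = 0" using F(2) by simp
    have "(\<lambda>m. LINT x|lborel. \<bar>b x\<bar> * \<bar>F (U m x) - F (w x)\<bar>) \<longlonglongrightarrow> 0" by (rule conv[OF Fc])
    moreover have "(LINT x|lborel. b x * F (U m x)) \<le> (LINT x|lborel. \<bar>b x\<bar> * \<bar>F (U m x) - F (w x)\<bar>)" for m
    proof (rule integral_mono_AE)
      show "integrable lborel (\<lambda>x. b x * F (U m x))" by (rule int(1)[OF Fc])
      have "integrable lborel (\<lambda>x. \<bar>b x * F (U m x) - b x * F (w x)\<bar>)"
        using int(1)[OF Fc] int(2)[OF Fc] by (intro integrable_abs Bochner_Integration.integrable_diff)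
      then show "integrable lborel (\<lambda>x. \<bar>b x\<bar> * \<bar>F (U m x) - F (w x)\<bar>)"
        by (simp add: abs_mult flip: right_diff_distrib)
      show "AE x in lborel. b x * F (U m x) \<le> \<bar>b x\<bar> * \<bar>F (U m x) - F (w x)\<bar>"
        using z
      proof eventually_elim
        case (elim x)
        show ?case
        proof (cases "x \<in> unit_ivl")
          case True
          then show ?thesis using elim F0 by (metis abs_ge_self abs_mult diff_zero)
        qed (simp add: b(2))
      qed
    qed
    ultimately have "\<forall>\<^sub>F m in sequentially. (LINT x|lborel. b x * F (U m x)) < \<delta> / lam"
      using neg(1) lam by (auto dest!: order_tendstoD(2)[where a="\<delta> / lam"] elim!: eventually_mono intro: le_less_trans)
    moreover have "\<forall>\<^sub>F m in sequentially. \<exists>v. ?J (k m) v \<le> - \<delta>"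
      using eventually_compose_filterlim[OF neg(2) k_lim] .
    ultimately have "\<forall>\<^sub>F m in sequentially. False"
    proof eventually_elim
      case (elim m)
      then obtain v where "?J (k m) v \<le> - \<delta>" by blast
      then have "?J (k m) (u (k m)) \<le> - \<delta>" using u(4)[OF k_pos] order_trans by blast
      moreover have "- (\<Sum>i<k m. lam * cell_integral b (k m) i * F (u (k m) i)) \<le> ?J (k m) (u (k m))"
        unfolding discrete_energy_def by (simp add: sum_nonneg)
      moreover have "(\<Sum>i<k m. lam * cell_integral b (k m) i * F (u (k m) i)) = lam * (LINT x|lborel. b x * F (U m x))"
        unfolding U_def using sum_cell_integral_total[OF b(1,2) k_pos, where G=F and u="u (k m)"]
        by (simp add: sum_distrib_left[symmetric] mult.assoc)
      moreover have "lam * (LINT x|lborel. b x * F (U m x)) < \<delta>" using elim(1) lam by (simp add: field_simps)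
      ultimately show False by linarith
    qed
    then show False by simp
  qed
  have ctrl: "flux_controls_increments p w"
    unfolding flux_controls_increments_def
  proof (intro allI impI; elim conjE)
    fix \<sigma> \<xi> x y :: real
    assume "\<sigma> = 1 \<or> \<sigma> = - 1" "0 < x" "x < y" "y < 1" "\<forall>t. x \<le> t \<and> t \<le> y \<longrightarrow> curvature_flux \<xi> < \<sigma> * p t"
    then show "\<xi> * (y - x) \<le> \<sigma> * (w y - w x)" by (intro incr) simp_all
  qed
  have w0: "0 \<le> w x" if "x \<in> unit_ivl" for x using w_bd[of x] that by simp
  show thesis
    by (rule that[of P N "2 * R"])
       (fact P(1-3) N(1-3) w0[unfolded w_def] nontriv[unfolded w_def] tot[unfolded w_def]
         p_abs[unfolded p_def w_def] ctrl[unfolded p_def w_def[abs_def]])+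
qed

section \<open>Derivatives of differences of monotone functions\<close>

lemma signed_measure_interval_measure:
  assumes F: "mono F" "\<And>x. continuous (at_right x) F"
  shows "signed_measure borel_ivl (measure (interval_measure F))"
    and "x \<in> unit_ivl \<Longrightarrow> distribution_function (measure (interval_measure F)) x = F x - F 0"
proof -
  let ?m = "interval_measure F"
  have Ioc: "emeasure ?m {x<..y} = ennreal (F y - F x)" if "x \<le> y" for x y
    using that F by (intro emeasure_interval_measure_Ioc) (auto dest: monoD)
  define M where "M = restrict_space ?m unit_ivl"
  have sM: "sets M = sets borel_ivl" unfolding M_def by (rule sets_restrict_space_cong) simp
  have mM: "measure M A = measure ?m A" if "A \<in> sets borel_ivl" for A
    unfolding M_def using that by (intro measure_restrict_space) (auto simp: sets_borel_ivl)
  have "emeasure ?m unit_ivl \<le> emeasure ?m {0<..1}" by (intro emeasure_mono) auto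
  also have "\<dots> < \<infinity>" using Ioc[of 0 1] by simp
  finally have "emeasure M (space M) \<noteq> \<infinity>"
    unfolding M_def by (subst emeasure_restrict_space) (auto simp: space_restrict_space)
  then interpret M: finite_measure M by (rule finite_measureI)
  show "signed_measure borel_ivl (measure ?m)"
    unfolding signed_measure_def
  proof (intro conjI allI impI)
    fix A :: "nat \<Rightarrow> real set" assume A: "range A \<subseteq> sets borel_ivl" "disjoint_family A"
    have "(\<lambda>i. measure M (A i)) sums measure M (\<Union>i. A i)"
      using A by (intro M.finite_measure_UNION) (simp_all add: sM)
    moreover have "(\<Union>i. A i) \<in> sets borel_ivl" using A(1) by auto
    moreover have "A i \<in> sets borel_ivl" for i using A(1) by auto
    ultimately show "(\<lambda>i. measure ?m (A i)) sums measure ?m (\<Union>i. A i)" by (simp add: mM)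
  qed simp
  show "distribution_function (measure ?m) x = F x - F 0" if x: "x \<in> unit_ivl"
  proof -
    have "unit_ivl \<inter> {..x} = {0<..x}" using x by auto
    moreover have "0 \<le> F x - F 0" using x monoD[OF F(1), of 0 x] by simp
    ultimately show ?thesis using Ioc[of 0 x] x by (simp add: measure_def)
  qed
qed

text \<open>
  The Stieltjes measure of the distribution function has the same distribution function.
\<close>

lemma signed_measure_nonneg_if_mono:
  assumes \<kappa>: "signed_measure borel_ivl \<kappa>" and mono: "mono (distribution_function \<kappa>)"
    and A: "A \<in> sets borel_ivl"
  shows "0 \<le> \<kappa> A"
proof -
  have "continuous (at_right x) (distribution_function \<kappa>)" for x
    unfolding continuous_within_sequentially comp_def
    using tendsto_distribution_function_right[OF \<kappa>] by (auto intro: less_imp_le)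
  note F = mono this
  have "\<kappa> A = measure (interval_measure (distribution_function \<kappa>)) A"
  proof (rule signed_measure_eqI_unit_ivl[OF \<kappa> signed_measure_interval_measure(1)[OF F] _ A])
    fix x assume x: "x \<in> unit_ivl"
    have "unit_ivl \<inter> {..0} = ({} :: real set)" by auto
    then show "distribution_function \<kappa> x = distribution_function (measure (interval_measure (distribution_function \<kappa>))) x"
      using signed_measure_interval_measure(2)[OF F x] signed_measure_empty[OF \<kappa>] by simp
  qed
  then show ?thesis by simp
qed

text \<open>
  On test functions the formula for primitives reduces the claim to the value of the distribution
  function, and the constant \<open>P 0 - N 0\<close> is annihilated by derivatives of test functions.
\<close>

lemma has_distr_deriv_monotone_difference:
  assumes P: "mono P" "\<And>x. continuous (at_right x) P" "\<And>x. \<bar>P x\<bar> \<le> R"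
    and N: "mono N" "\<And>x. continuous (at_right x) N" "\<And>x. \<bar>N x\<bar> \<le> R"
  defines "\<nu> \<equiv> (\<lambda>A. measure (interval_measure P) A - measure (interval_measure N) A)"
  shows "set_integrable lebesgue unit_ivl (\<lambda>x. P x - N x)"
    and "has_distr_deriv (\<lambda>x. P x - N x) \<nu>"
    and "x \<in> unit_ivl \<Longrightarrow> distribution_function \<nu> x = (P x - N x) - (P 0 - N 0)"
proof -
  have [measurable]: "P \<in> borel_measurable borel" "N \<in> borel_measurable borel"
    using P(1) N(1) by (auto intro: borel_measurable_mono)
  have cdf: "distribution_function \<nu> x = (P x - N x) - (P 0 - N 0)" if "x \<in> unit_ivl" for x
    using signed_measure_interval_measure(2)[OF P(1,2) that] signed_measure_interval_measure(2)[OF N(1,2) that]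
    by (simp add: \<nu>_def)
  then show "x \<in> unit_ivl \<Longrightarrow> distribution_function \<nu> x = (P x - N x) - (P 0 - N 0)" .
  have \<nu>: "signed_measure borel_ivl \<nu>"
    using signed_measure_linear_combination[OF signed_measure_interval_measure(1)[OF P(1,2)]
        signed_measure_interval_measure(1)[OF N(1,2)], of 1 "- 1"]
    by (simp add: \<nu>_def)
  have bd: "\<bar>P x - N x\<bar> \<le> 2 * R" for x using P(3)[of x] N(3)[of x] by linarith
  have um: "(\<lambda>x. P x - N x) \<in> borel_measurable borel" by measurable
  have ui: "integrable lborel (\<lambda>x. indicator unit_ivl x * (P x - N x))"
    by (rule integrable_on_unit_ivl[OF um bd])
  then show "set_integrable lebesgue unit_ivl (\<lambda>x. P x - N x)"
    unfolding set_integrable_def by (subst integrable_completion) auto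
  show "has_distr_deriv (\<lambda>x. P x - N x) \<nu>"
    unfolding has_distr_deriv_def
  proof (intro conjI allI impI \<nu>)
    fix \<psi> assume \<psi>: "test_fun \<psi>"
    note d = test_fun_eq_primitive[OF \<psi>]
    have dm [measurable]: "deriv \<psi> \<in> borel_measurable borel" using d(1) by auto
    have i: "integrable lborel (\<lambda>x. deriv \<psi> x * (P x - N x))"
      using d(1) by (rule integrable_mult_bounded[OF _ _ bd]) simp
    have "signed_integral borel_ivl \<nu> \<psi> = - (LINT x|lborel. deriv \<psi> x * distribution_function \<nu> x)"
      using signed_integral_primitive[OF \<nu> d(1,3)] by (simp add: d(4))
    also have "(LINT x|lborel. deriv \<psi> x * distribution_function \<nu> x) =
       (LINT x|lborel. deriv \<psi> x * (P x - N x) - (P 0 - N 0) * deriv \<psi> x)"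
    proof (intro Bochner_Integration.integral_cong refl)
      show "deriv \<psi> x * distribution_function \<nu> x = deriv \<psi> x * (P x - N x) - (P 0 - N 0) * deriv \<psi> x" for x
      proof (cases "x \<in> unit_ivl")
        case True
        show ?thesis unfolding cdf[OF True] by (simp add: algebra_simps)
      qed (simp add: d(2))
    qed
    also have "\<dots> = (LINT x|lborel. deriv \<psi> x * (P x - N x))"
      using i d(1,3) by simp
    also have "\<dots> = (LINT x:unit_ivl|lebesgue. (P x - N x) * deriv \<psi> x)"
    proof (rule integral_unit_ivl_lebesgue_eq_lborel[symmetric])
      show "(\<lambda>x. indicator unit_ivl x * ((P x - N x) * deriv \<psi> x)) \<in> borel_measurable lebesgue"
        by (rule measurable_completion) measurable
      show "AE x in lborel. indicator unit_ivl x * ((P x - N x) * deriv \<psi> x) = deriv \<psi> x * (P x - N x)"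
        using d(2) by (intro AE_I2) (auto simp: indicator_def)
    qed measurable
    finally show "(LINT x:unit_ivl|lebesgue. (P x - N x) * deriv \<psi> x) = - signed_integral borel_ivl \<nu> \<psi>" by simp
  qed
qed

text \<open>
  The comparison of \<open>\<nu>\<close> with Lebesgue measure passes from intervals to Borel sets: on a closed interval
  contained in \<open>U\<close> the difference of both measures has a monotone distribution function, and
  countably many intervals with rational end points cover \<open>U\<close>.
\<close>

lemma signed_measure_nonneg_on_open:
  assumes \<nu>: "signed_measure borel_ivl \<nu>" and cdf: "\<And>x. x \<in> unit_ivl \<Longrightarrow> distribution_function \<nu> x = w x - w 0"
    and U: "open U" "U \<subseteq> unit_ivl"
    and incr: "\<And>x y. x < y \<Longrightarrow> {x..y} \<subseteq> U \<Longrightarrow> \<xi> * (y - x) \<le> \<sigma> * (w y - w x)"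
    and A: "A \<in> sets borel_ivl" "A \<subseteq> U"
  shows "\<xi> * measure lborel A \<le> \<sigma> * \<nu> A"
proof -
  define len where "len A = (LINT x:A|lborel. indicator unit_ivl x :: real)" for A
  have len: "signed_measure borel_ivl len" unfolding len_def
    by (rule signed_measure_lborel_density) (intro integrable_real_indicator, auto)
  have lenm: "len B = measure lborel B" if "B \<in> sets borel_ivl" for B
  proof -
    have B: "B \<in> sets borel" "B \<subseteq> unit_ivl" using that by (auto simp: sets_borel_ivl)
    have "len B = (LINT x|lborel. indicator B x)"
      unfolding len_def set_lebesgue_integral_def using B
      by (intro Bochner_Integration.integral_cong) (auto simp: indicator_def)
    then show ?thesis using B by simp
  qed
  define \<kappa> where "\<kappa> A = \<sigma> * \<nu> A + (- \<xi>) * len A" for A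
  have \<kappa>: "signed_measure borel_ivl \<kappa>" unfolding \<kappa>_def by (rule signed_measure_linear_combination[OF \<nu> len])
  have \<kappa>cdf: "distribution_function \<kappa> x = \<sigma> * (w x - w 0) - \<xi> * x" if x: "x \<in> unit_ivl" for x
  proof -
    have "unit_ivl \<inter> {..x} = {0<..x}" using x by auto
    moreover have "len {0<..x} = x" using x by (subst lenm) (auto simp: sets_borel_ivl)
    ultimately show ?thesis using cdf[OF x] by (simp add: \<kappa>_def)
  qed
  have \<kappa>Ioc: "\<kappa> {x<..y} = \<sigma> * (w y - w x) - \<xi> * (y - x)" if xy: "0 < x" "x \<le> y" "y < 1" for x y
  proof -
    have "{x<..y} = (unit_ivl \<inter> {..y}) - (unit_ivl \<inter> {..x})" using xy by auto
    moreover have "unit_ivl \<inter> {..t} \<in> sets borel_ivl" for t by (simp add: sets_borel_ivl)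
    moreover have "unit_ivl \<inter> {..x} \<subseteq> unit_ivl \<inter> {..y}" using xy(2) by auto
    ultimately have "\<kappa> {x<..y} = distribution_function \<kappa> y - distribution_function \<kappa> x"
      by (simp only: signed_measure_Diff[OF \<kappa>])
    then show ?thesis using \<kappa>cdf[of x] \<kappa>cdf[of y] xy by (simp add: algebra_simps)
  qed
  have piece: "0 \<le> \<kappa> B" if B: "B \<in> sets borel_ivl" "B \<subseteq> {x<..y}" and xy: "x < y" "{x..y} \<subseteq> U" for B x y
  proof -
    have "x \<in> U" "y \<in> U" using xy by auto
    then have x0: "0 < x" and y1: "y < 1" using U(2) by auto
    define \<kappa>' where "\<kappa>' A = \<kappa> (A \<inter> {x<..y})" for A
    have I: "{x<..y} \<in> sets borel_ivl" using x0 y1 by (auto simp: sets_borel_ivl)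
    have \<kappa>': "signed_measure borel_ivl \<kappa>'" unfolding \<kappa>'_def by (rule signed_measure_restrict[OF \<kappa> I])
    have c: "distribution_function \<kappa>' t = \<kappa> {x<..max x (min t y)}" for t
    proof -
      have "unit_ivl \<inter> {..t} \<inter> {x<..y} = {x<..max x (min t y)}" using x0 y1 by auto
      then show ?thesis by (simp add: \<kappa>'_def)
    qed
    have "mono (distribution_function \<kappa>')"
    proof (rule monoI)
      fix s t :: real assume "s \<le> t"
      define S where "S = max x (min s y)"
      define T where "T = max x (min t y)"
      have ST: "x \<le> S" "S \<le> T" "T \<le> y" using \<open>s \<le> t\<close> xy(1) by (auto simp: S_def T_def)
      have "\<xi> * (T - S) \<le> \<sigma> * (w T - w S)"
      proof (cases "S = T")
        case False
        then show ?thesis using ST xy(2) by (intro incr) auto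
      qed simp
      then have "\<kappa> {x<..S} \<le> \<kappa> {x<..T}"
        using \<kappa>Ioc[of x S] \<kappa>Ioc[of x T] x0 y1 ST by (simp add: algebra_simps)
      then show "distribution_function \<kappa>' s \<le> distribution_function \<kappa>' t"
        unfolding c S_def T_def .
    qed
    from signed_measure_nonneg_if_mono[OF \<kappa>' this B(1)] have "0 \<le> \<kappa>' B" .
    then show ?thesis using B(2) by (simp add: \<kappa>'_def Int_absorb2)
  qed
  \<comment> \<open>An enumeration of the intervals with rational end points that are contained in \<open>U\<close>.\<close>
  define C where "C k = (case from_nat k :: rat \<times> rat of (q, r) \<Rightarrow>
     if q < r \<and> {of_rat q..of_rat r} \<subseteq> U then {of_rat q<..of_rat r} else ({} :: real set))" for k
  have C: "C k \<in> sets borel_ivl" for k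
  proof -
    obtain q r where qr: "(from_nat k :: rat \<times> rat) = (q, r)" by (cases "from_nat k :: rat \<times> rat")
    have "C k \<subseteq> U"
    proof (cases "q < r \<and> {of_rat q..of_rat r} \<subseteq> U")
      case True
      then have "C k \<subseteq> {of_rat q..of_rat r}" using qr by (auto simp: C_def)
      then show ?thesis using True by blast
    next
      case False
      then show ?thesis using qr by (auto simp: C_def)
    qed
    moreover have "C k \<in> sets borel" using qr by (simp add: C_def)
    ultimately show ?thesis using U(2) by (simp add: sets_borel_ivl)
  qed
  have "A \<subseteq> (\<Union>k. C k)"
  proof
    fix t assume "t \<in> A"
    then have "t \<in> U" using A by auto
    then obtain e where e: "e > 0" "\<And>s. dist s t < e \<Longrightarrow> s \<in> U" using U(1) unfolding open_dist by blast
    obtain q where q: "t - e < of_rat q" "of_rat q < t" using of_rat_dense[of "t - e" t] e(1) by auto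
    obtain r where r: "t < of_rat r" "of_rat r < t + e" using of_rat_dense[of t "t + e"] e(1) by auto
    have "q < r" using q r by (metis less_trans of_rat_less)
    moreover have "{of_rat q..of_rat r} \<subseteq> U"
    proof
      fix s :: real assume "s \<in> {of_rat q..of_rat r}"
      then show "s \<in> U" using q r by (intro e(2)) (auto simp: dist_real_def abs_less_iff)
    qed
    ultimately have "t \<in> C (to_nat (q, r))" using q r by (simp add: C_def)
    then show "t \<in> (\<Union>k. C k)" by blast
  qed
  moreover have n\<kappa>: "signed_measure borel_ivl (\<lambda>A. (- 1) * \<kappa> A + 0 * \<kappa> A)"
    by (rule signed_measure_linear_combination[OF \<kappa> \<kappa>])
  moreover have "- 1 * \<kappa> X + 0 * \<kappa> X \<le> 0" if X: "X \<in> sets borel_ivl" "X \<subseteq> C k" for k X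
  proof -
    obtain q r where qr: "(from_nat k :: rat \<times> rat) = (q, r)" by (cases "from_nat k :: rat \<times> rat")
    show ?thesis
    proof (cases "q < r \<and> {of_rat q..of_rat r} \<subseteq> U")
      case True
      then have "X \<subseteq> {of_rat q<..of_rat r}" using X(2) qr by (simp add: C_def)
      then have "0 \<le> \<kappa> X" using True by (intro piece[OF X(1)]) (auto simp: of_rat_less)
      then show ?thesis by simp
    next
      case False
      then have "C k = {}" unfolding C_def qr by (simp only: prod.case if_False)
      then have "X = {}" using X(2) by simp
      then show ?thesis using signed_measure_empty[OF \<kappa>] by simp
    qed
  qed
  ultimately have "- 1 * \<kappa> A + 0 * \<kappa> A \<le> 0"
    using signed_measure_negative_UN[OF n\<kappa>, of C A] C A(1) by blast
  then show ?thesis using lenm[OF A(1)] by (simp add: \<kappa>_def)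
qed

section \<open>The flux determines both parts of the derivative\<close>

text \<open>
  On the open set \<open>U \<sigma> \<xi>\<close> where \<open>\<sigma> p\<close> exceeds the flux of slope \<open>\<xi>\<close>, the measure \<open>\<sigma> \<nu>\<close> is at least
  \<open>\<xi>\<close> times Lebesgue measure. Off the null set \<open>N\<close> that carries \<open>\<mu>\<close> this bounds \<open>\<sigma> g\<close> from below by
  \<open>\<xi>\<close>, and with rational \<open>\<xi>\<close> and both signs it pins down \<open>g\<close>. On \<open>N\<close>, where Lebesgue measure
  vanishes, it says that \<open>\<sigma> \<mu>\<close> is nonnegative on each \<open>U \<sigma> \<xi>\<close>, hence where \<open>\<sigma> p > - 1\<close>. Where both
  signs apply \<open>\<mu>\<close> vanishes, and what remains is \<open>p = 1\<close> with \<open>\<mu>\<close> positive and \<open>p = - 1\<close> with \<open>\<mu>\<close>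
  negative.
\<close>

theorem flux_inclusion:
  assumes \<nu>: "signed_measure borel_ivl \<nu>" and cdf: "\<And>x. x \<in> unit_ivl \<Longrightarrow> distribution_function \<nu> x = w x - w 0"
    and dec: "lebesgue_decomp \<nu> g \<mu>"
    and p: "continuous_on UNIV p" "\<And>x. \<bar>p x\<bar> \<le> 1"
    and ctrl: "flux_controls_increments p w"
  shows "AE x in lborel. x \<in> unit_ivl \<longrightarrow> curvature_flux (g x) = p x"
    and "AE x in total_variation borel_ivl \<mu>. polar_density borel_ivl \<mu> x = p x"
proof -
  have pm [measurable]: "p \<in> borel_measurable borel" using p(1) by (rule borel_measurable_continuous_onI)
  have gi: "set_integrable lebesgue unit_ivl g" and \<mu>: "signed_measure borel_ivl \<mu>"
    using dec by (auto simp: lebesgue_decomp_def)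
  obtain N where N: "N \<in> sets borel_ivl" "emeasure lebesgue N = 0"
      "emeasure (total_variation borel_ivl \<mu>) (unit_ivl - N) = 0"
    using dec by (auto simp: lebesgue_decomp_def)
  have Nb: "N \<in> sets borel" "N \<subseteq> unit_ivl" using N(1) by (auto simp: sets_borel_ivl)
  have Nc: "unit_ivl - N \<in> sets borel_ivl" using Nb(1) by (simp add: sets_borel_ivl)
  have N0: "emeasure lborel N = 0" using N(2) Nb(1) by simp
  then have N_AE: "AE x in lborel. x \<notin> N" using Nb(1) by (intro AE_not_in) (auto simp: null_sets_def)
  obtain g' where g': "integrable lborel g'" "\<And>x. x \<notin> unit_ivl \<Longrightarrow> g' x = 0"
    "AE x in lborel. indicator unit_ivl x * g x = g' x"
    using borel_representative[OF gi] by blast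
  have g'm [measurable]: "g' \<in> borel_measurable borel" using g'(1) by auto
  have \<nu>_eq: "\<nu> A = (LINT x|lborel. indicator A x * g' x) + \<mu> A" if A: "A \<in> sets borel_ivl" for A
  proof -
    have Ab: "A \<in> sets borel" "A \<subseteq> unit_ivl" using A by (auto simp: sets_borel_ivl)
    have "(LINT x:A|lebesgue. g x) = (LINT x:unit_ivl|lebesgue. indicator A x * g x)"
      unfolding set_lebesgue_integral_def using Ab
      by (intro Bochner_Integration.integral_cong) (auto simp: indicator_def)
    also have "\<dots> = (LINT x|lborel. indicator A x * g' x)"
      using Ab(1) by (intro integral_borel_representative[OF gi _ g'(3)]) auto
    finally show ?thesis using dec A by (simp add: lebesgue_decomp_def)
  qed
  define U where "U \<sigma> \<xi> = {t \<in> unit_ivl. curvature_flux \<xi> < \<sigma> * p t}" for \<sigma> \<xi>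
  have U_open: "open (U \<sigma> \<xi>)" for \<sigma> \<xi>
  proof -
    have "open {t. curvature_flux \<xi> < \<sigma> * p t}" using p(1) by (intro open_Collect_less continuous_intros)
    moreover have "U \<sigma> \<xi> = unit_ivl \<inter> {t. curvature_flux \<xi> < \<sigma> * p t}" by (auto simp: U_def)
    ultimately show ?thesis by (simp add: open_Int)
  qed
  have U_sets: "U \<sigma> \<xi> \<in> sets borel_ivl" for \<sigma> \<xi> using borel_open[OF U_open] by (auto simp: sets_borel_ivl U_def)
  have low: "\<xi> * measure lborel A \<le> \<sigma> * \<nu> A"
    if \<sigma>: "\<sigma> = 1 \<or> \<sigma> = - 1" and A: "A \<in> sets borel_ivl" "A \<subseteq> U \<sigma> \<xi>" for \<sigma> \<xi> A
  proof (rule signed_measure_nonneg_on_open[OF \<nu> cdf U_open[of \<sigma> \<xi>] _ _ A])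
    show "U \<sigma> \<xi> \<subseteq> unit_ivl" by (auto simp: U_def)
    fix x y assume xy: "x < y" "{x..y} \<subseteq> U \<sigma> \<xi>"
    have "x \<in> U \<sigma> \<xi>" "y \<in> U \<sigma> \<xi>" using xy by auto
    then have "0 < x" "y < 1" by (auto simp: U_def)
    moreover have "curvature_flux \<xi> < \<sigma> * p t" if "x \<le> t" "t \<le> y" for t
      using xy(2) that by (auto simp: U_def subset_eq)
    ultimately show "\<xi> * (y - x) \<le> \<sigma> * (w y - w x)"
      using ctrl \<sigma> xy(1) unfolding flux_controls_increments_def by blast
  qed
  have ac: "AE t in lborel. t \<in> U \<sigma> \<xi> \<longrightarrow> \<xi> \<le> \<sigma> * g' t" if \<sigma>: "\<sigma> = 1 \<or> \<sigma> = - 1" for \<sigma> \<xi>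
  proof -
    \<comment> \<open>The set on which the claim fails; its Lebesgue measure turns out to vanish.\<close>
    define A where "A = {t \<in> U \<sigma> \<xi>. \<sigma> * g' t < \<xi>} - N"
    have "{t. \<sigma> * g' t < \<xi>} \<in> sets borel" by measurable
    moreover have "A = U \<sigma> \<xi> \<inter> {t. \<sigma> * g' t < \<xi>} - N" by (auto simp: A_def)
    ultimately have Ab: "A \<in> sets borel" using borel_open[OF U_open[of \<sigma> \<xi>]] Nb(1) by simp
    have Au: "A \<subseteq> unit_ivl" by (auto simp: A_def U_def)
    have As: "A \<in> sets borel_ivl" using Ab Au by (simp add: sets_borel_ivl)
    have "\<mu> A = 0"
    proof (rule signed_measure_null_total_variation[OF \<mu> Nc N(3) As])
      show "A \<subseteq> unit_ivl - N" using Au by (simp add: A_def subset_eq)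
    qed
    then have le: "\<xi> * measure lborel A \<le> \<sigma> * (LINT x|lborel. indicator A x * g' x)"
      using low[OF \<sigma> As] \<nu>_eq[OF As] by (auto simp: A_def)
    have "emeasure lborel A \<le> emeasure lborel unit_ivl" using Au by (intro emeasure_mono) auto
    also have "\<dots> < \<infinity>" by simp
    finally have fin: "integrable lborel (indicator A :: real \<Rightarrow> real)"
      using Ab by (intro integrable_real_indicator) simp_all
    have gA: "integrable lborel (\<lambda>x. indicator A x * g' x)"
      using g'(1) Ab by (intro integrable_indicator_mult) simp_all
    have mA: "(LINT x|lborel. indicator A x) = measure lborel A" using Ab by simp
    have "(LINT x|lborel. \<xi> * indicator A x - \<sigma> * (indicator A x * g' x))
       = \<xi> * measure lborel A - \<sigma> * (LINT x|lborel. indicator A x * g' x)"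
      unfolding mA[symmetric] using fin gA
      by (subst Bochner_Integration.integral_diff) (auto intro: integrable_mult_right)
    then have "(LINT x|lborel. \<xi> * indicator A x - \<sigma> * (indicator A x * g' x)) \<le> 0" using le by linarith
    moreover have nn: "0 \<le> \<xi> * indicator A x - \<sigma> * (indicator A x * g' x)" for x
      by (auto simp: A_def indicator_def)
    moreover have int: "integrable lborel (\<lambda>x. \<xi> * indicator A x - \<sigma> * (indicator A x * g' x))"
      using fin gA by (intro Bochner_Integration.integrable_diff integrable_mult_right)
    ultimately have "(LINT x|lborel. \<xi> * indicator A x - \<sigma> * (indicator A x * g' x)) = 0"
      by (intro antisym integral_nonneg_AE) auto
    then have "AE x in lborel. \<xi> * indicator A x - \<sigma> * (indicator A x * g' x) = 0"
      using integral_nonneg_eq_0_iff_AE[OF int] nn by simp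
    then show ?thesis using N_AE
    proof eventually_elim
      case (elim t)
      show ?case
      proof (intro impI, rule ccontr)
        assume "t \<in> U \<sigma> \<xi>" "\<not> \<xi> \<le> \<sigma> * g' t"
        then have "t \<in> A" using elim(2) by (simp add: A_def)
        then show False using elim(1) \<open>\<not> \<xi> \<le> \<sigma> * g' t\<close> by simp
      qed
    qed
  qed
  have "AE t in lborel. \<forall>q :: rat. (t \<in> U 1 (of_rat q) \<longrightarrow> of_rat q \<le> 1 * g' t) \<and>
      (t \<in> U (- 1) (of_rat q) \<longrightarrow> of_rat q \<le> - 1 * g' t)"
    unfolding AE_all_countable by (intro allI AE_conjI ac) auto
  then show "AE x in lborel. x \<in> unit_ivl \<longrightarrow> curvature_flux (g x) = p x"
    using g'(3)
  proof eventually_elim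
    case (elim t)
    show ?case
    proof
      assume t: "t \<in> unit_ivl"
      have "\<not> curvature_flux (g' t) < p t"
      proof
        assume "curvature_flux (g' t) < p t"
        then obtain q :: rat where q: "g' t < of_rat q" "curvature_flux (of_rat q) < p t"
          by (rule rational_slope_between)
        then show False using elim(1) t by (auto simp: U_def dest!: spec[of _ q])
      qed
      moreover have "\<not> curvature_flux (- g' t) < - p t"
      proof
        assume "curvature_flux (- g' t) < - p t"
        then obtain q :: rat where q: "- g' t < of_rat q" "curvature_flux (of_rat q) < - p t"
          by (rule rational_slope_between)
        then show False using elim(1) t by (auto simp: U_def dest!: spec[of _ q])
      qed
      ultimately show "curvature_flux (g t) = p t"
        using elim(2) t by (simp add: curvature_flux_minus)
    qed
  qed
  let ?T = "total_variation borel_ivl \<mu>" and ?s = "polar_density borel_ivl \<mu>"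
  have sm [measurable]: "?s \<in> borel_measurable ?T" using integrable_polar_density[OF \<mu>] by auto
  have sing: "0 \<le> \<sigma> * \<mu> A" if \<sigma>: "\<sigma> = 1 \<or> \<sigma> = - 1" and A: "A \<in> sets borel_ivl" "A \<subseteq> U \<sigma> \<xi>" for \<sigma> \<xi> A
  proof -
    have AN: "A \<inter> N \<in> sets borel_ivl" "A - N \<in> sets borel_ivl" using A(1) N(1) by auto
    have "measure lborel (A \<inter> N) = 0"
      using N0 Nb A(1) emeasure_mono[of "A \<inter> N" N lborel] by (simp add: measure_def sets_borel_ivl)
    have "AE x in lborel. indicator (A \<inter> N) x * g' x = 0"
      using N_AE by eventually_elim simp
    then have "(LINT x|lborel. indicator (A \<inter> N) x * g' x) = 0" by (rule integral_eq_zero_AE)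
    then have "0 \<le> \<sigma> * \<mu> (A \<inter> N)"
      using low[OF \<sigma> AN(1), of \<xi>] \<nu>_eq[OF AN(1)] A(2) \<open>measure lborel (A \<inter> N) = 0\<close> by auto
    moreover have "\<mu> (A - N) = 0"
    proof (rule signed_measure_null_total_variation[OF \<mu> Nc N(3) AN(2)])
      show "A - N \<subseteq> unit_ivl - N" using A(1) by (auto simp: sets_borel_ivl)
    qed
    moreover have "\<mu> ((A \<inter> N) \<union> (A - N)) = \<mu> (A \<inter> N) + \<mu> (A - N)"
      using AN by (intro signed_measure_Un[OF \<mu>]) auto
    moreover have "(A \<inter> N) \<union> (A - N) = A" by auto
    ultimately show ?thesis by simp
  qed
  have sign: "AE t in ?T. t \<in> U \<sigma> \<xi> \<longrightarrow> 0 \<le> \<sigma> * ?s t" if \<sigma>: "\<sigma> = 1 \<or> \<sigma> = - 1" for \<sigma> \<xi>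
  proof -
    \<comment> \<open>The set on which the claim fails; it turns out to be null for the variation.\<close>
    define A where "A = {t \<in> space ?T. \<sigma> * ?s t < 0} \<inter> U \<sigma> \<xi>"
    have "{t \<in> space ?T. \<sigma> * ?s t < 0} \<in> sets ?T" by measurable
    then have As: "A \<in> sets borel_ivl" unfolding A_def using U_sets by auto
    have int: "integrable ?T (\<lambda>t. - (\<sigma> * (indicator A t * ?s t)))"
      using integrable_polar_density[OF \<mu>] As
      by (intro Bochner_Integration.integrable_minus integrable_mult_right integrable_indicator_mult) auto
    have nn: "0 \<le> - (\<sigma> * (indicator A t * ?s t))" for t by (auto simp: A_def indicator_def)
    have "0 \<le> \<sigma> * \<mu> A" by (rule sing[OF \<sigma> As, of \<xi>]) (simp add: A_def)
    also have "\<mu> A = (LINT t|?T. indicator A t * ?s t)"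
      unfolding signed_measure_eq_integral[OF \<mu> As] set_lebesgue_integral_def by simp
    finally have "(LINT t|?T. - (\<sigma> * (indicator A t * ?s t))) \<le> 0" by simp
    then have "(LINT t|?T. - (\<sigma> * (indicator A t * ?s t))) = 0"
      using nn by (intro antisym integral_nonneg_AE) auto
    then have "AE t in ?T. - (\<sigma> * (indicator A t * ?s t)) = 0"
      using integral_nonneg_eq_0_iff_AE[OF int] nn by simp
    then show ?thesis using AE_space
    proof eventually_elim
      case (elim t)
      show ?case
      proof (intro impI, rule ccontr)
        assume "t \<in> U \<sigma> \<xi>" "\<not> 0 \<le> \<sigma> * ?s t"
        then have "t \<in> A" using elim(2) by (simp add: A_def)
        then show False using elim(1) \<open>\<not> 0 \<le> \<sigma> * ?s t\<close> by auto
      qed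
    qed
  qed
  have "AE t in ?T. \<forall>k :: nat. (t \<in> U 1 (- real k) \<longrightarrow> 0 \<le> 1 * ?s t) \<and> (t \<in> U (- 1) (- real k) \<longrightarrow> 0 \<le> - 1 * ?s t)"
    unfolding AE_all_countable by (intro allI AE_conjI sign) auto
  then show "AE x in ?T. ?s x = p x"
    using AE_abs_polar_density[OF \<mu>] AE_space
  proof eventually_elim
    case (elim t)
    have t: "t \<in> unit_ivl" using elim(3) by simp
    have 1: "0 \<le> ?s t" if pt: "- 1 < p t"
    proof -
      obtain k :: nat where "curvature_flux (- real k) < p t" 
        using curvature_flux_near_minus_one[OF pt] by blast
      then show ?thesis using elim(1) t by (auto simp: U_def)
    qed
    have 2: "?s t \<le> 0" if pt: "p t < 1"
    proof -
      obtain k :: nat where "curvature_flux (- real k) < - p t" 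
        using curvature_flux_near_minus_one[of "- p t"] pt by auto
      then show ?thesis using elim(1) t by (auto simp: U_def)
    qed
    consider "p t = 1" | "p t = - 1" | "- 1 < p t" "p t < 1" using p(2)[of t] by linarith
    then show ?case
    proof cases
      case 1
      then show ?thesis using \<open>- 1 < p t \<Longrightarrow> 0 \<le> ?s t\<close> elim(2) by simp
    next
      case 2
      then show ?thesis using \<open>p t < 1 \<Longrightarrow> ?s t \<le> 0\<close> elim(2) by simp
    next
      case 3
      then show ?thesis using 1 2 elim(2) by simp
    qed
  qed
qed

section \<open>Existence of a positive solution\<close>

lemma borel_measurable_lebesgue_indicator_mult:
  assumes "set_integrable lebesgue unit_ivl (k :: real \<Rightarrow> real)"
  shows "(\<lambda>x. indicator unit_ivl x * k x) \<in> borel_measurable lebesgue"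
  using assms borel_measurable_integrable by (simp add: set_integrable_def)

text \<open>
  By absolute continuity of \<open>\<bar>D\<phi>\<^sup>s\<bar>\<close> with respect to \<open>\<bar>Du\<^sup>s\<bar>\<close>, the identity between the polar density
  and \<open>p\<close> also holds almost everywhere for the measure in the weak formulation. Both terms on its
  left then become integrals of \<open>p\<close> against \<open>D\<phi>\<close>.
\<close>

theorem bv_solution_if_flux_inclusion:
  assumes a: "set_integrable lebesgue unit_ivl a"
    and b: "integrable lborel b" "\<And>x. x \<notin> unit_ivl \<Longrightarrow> b x = 0"
      "AE x in lborel. indicator unit_ivl x * a x = b x"
    and fm: "f \<in> borel_measurable borel" and u: "u \<in> BV" and um: "u \<in> borel_measurable borel"
    and ri: "integrable lborel (\<lambda>x. - lam * (b x * f (u x)))" and r0: "(LINT x|lborel. b x * f (u x)) = 0"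
    and ac: "AE x in lborel. x \<in> unit_ivl \<longrightarrow>
       curvature_flux (deriv_ac u x) = primitive (\<lambda>x. - lam * (b x * f (u x))) x"
    and sing: "AE x in total_variation borel_ivl (deriv_sing u).
       polar_density borel_ivl (deriv_sing u) x = primitive (\<lambda>x. - lam * (b x * f (u x))) x"
  shows "bv_solution a f lam u"
  unfolding bv_solution_def
proof (intro conjI u ballI impI)
  fix \<phi> assume \<phi>: "\<phi> \<in> BV"
    and abs: "absolutely_continuous (total_variation borel_ivl (deriv_sing u)) (total_variation borel_ivl (deriv_sing \<phi>))"
  define r where "r x = - lam * (b x * f (u x))" for x
  define p where "p = primitive r"
  have p: "p = primitive (\<lambda>x. - lam * (b x * f (u x)))" by (simp add: p_def r_def[abs_def])
  have rr: "integrable lborel r" "\<And>x. x \<notin> unit_ivl \<Longrightarrow> r x = 0" "(LINT x|lborel. r x) = 0"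
    using ri r0 b(2) by (simp_all add: r_def[abs_def])
  have pm [measurable]: "p \<in> borel_measurable borel" unfolding p_def using rr(1) by measurable
  have decu: "lebesgue_decomp (distr_deriv u) (deriv_ac u) (deriv_sing u)" by (rule lebesgue_decomp_deriv[OF u])
  have dec\<phi>: "lebesgue_decomp (distr_deriv \<phi>) (deriv_ac \<phi>) (deriv_sing \<phi>)" by (rule lebesgue_decomp_deriv[OF \<phi>])
  have m [measurable]: "(\<lambda>x. indicator unit_ivl x * deriv_ac u x) \<in> borel_measurable lebesgue"
    "(\<lambda>x. indicator unit_ivl x * deriv_ac \<phi> x) \<in> borel_measurable lebesgue"
    "(\<lambda>x. indicator unit_ivl x * a x) \<in> borel_measurable lebesgue"
    "(\<lambda>x. indicator unit_ivl x * \<phi> x) \<in> borel_measurable lebesgue"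
    using decu dec\<phi> a \<phi> by (auto intro!: borel_measurable_lebesgue_indicator_mult simp: lebesgue_decomp_def BV_def)
  have lm [measurable]: "p \<in> borel_measurable lebesgue" "u \<in> borel_measurable lebesgue"
    "b \<in> borel_measurable lebesgue" "(\<lambda>x. f (u x)) \<in> borel_measurable lebesgue"
    using pm um b(1) measurable_compose[OF um fm] by (auto intro: measurable_completion)
  have "(LINT x:unit_ivl|lebesgue. deriv_ac u x * deriv_ac \<phi> x / sqrt (1 + (deriv_ac u x)\<^sup>2))
      = (LINT x:unit_ivl|lebesgue. p x * deriv_ac \<phi> x)"
    unfolding set_lebesgue_integral_def
  proof (rule integral_cong_AE)
    have "(\<lambda>x. (indicator unit_ivl x * deriv_ac u x) * (indicator unit_ivl x * deriv_ac \<phi> x) /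
        sqrt (1 + (indicator unit_ivl x * deriv_ac u x)\<^sup>2)) \<in> borel_measurable lebesgue"
      by measurable
    moreover have "indicator unit_ivl x *\<^sub>R (deriv_ac u x * deriv_ac \<phi> x / sqrt (1 + (deriv_ac u x)\<^sup>2)) =
       (indicator unit_ivl x * deriv_ac u x) * (indicator unit_ivl x * deriv_ac \<phi> x) /
        sqrt (1 + (indicator unit_ivl x * deriv_ac u x)\<^sup>2)" for x
      by (cases "x \<in> unit_ivl") auto
    ultimately show "(\<lambda>x. indicator unit_ivl x *\<^sub>R (deriv_ac u x * deriv_ac \<phi> x / sqrt (1 + (deriv_ac u x)\<^sup>2)))
       \<in> borel_measurable lebesgue" by simp
    have "(\<lambda>x. p x * (indicator unit_ivl x * deriv_ac \<phi> x)) \<in> borel_measurable lebesgue" by measurable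
    then show "(\<lambda>x. indicator unit_ivl x *\<^sub>R (p x * deriv_ac \<phi> x)) \<in> borel_measurable lebesgue"
      by (simp add: mult.left_commute)
    show "AE x in lebesgue. indicator unit_ivl x *\<^sub>R (deriv_ac u x * deriv_ac \<phi> x / sqrt (1 + (deriv_ac u x)\<^sup>2)) =
       indicator unit_ivl x *\<^sub>R (p x * deriv_ac \<phi> x)"
      using AE_completion[OF ac]
    proof eventually_elim
      case (elim x)
      show ?case
      proof (cases "x \<in> unit_ivl")
        case True
        then have "p x = curvature_flux (deriv_ac u x)" using elim by (simp add: p)
        then show ?thesis by (simp add: curvature_flux_def)
      qed simp
    qed
  qed
  moreover have "signed_integral borel_ivl (deriv_sing \<phi>) (polar_density borel_ivl (deriv_sing u))
     = signed_integral borel_ivl (deriv_sing \<phi>) p"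
    unfolding signed_integral_def
  proof (rule integral_cong_AE)
    let ?T = "total_variation borel_ivl (deriv_sing \<phi>)"
    have \<mu>u: "signed_measure borel_ivl (deriv_sing u)" and \<mu>\<phi>: "signed_measure borel_ivl (deriv_sing \<phi>)"
      using decu dec\<phi> by (auto simp: lebesgue_decomp_def)
    have s1: "polar_density borel_ivl (deriv_sing \<phi>) \<in> borel_measurable ?T"
      using integrable_polar_density[OF \<mu>\<phi>] by auto
    have "polar_density borel_ivl (deriv_sing u) \<in> borel_measurable (total_variation borel_ivl (deriv_sing u))"
      using integrable_polar_density[OF \<mu>u] by auto
    then have s2: "polar_density borel_ivl (deriv_sing u) \<in> borel_measurable ?T"
      by (simp cong: measurable_cong_sets)
    show "(\<lambda>x. polar_density borel_ivl (deriv_sing u) x * polar_density borel_ivl (deriv_sing \<phi>) x) \<in> borel_measurable ?T"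
      using s2 s1 by (rule borel_measurable_times)
    show "(\<lambda>x. p x * polar_density borel_ivl (deriv_sing \<phi>) x) \<in> borel_measurable ?T"
      using borel_measurable_total_variation[OF pm] s1 by (rule borel_measurable_times)
    have "AE x in ?T. polar_density borel_ivl (deriv_sing u) x = p x"
      using absolutely_continuous_AE[OF _ abs sing] by (simp add: p)
    then show "AE x in ?T. polar_density borel_ivl (deriv_sing u) x * polar_density borel_ivl (deriv_sing \<phi>) x
       = p x * polar_density borel_ivl (deriv_sing \<phi>) x"
      by eventually_elim simp
  qed
  moreover have "(LINT x:unit_ivl|lebesgue. p x * deriv_ac \<phi> x) + signed_integral borel_ivl (deriv_sing \<phi>) p
     = - (LINT x:unit_ivl|lebesgue. r x * \<phi> x)"
    unfolding p_def by (rule BV_integration_by_parts[OF \<phi> rr])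
  moreover have "- (LINT x:unit_ivl|lebesgue. r x * \<phi> x) = (LINT x:unit_ivl|lebesgue. - (r x * \<phi> x))"
    by (simp add: set_lebesgue_integral_def)
  moreover have "(LINT x:unit_ivl|lebesgue. - (r x * \<phi> x)) = (LINT x:unit_ivl|lebesgue. lam * a x * f (u x) * \<phi> x)"
    unfolding set_lebesgue_integral_def
  proof (rule integral_cong_AE)
    have "(\<lambda>x. lam * b x * f (u x) * (indicator unit_ivl x * \<phi> x)) \<in> borel_measurable lebesgue" by measurable
    then show "(\<lambda>x. indicator unit_ivl x *\<^sub>R (- (r x * \<phi> x))) \<in> borel_measurable lebesgue"
      by (simp add: r_def mult_ac)
    have "(\<lambda>x. lam * (indicator unit_ivl x * a x) * f (u x) * (indicator unit_ivl x * \<phi> x)) \<in> borel_measurable lebesgue"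
      by measurable
    moreover have "indicator unit_ivl x *\<^sub>R (lam * a x * f (u x) * \<phi> x) =
       lam * (indicator unit_ivl x * a x) * f (u x) * (indicator unit_ivl x * \<phi> x)" for x
      by (cases "x \<in> unit_ivl") auto
    ultimately show "(\<lambda>x. indicator unit_ivl x *\<^sub>R (lam * a x * f (u x) * \<phi> x)) \<in> borel_measurable lebesgue"
      by (simp only:)
    show "AE x in lebesgue. indicator unit_ivl x *\<^sub>R (- (r x * \<phi> x)) = indicator unit_ivl x *\<^sub>R (lam * a x * f (u x) * \<phi> x)"
      using AE_completion[OF b(3)]
    proof eventually_elim
      case (elim x)
      then show ?case by (cases "x \<in> unit_ivl") (auto simp: r_def)
    qed
  qed
  ultimately show "(LINT x:unit_ivl|lebesgue. deriv_ac u x * deriv_ac \<phi> x / sqrt (1 + (deriv_ac u x)\<^sup>2))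
      + signed_integral borel_ivl (deriv_sing \<phi>) (polar_density borel_ivl (deriv_sing u))
      = (LINT x:unit_ivl|lebesgue. lam * a x * f (u x) * \<phi> x)"
    by simp
qed

text \<open>
  A nonnegative function whose essential supremum is not positive vanishes almost everywhere.
\<close>

lemma positive_funI:
  assumes um: "u \<in> borel_measurable borel" and nonneg: "\<And>x. x \<in> unit_ivl \<Longrightarrow> 0 \<le> u x"
    and nz: "\<not> (AE x in lborel. x \<in> unit_ivl \<longrightarrow> u x = 0)"
  shows "positive_fun u"
proof -
  let ?L = "lebesgue_on unit_ivl"
  have ul: "u \<in> borel_measurable ?L"
    using um by (intro measurable_restrict_space1 measurable_completion) simp
  have m1: "(\<lambda>x. - ereal (u x)) \<in> borel_measurable ?L" using ul by measurable
  have m2: "(\<lambda>x. ereal (u x)) \<in> borel_measurable ?L" using ul by measurable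
  have "esssup ?L (\<lambda>x. - ereal (u x)) \<le> 0"
    using m1 nonneg by (intro esssup_I) (auto intro!: AE_I2 simp: space_restrict_space)
  then have 1: "- esssup ?L (\<lambda>x. - ereal (u x)) \<ge> 0" by (simp add: ereal_uminus_le_reorder)
  have 2: "esssup ?L (\<lambda>x. ereal (u x)) > 0"
  proof (rule ccontr)
    assume "\<not> ?thesis"
    then have le: "esssup ?L (\<lambda>x. ereal (u x)) \<le> 0" by simp
    have "AE x in ?L. ereal (u x) \<le> esssup ?L (\<lambda>x. ereal (u x))" by (rule esssup_AE)
    then have "AE x in ?L. u x \<le> 0"
    proof eventually_elim
      case (elim x)
      then have "ereal (u x) \<le> 0" using le by (rule order_trans)
      then show ?case by simp
    qed
    then have "AE x in lebesgue. x \<in> unit_ivl \<longrightarrow> u x \<le> 0"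
      by (subst (asm) AE_restrict_space_iff) auto
    then have "AE x in lborel. x \<in> unit_ivl \<longrightarrow> u x \<le> 0" by (simp add: AE_completion_iff)
    then have "AE x in lborel. x \<in> unit_ivl \<longrightarrow> u x = 0"
      by eventually_elim (use nonneg in force)
    then show False using nz by blast
  qed
  show ?thesis unfolding positive_fun_def using 1 2 by simp
qed

text \<open>
  Since \<open>q < 1\<close>, the function \<open>f\<close> eventually dominates \<open>(h/2)/s\<close>, and \<open>F\<close> grows at least like a
  logarithm.
\<close>

lemma primitive_tendsto_infinity:
  assumes F: "\<And>s. (F has_real_derivative g s) (at s)"
    and g: "\<And>s. 0 < s \<Longrightarrow> g s = f s"
    and h: "h > 0" and q: "q < 1" and lim: "((\<lambda>s. f s / s powr (- q)) \<longlongrightarrow> h) at_top"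
  shows "filterlim F at_top at_top"
proof -
  have "\<forall>\<^sub>F s in at_top. h / 2 < f s / s powr (- q)" using lim h by (intro order_tendstoD) auto
  then obtain S0 where S0: "\<And>s. s \<ge> S0 \<Longrightarrow> h / 2 < f s / s powr (- q)" by (auto simp: eventually_at_top_linorder)
  define S where "S = max S0 1"
  have low: "h / 2 / s \<le> g s" if s: "S \<le> s" for s
  proof -
    have s1: "1 \<le> s" using s by (simp add: S_def)
    have "h / 2 / s = h / 2 * s powr (- 1)" using s1 by (simp add: powr_minus_divide)
    also have "\<dots> \<le> h / 2 * s powr (- q)" using s1 q h by (intro mult_left_mono powr_mono) auto
    also have "\<dots> \<le> f s" using S0[of s] s s1 by (simp add: S_def field_simps)
    finally show ?thesis using g[of s] s1 by simp
  qed
  have FS: "F S + h / 2 * (ln s - ln S) \<le> F s" if s: "S \<le> s" for s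
  proof -
    have "(\<lambda>t. F t - h / 2 * ln t) S \<le> (\<lambda>t. F t - h / 2 * ln t) s"
    proof (rule DERIV_nonneg_imp_nondecreasing[OF s])
      fix t assume t: "S \<le> t" "t \<le> s"
      then have "t > 0" by (simp add: S_def)
      then have "((\<lambda>t. F t - h / 2 * ln t) has_real_derivative g t - h / 2 * (1 / t)) (at t)"
        by (auto intro!: derivative_eq_intros F)
      moreover have "0 \<le> g t - h / 2 * (1 / t)" using low[OF t(1)] by simp
      ultimately show "\<exists>y. ((\<lambda>t. F t - h / 2 * ln t) has_real_derivative y) (at t) \<and> 0 \<le> y" by blast
    qed
    then have "F S - h / 2 * ln S \<le> F s - h / 2 * ln s" by simp
    then show ?thesis unfolding right_diff_distrib by linarith
  qed
  have "filterlim (\<lambda>s. (F S - h / 2 * ln S) + h / 2 * ln s) at_top at_top"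
    using h by (intro filterlim_tendsto_add_at_top[OF tendsto_const]
        filterlim_tendsto_pos_mult_at_top[OF tendsto_const _ ln_at_top]) auto
  then show ?thesis
  proof (rule filterlim_at_top_mono)
    show "\<forall>\<^sub>F s in at_top. (F S - h / 2 * ln S) + h / 2 * ln s \<le> F s"
      using eventually_ge_at_top[of S]
    proof eventually_elim
      case (elim s)
      from FS[OF elim] show ?case unfolding right_diff_distrib by linarith
    qed
  qed
qed

text \<open>
  Beyond the results above, only the truncation \<open>g s = f (max s 0)\<close> is new: it makes the potential
  flat on the negative half line and agrees with \<open>f\<close> on the range of the nonnegative solution.
\<close>

theorem theorem3p1:
  fixes a f :: "real \<Rightarrow> real" and h q lam0 :: real
  assumes "set_integrable lebesgue {0<..<1} a"
    and "(LINT x:{0<..<1}|lebesgue. a x) < 0"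
    and "emeasure lebesgue {x \<in> {0<..<1}. a x > 0} > 0"
    and "continuous_on UNIV f"
    and "f 0 = 0"
    and "\<And>s. s > 0 \<Longrightarrow> f s > 0"
    and "h > 0" and "0 < q" and "q < 1"
    and "((\<lambda>s. f s / s) \<longlongrightarrow> 1) (at_right 0)"
    and "((\<lambda>s. f s / s powr (- q)) \<longlongrightarrow> h) at_top"
    and "positive_principal_eigenvalue a lam0"
  shows "\<forall>lam>lam0. \<exists>u. bv_solution a f lam u \<and> positive_fun u"
proof (intro allI impI)
  fix lam assume lam: "lam0 < lam"
  note a = assms(1) and f = assms(4,5,6)
  obtain \<phi> where lam0: "lam0 > 0" and \<phi>: "neumann_eigenfunction a lam0 \<phi>" "\<And>x. x \<in> {0..1} \<Longrightarrow> \<phi> x > 0"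
    using assms(12) unfolding positive_principal_eigenvalue_def by blast
  obtain b where b: "integrable lborel b" "\<And>x. x \<notin> unit_ivl \<Longrightarrow> b x = 0"
    "AE x in lborel. indicator unit_ivl x * a x = b x"
    using borel_representative[OF a] by blast
  have "(LINT x:unit_ivl|lebesgue. a x) = (LINT x|lborel. b x)"
    using integral_borel_representative[OF a _ b(3), of "\<lambda>_. 1"] b(1) by simp
  then have b_neg: "(LINT x|lborel. b x) < 0" using assms(2) by simp
  define g where "g s = f (max s 0)" for s
  have g_nonneg: "0 \<le> g s" for s
    using f(2) f(3)[of s] by (cases "s > 0") (auto simp: g_def max_def less_imp_le)
  have gf: "g s = f s" if "0 \<le> s" for s using that by (simp add: g_def max_def)
  have gc: "continuous_on UNIV g"
    unfolding g_def by (intro continuous_on_compose2[OF f(1)] continuous_intros) auto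
  have g_lim: "(g \<longlongrightarrow> 0) at_top"
  proof -
    have "((\<lambda>s. s powr (- q)) \<longlongrightarrow> 0) at_top"
      using assms(8) by (intro tendsto_neg_powr filterlim_ident) auto
    then have "((\<lambda>s. f s / s powr (- q) * s powr (- q)) \<longlongrightarrow> h * 0) at_top"
      by (intro tendsto_mult assms(11))
    moreover have "\<forall>\<^sub>F s in at_top. f s / s powr (- q) * s powr (- q) = g s"
      using eventually_gt_at_top[of 0] by eventually_elim (simp add: gf)
    ultimately show ?thesis by (simp add: tendsto_cong)
  qed
  have g_0: "((\<lambda>s. g s / s) \<longlongrightarrow> 1) (at_right 0)"
  proof -
    have "\<forall>\<^sub>F s in at_right 0. f s / s = g s / s"
      using eventually_at_right_less[of 0] by eventually_elim (simp add: gf)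
    with assms(10) show ?thesis by (rule Lim_transform_eventually)
  qed
  have "\<exists>F. \<forall>x :: real. -\<infinity> < ereal x \<longrightarrow> ereal x < \<infinity> \<longrightarrow> (F has_vector_derivative g x) (at x)"
    using gc by (intro einterval_antiderivative) (auto simp: continuous_on_eq_continuous_at)
  then obtain F0 where F0: "\<And>x. (F0 has_real_derivative g x) (at x)"
    by (auto simp: has_real_derivative_iff_has_vector_derivative)
  define F where "F s = F0 s - F0 0" for s
  have F: "(F has_real_derivative g s) (at s)" for s
    unfolding F_def by (auto intro!: derivative_eq_intros F0)
  have F_0: "F 0 = 0" by (simp add: F_def)
  have F_neg: "F s = 0" if "s \<le> 0" for s
  proof (cases "s = 0")
    case False
    have "F 0 = F s"
    proof (rule DERIV_isconst_end[where f=F and a=s and b=0])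
      show "s < 0" using that False by simp
      show "continuous_on {s..0} F"
        using F by (intro continuous_at_imp_continuous_on ballI) (rule DERIV_isCont)
      fix x assume "s < x" "x < 0"
      then show "(F has_real_derivative 0) (at x)"
        using F[of x] f(2) by (simp add: g_def max_def)
    qed
    then show ?thesis by (simp add: F_0)
  qed (simp add: F_0)
  have F_lim: "filterlim F at_top at_top"
    by (rule primitive_tendsto_infinity[OF F _ assms(7,9,11)]) (simp add: gf)
  obtain c \<rho> where \<rho>: "integrable lborel \<rho>" "\<And>x. x \<notin> unit_ivl \<Longrightarrow> \<rho> x = 0"
    "integrable lborel (\<lambda>x. (\<rho> x)\<^sup>2)" "\<And>x. 0 < c + primitive \<rho> x"
    "(LINT x|lborel. (\<rho> x)\<^sup>2) = lam0 * (LINT x|lborel. b x * (c + primitive \<rho> x)\<^sup>2)"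
    by (rule eigenfunction_primitive[OF \<phi> b]; (assumption | (rule that; assumption)))
  have g00: "g 0 = 0" using f(2) by (simp add: g_def)
  have "\<exists>\<delta>>0. \<forall>\<^sub>F n in sequentially. \<exists>w. discrete_energy n (\<lambda>i. lam * cell_integral b n i) F w \<le> - \<delta>"
    by (rule discrete_energy_eventually_negative[OF b(1,2) b_neg \<rho> lam0 lam F F_0 g_0 g00])
  then obtain \<delta> where \<delta>: "\<delta> > 0"
    "\<forall>\<^sub>F n in sequentially. \<exists>w. discrete_energy n (\<lambda>i. lam * cell_integral b n i) F w \<le> - \<delta>"
    by (elim exE conjE)
  have lamp: "lam > 0" using lam lam0 by simp
  obtain P N R where PN: "mono P" "mono N" "\<And>x. continuous (at_right x) P" "\<And>x. continuous (at_right x) N"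
    "\<And>x. \<bar>P x\<bar> \<le> R" "\<And>x. \<bar>N x\<bar> \<le> R"
    and nonneg: "\<And>x. x \<in> unit_ivl \<Longrightarrow> 0 \<le> P x - N x"
    and nz: "\<not> (AE x in lborel. x \<in> unit_ivl \<longrightarrow> P x - N x = 0)"
    and tot: "(LINT x|lborel. b x * g (P x - N x)) = 0"
    and p1: "\<And>x. \<bar>primitive (\<lambda>x. - lam * (b x * g (P x - N x))) x\<bar> \<le> 1"
    and ctrl: "flux_controls_increments (primitive (\<lambda>x. - lam * (b x * g (P x - N x)))) (\<lambda>x. P x - N x)"
    by (rule continuum_limit[OF b(1,2) b_neg lamp F F_neg g_nonneg g_lim gc F_lim \<delta>];
        (assumption | (rule that; assumption)))
  define u where "u x = P x - N x" for x
  have [measurable]: "P \<in> borel_measurable borel" "N \<in> borel_measurable borel"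
    using PN(1,2) by (auto intro: borel_measurable_mono)
  have um [measurable]: "u \<in> borel_measurable borel" unfolding u_def by measurable
  have fm [measurable]: "f \<in> borel_measurable borel" using f(1) by (rule borel_measurable_continuous_onI)
  have bg: "b x * g (P x - N x) = b x * f (u x)" for x
    using b(2)[of x] nonneg[of x] by (cases "x \<in> unit_ivl") (simp_all add: gf u_def)
  define p where "p = primitive (\<lambda>x. - lam * (b x * f (u x)))"
  have ri: "integrable lborel (\<lambda>x. - lam * (b x * f (u x)))"
  proof -
    have "compact (f ` {- 2 * R..2 * R})"
      using f(1) by (intro compact_continuous_image) (auto intro: continuous_on_subset)
    then have "bounded (f ` {- 2 * R..2 * R})" by (rule compact_imp_bounded)
    then have "\<exists>C. \<forall>s\<in>{- 2 * R..2 * R}. \<bar>f s\<bar> \<le> C" by (auto simp: bounded_iff)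
    then obtain C where C: "\<And>s. s \<in> {- 2 * R..2 * R} \<Longrightarrow> \<bar>f s\<bar> \<le> C" by blast
    have "u x \<in> {- 2 * R..2 * R}" for x
      using PN(5)[of x] PN(6)[of x] unfolding u_def abs_le_iff atLeastAtMost_iff by linarith
    then have "\<bar>f (u x)\<bar> \<le> C" for x using C by blast
    then have "integrable lborel (\<lambda>x. b x * f (u x))"
      by (intro integrable_mult_bounded[OF b(1)]) auto
    then show ?thesis by simp
  qed
  have pc: "continuous_on UNIV p" unfolding p_def by (rule continuous_primitive[OF ri])
  define \<nu> where "\<nu> A = measure (interval_measure P) A - measure (interval_measure N) A" for A
  note D = has_distr_deriv_monotone_difference[OF PN(1,3,5) PN(2,4,6), folded \<nu>_def[abs_def] u_def]
  have uBV: "u \<in> BV" unfolding BV_def using D(1,2) by (auto simp: u_def[abs_def])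
  have Du: "has_distr_deriv u \<nu>" using D(2) by (simp add: u_def[abs_def])
  have ui: "set_integrable lebesgue unit_ivl u" using D(1) by (simp add: u_def[abs_def])
  have \<nu>: "signed_measure borel_ivl \<nu>" using Du by (simp add: has_distr_deriv_def)
  have \<nu>_eq: "distr_deriv u A = \<nu> A" if "A \<in> sets borel_ivl" for A
    by (rule distr_deriv_unique[OF ui has_distr_deriv_distr_deriv[OF uBV] Du that])
  have dec: "lebesgue_decomp \<nu> (deriv_ac u) (deriv_sing u)"
    using lebesgue_decomp_deriv[OF uBV] \<nu>_eq by (auto simp: lebesgue_decomp_def)
  have p1': "\<bar>p x\<bar> \<le> 1" for x using p1[of x] unfolding bg p_def .
  have ctrl': "flux_controls_increments p u" using ctrl unfolding bg p_def u_def[abs_def] .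
  have \<nu>cdf: "distribution_function \<nu> x = u x - u 0" if "x \<in> unit_ivl" for x
    using D(3)[OF that] by (simp add: u_def \<nu>_def)
  note incl = flux_inclusion[OF \<nu> \<nu>cdf dec pc p1' ctrl', unfolded p_def]
  have "bv_solution a f lam u"
    using tot unfolding bg by (intro bv_solution_if_flux_inclusion[OF a b fm uBV um ri _ incl])
  moreover have "positive_fun u"
    using nonneg nz unfolding u_def[symmetric] by (intro positive_funI um)
  ultimately show "\<exists>u. bv_solution a f lam u \<and> positive_fun u" by blast
qed

end
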